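(* The following three sequences of theories $(A_n)$, $(B_n)$, $(C_n)$ are pairwise $O(1)$-equivalent: $A_n$ is $\mathsf{PA}$ plus the single axiom $\mathrm{C}(r_n)\ge n$; $B_n$ is $\mathsf{PA}$ plus, for each string $x$ with $\mathrm{C}(x)\le n$, an axiom stating the exact value of $\mathrm{C}(x)$, plus an axiom stating that all strings other than these have complexity greater than $n$; $C_n$ is $\mathsf{PA}$ plus all true $\mathrm{\Pi}_1$-statements of complexity at most $n$.
   Context: $\mathsf{PA}$ is Peano arithmetic; "true" means true in the standard model. $\mathrm{C}$ is plain Kolmogorov complexity, represented in $\mathsf{PA}$ as $\mathrm{C}_D(x)=\min\{|p|:D(p)=x\}$ for a provably optimal interpreter $D$ (for every partial computable $D'$ there is $c$ with $\mathsf{PA}\vdash\forall x\,[\mathrm{C}_D(x)\le\mathrm{C}_{D'}(x)+c]$). $r_n$ denotes the lexicographically first binary string of length $n$ with $\mathrm{C}(r_n)\ge n$. Complexity of $\mathrm{\Pi}_1$-statements: a $\mathrm{\Pi}_1$-formula $U(x)$ is universal if for every closed $\mathrm{\Pi}_1$-statement $T$ there is a string $t$ with $\mathsf{PA}\vdash[T\Leftrightarrow U(t)]$; the $U$-complexity of $T$ is the minimal length of such $t$; one fixes an optimal universal $U$ (one whose complexity function is minimal up to an additive constant among all universal formulas) and calls the $U$-complexity simply the complexity. For theories $U,V$, $U\subset V$ means every theorem of $U$ is a theorem of $V$. Sequences of theories $(T_n)$ and $(S_n)$ are $O(1)$-equivalent if there is a constant $c$ such that $T_n\subset S_{n+c}$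 and $S_n\subset T_{n+c}$ for all $n$. *)

theory Defs
  imports
    "HOL-Library.Extended_Nat"
    "HOL-Library.List_Lexorder"
    "HOL-Number_Theory.Cong"
begin

section \<open>First-order arithmetic\<close>

text \<open>Formulas use de Bruijn indices: \<open>Forall \<phi>\<close> binds the variable \<open>Var 0\<close> of \<open>\<phi>\<close>.\<close>

datatype tm = Var nat | Zero | Succ tm | Add tm tm | Mul tm tm

datatype fm = Bot | Eql tm tm | Impl fm fm | Forall fm

definition Neg :: "fm \<Rightarrow> fm" where
  "Neg \<phi> = Impl \<phi> Bot"

definition Conj :: "fm \<Rightarrow> fm \<Rightarrow> fm" where
  "Conj \<phi> \<psi> = Neg (Impl \<phi> (Neg \<psi>))"

definition Disj :: "fm \<Rightarrow> fm \<Rightarrow> fm" where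
  "Disj \<phi> \<psi> = Impl (Neg \<phi>) \<psi>"

definition Iff :: "fm \<Rightarrow> fm \<Rightarrow> fm" where
  "Iff \<phi> \<psi> = Conj (Impl \<phi> \<psi>) (Impl \<psi> \<phi>)"

definition Exists :: "fm \<Rightarrow> fm" where
  "Exists \<phi> = Neg (Forall (Neg \<phi>))"

definition Conjs :: "fm list \<Rightarrow> fm" where
  "Conjs \<phi>s = foldr Conj \<phi>s (Neg Bot)"

fun num :: "nat \<Rightarrow> tm" where
  "num 0 = Zero"
| "num (Suc n) = Succ (num n)"

primrec subst_tm :: "(nat \<Rightarrow> tm) \<Rightarrow> tm \<Rightarrow> tm" where
  "subst_tm \<sigma> (Var i) = \<sigma> i"
| "subst_tm \<sigma> Zero = Zero"
| "subst_tm \<sigma> (Succ t) = Succ (subst_tm \<sigma> t)"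
| "subst_tm \<sigma> (Add s t) = Add (subst_tm \<sigma> s) (subst_tm \<sigma> t)"
| "subst_tm \<sigma> (Mul s t) = Mul (subst_tm \<sigma> s) (subst_tm \<sigma> t)"

definition lift_tm :: "tm \<Rightarrow> tm" where
  "lift_tm = subst_tm (\<lambda>i. Var (Suc i))"

primrec subst :: "(nat \<Rightarrow> tm) \<Rightarrow> fm \<Rightarrow> fm" where
  "subst \<sigma> Bot = Bot"
| "subst \<sigma> (Eql s t) = Eql (subst_tm \<sigma> s) (subst_tm \<sigma> t)"
| "subst \<sigma> (Impl \<phi> \<psi>) = Impl (subst \<sigma> \<phi>) (subst \<sigma> \<psi>)"
| "subst \<sigma> (Forall \<phi>) = Forall (subst (case_nat (Var 0) (\<lambda>i. lift_tm (\<sigma> i))) \<phi>)"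

definition lift :: "fm \<Rightarrow> fm" where
  "lift = subst (\<lambda>i. Var (Suc i))"

text \<open>\<open>inst \<phi> [t\<^sub>0, \<dots>, t\<^sub>k]\<close> is \<open>\<phi>(t\<^sub>0, \<dots>, t\<^sub>k)\<close>: \<open>Var i\<close> is replaced by \<open>t\<^sub>i\<close> for \<open>i \<le> k\<close>,
  and the remaining indices are shifted down as if \<open>k + 1\<close> binders had been removed.\<close>

definition inst :: "fm \<Rightarrow> tm list \<Rightarrow> fm" where
  "inst \<phi> ts = subst (\<lambda>i. if i < length ts then ts ! i else Var (i - length ts)) \<phi>"

primrec closed_tm :: "nat \<Rightarrow> tm \<Rightarrow> bool" where
  "closed_tm k (Var i) = (i < k)"
| "closed_tm k Zero = True"
| "closed_tm k (Succ t) = closed_tm k t"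
| "closed_tm k (Add s t) = (closed_tm k s \<and> closed_tm k t)"
| "closed_tm k (Mul s t) = (closed_tm k s \<and> closed_tm k t)"

text \<open>\<open>closed_fm k \<phi>\<close>: the free variables of \<open>\<phi>\<close> are among \<open>Var 0, \<dots>, Var (k - 1)\<close>.\<close>

primrec closed_fm :: "nat \<Rightarrow> fm \<Rightarrow> bool" where
  "closed_fm k Bot = True"
| "closed_fm k (Eql s t) = (closed_tm k s \<and> closed_tm k t)"
| "closed_fm k (Impl \<phi> \<psi>) = (closed_fm k \<phi> \<and> closed_fm k \<psi>)"
| "closed_fm k (Forall \<phi>) = closed_fm (Suc k) \<phi>"

abbreviation sentence :: "fm \<Rightarrow> bool" where
  "sentence \<equiv> closed_fm 0"

subsection \<open>Truth in the standard model\<close>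

primrec val :: "(nat \<Rightarrow> nat) \<Rightarrow> tm \<Rightarrow> nat" where
  "val e (Var i) = e i"
| "val e Zero = 0"
| "val e (Succ t) = Suc (val e t)"
| "val e (Add s t) = val e s + val e t"
| "val e (Mul s t) = val e s * val e t"

primrec sat :: "(nat \<Rightarrow> nat) \<Rightarrow> fm \<Rightarrow> bool" where
  "sat e Bot = False"
| "sat e (Eql s t) = (val e s = val e t)"
| "sat e (Impl \<phi> \<psi>) = (sat e \<phi> \<longrightarrow> sat e \<psi>)"
| "sat e (Forall \<phi>) = (\<forall>m. sat (case_nat m e) \<phi>)"

definition true_fm :: "fm \<Rightarrow> bool" where
  "true_fm \<phi> \<longleftrightarrow> (\<forall>e. sat e \<phi>)"

subsection \<open>Classical natural deduction with equality\<close>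

text \<open>In \<open>AllI\<close> the hypotheses are lifted, so that \<open>Var 0\<close> is the eigenvariable.\<close>

inductive proves :: "fm set \<Rightarrow> fm \<Rightarrow> bool" (infix "\<turnstile>" 50) where
  Hyp: "\<phi> \<in> \<Gamma> \<Longrightarrow> \<Gamma> \<turnstile> \<phi>"
| ImpI: "insert \<phi> \<Gamma> \<turnstile> \<psi> \<Longrightarrow> \<Gamma> \<turnstile> Impl \<phi> \<psi>"
| ImpE: "\<Gamma> \<turnstile> Impl \<phi> \<psi> \<Longrightarrow> \<Gamma> \<turnstile> \<phi> \<Longrightarrow> \<Gamma> \<turnstile> \<psi>"
| Contr: "insert (Neg \<phi>) \<Gamma> \<turnstile> Bot \<Longrightarrow> \<Gamma> \<turnstile> \<phi>"
| AllI: "lift ` \<Gamma> \<turnstile> \<phi> \<Longrightarrow> \<Gamma> \<turnstile> Forall \<phi>"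
| AllE: "\<Gamma> \<turnstile> Forall \<phi> \<Longrightarrow> \<Gamma> \<turnstile> inst \<phi> [t]"
| EqI: "\<Gamma> \<turnstile> Eql t t"
| EqE: "\<Gamma> \<turnstile> Eql s t \<Longrightarrow> \<Gamma> \<turnstile> inst \<phi> [s] \<Longrightarrow> \<Gamma> \<turnstile> inst \<phi> [t]"

text \<open>A theory is given by its set of axioms, which are sentences.\<close>

definition subtheory :: "fm set \<Rightarrow> fm set \<Rightarrow> bool" where
  "subtheory S T \<longleftrightarrow> (\<forall>\<phi>. S \<turnstile> \<phi> \<longrightarrow> T \<turnstile> \<phi>)"

definition O1_equivalent :: "(nat \<Rightarrow> fm set) \<Rightarrow> (nat \<Rightarrow> fm set) \<Rightarrow> bool" where
  "O1_equivalent T S \<longleftrightarrow>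
    (\<exists>c. \<forall>n. subtheory (T n) (S (n + c)) \<and> subtheory (S n) (T (n + c)))"

subsection \<open>Peano arithmetic\<close>

definition induction_fm :: "fm \<Rightarrow> fm" where
  "induction_fm \<phi> =
    Impl (inst \<phi> [Zero])
      (Impl (Forall (Impl \<phi> (subst (case_nat (Succ (Var 0)) (\<lambda>i. Var (Suc i))) \<phi>)))
        (Forall \<phi>))"

text \<open>The prefix \<open>Forall ^^ k\<close> binds the parameters of an induction axiom.\<close>

inductive_set PA :: "fm set" where
  Succ_neq_Zero: "Forall (Neg (Eql (Succ (Var 0)) Zero)) \<in> PA"
| Succ_inject:
    "Forall (Forall (Impl (Eql (Succ (Var 1)) (Succ (Var 0))) (Eql (Var 1) (Var 0)))) \<in> PA"
| Add_Zero: "Forall (Eql (Add (Var 0) Zero) (Var 0)) \<in> PA"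
| Add_Succ:
    "Forall (Forall (Eql (Add (Var 1) (Succ (Var 0))) (Succ (Add (Var 1) (Var 0))))) \<in> PA"
| Mul_Zero: "Forall (Eql (Mul (Var 0) Zero) Zero) \<in> PA"
| Mul_Succ:
    "Forall (Forall (Eql (Mul (Var 1) (Succ (Var 0))) (Add (Mul (Var 1) (Var 0)) (Var 1)))) \<in> PA"
| Induction: "closed_fm k (induction_fm \<phi>) \<Longrightarrow> (Forall ^^ k) (induction_fm \<phi>) \<in> PA"

subsection \<open>The arithmetical hierarchy\<close>

definition Le :: "tm \<Rightarrow> tm \<Rightarrow> fm" where
  "Le s t = Exists (Eql (Add (lift_tm s) (Var 0)) (lift_tm t))"

definition Lt :: "tm \<Rightarrow> tm \<Rightarrow> fm" where
  "Lt s t = Le (Succ s) t"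

text \<open>In a bounded quantifier, \<open>lift_tm t\<close> keeps the bound free of the quantified variable.\<close>

inductive delta0 :: "fm \<Rightarrow> bool" where
  "delta0 Bot"
| "delta0 (Eql s t)"
| "delta0 \<phi> \<Longrightarrow> delta0 \<psi> \<Longrightarrow> delta0 (Impl \<phi> \<psi>)"
| "delta0 \<phi> \<Longrightarrow> delta0 (Forall (Impl (Le (Var 0) (lift_tm t)) \<phi>))"
| "delta0 \<phi> \<Longrightarrow> delta0 (Exists (Conj (Le (Var 0) (lift_tm t)) \<phi>))"

inductive sigma1 :: "fm \<Rightarrow> bool" where
  "delta0 \<phi> \<Longrightarrow> sigma1 \<phi>"
| "sigma1 \<phi> \<Longrightarrow> sigma1 (Exists \<phi>)"

inductive pi1 :: "fm \<Rightarrow> bool" where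
  "delta0 \<phi> \<Longrightarrow> pi1 \<phi>"
| "pi1 \<phi> \<Longrightarrow> pi1 (Forall \<phi>)"

section \<open>Binary strings in arithmetic\<close>

text \<open>The string \<open>s\<close> is identified with the number whose binary expansion is \<open>1s\<close>, minus one.
  This is a bijection (it is bijective base-2 notation), so quantifiers over strings become
  plain number quantifiers.\<close>

definition code :: "bool list \<Rightarrow> nat" where
  "code s = foldl (\<lambda>m b. 2 * m + (if b then 2 else 1)) 0 s"

abbreviation string_tm :: "bool list \<Rightarrow> tm" where
  "string_tm s \<equiv> num (code s)"

text \<open>\<open>Beta a b i r\<close> is the graph of Goedel's beta function: it says that \<open>r\<close> is the remainder of \<open>a\<close>
  modulo \<open>1 + (i + 1) * b\<close>.\<close>

definition Beta :: "tm \<Rightarrow> tm \<Rightarrow> tm \<Rightarrow> tm \<Rightarrow> fm" where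
  "Beta a b i r =
    (let m = Succ (Mul (Succ i) b) in
      Conj (Lt r m) (Exists (Eql (lift_tm a) (Add (Mul (Var 0) (lift_tm m)) (lift_tm r)))))"

text \<open>\<open>length_fm(x, k)\<close>: there is a sequence \<open>c\<^sub>0 = 0, \<dots>, c\<^sub>k = x\<close>, coded by \<open>a, b\<close>, with
  \<open>c\<^bsub>i+1\<^esub> = 2c\<^sub>i + 1\<close> or \<open>c\<^bsub>i+1\<^esub> = 2c\<^sub>i + 2\<close> for \<open>i < k\<close>; it lists the codes of the prefixes
  of the string \<open>x\<close>. Under the binders, the variables are
  \<open>b, a, x, k\<close>, then \<open>i, b, a, x, k\<close>, then \<open>r, i, b, a, x, k\<close>.\<close>

definition length_fm :: fm where
  "length_fm =
    Exists (Exists (Conjs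
      [Beta (Var 1) (Var 0) Zero Zero,
       Forall (Impl (Lt (Var 0) (Var 4))
         (Exists (Conj
           (Beta (Var 3) (Var 2) (Var 1) (Var 0))
           (Disj
             (Beta (Var 3) (Var 2) (Succ (Var 1)) (Succ (Add (Var 0) (Var 0))))
             (Beta (Var 3) (Var 2) (Succ (Var 1)) (Succ (Succ (Add (Var 0) (Var 0))))))))),
       Beta (Var 1) (Var 0) (Var 3) (Var 2)]))"

definition Length :: "tm \<Rightarrow> tm \<Rightarrow> fm" where
  "Length x k = inst length_fm [x, k]"

section \<open>Kolmogorov complexity\<close>

text \<open>\<open>complexity_fm D (x, k)\<close> is \<open>C\<^sub>D(x) = k\<close>: some \<open>p\<close> with \<open>D(p) = x\<close> has length \<open>k\<close>, and all
  \<open>q\<close> with \<open>D(q) = x\<close> have length at least \<open>k\<close>. The formula \<open>D\<close> has the program as \<open>Var 0\<close> and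
  the output as \<open>Var 1\<close>.\<close>

definition complexity_fm :: "fm \<Rightarrow> fm" where
  "complexity_fm D =
    Conj
      (Exists (Conj (inst D [Var 0, Var 1]) (Length (Var 0) (Var 2))))
      (Forall (Forall
        (Impl (Conj (inst D [Var 1, Var 2]) (Length (Var 1) (Var 0))) (Le (Var 3) (Var 0)))))"

definition C_eq :: "fm \<Rightarrow> tm \<Rightarrow> tm \<Rightarrow> fm" where
  "C_eq D x k = inst (complexity_fm D) [x, k]"

definition C_ge :: "fm \<Rightarrow> tm \<Rightarrow> tm \<Rightarrow> fm" where
  "C_ge D x k = Forall (Impl (C_eq D (lift_tm x) (Var 0)) (Le (lift_tm k) (Var 0)))"

definition C_gt :: "fm \<Rightarrow> tm \<Rightarrow> tm \<Rightarrow> fm" where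
  "C_gt D x k = Forall (Impl (C_eq D (lift_tm x) (Var 0)) (Lt (lift_tm k) (Var 0)))"

text \<open>An interpreter is (an algorithm for) a partial computable function on strings. In
  arithmetic it is given by a \<open>\<Sigma>\<^sub>1\<close>-formula for its graph that \<open>PA\<close> proves to be functional.
  Functionality in the standard model alone would not suffice: the formula would then not
  describe the input-output behaviour of an algorithm from the point of view of \<open>PA\<close>.\<close>

definition interpreter :: "fm \<Rightarrow> bool" where
  "interpreter D \<longleftrightarrow> sigma1 D \<and> closed_fm 2 D \<and>
    PA \<turnstile> Forall (Forall (Forall
      (Impl (Conj (inst D [Var 2, Var 1]) (inst D [Var 2, Var 0])) (Eql (Var 1) (Var 0)))))"

text \<open>\<open>C\<^sub>D(x) \<le> C\<^sub>D\<^sub>'(x) + c\<close> is read with \<open>C\<^sub>D\<^sub>'(x) = \<infinity>\<close> if \<open>x\<close> has no \<open>D'\<close>-description.\<close>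

definition provably_optimal :: "fm \<Rightarrow> bool" where
  "provably_optimal D \<longleftrightarrow> interpreter D \<and>
    (\<forall>D'. interpreter D' \<longrightarrow>
      (\<exists>c. PA \<turnstile> Forall (Forall
        (Impl (C_eq D' (Var 1) (Var 0))
          (Exists (Conj (C_eq D (Var 2) (Var 0)) (Le (Var 0) (Add (Var 1) (num c)))))))))"

definition outputs :: "fm \<Rightarrow> bool list \<Rightarrow> bool list \<Rightarrow> bool" where
  "outputs D p x \<longleftrightarrow> true_fm (inst D [string_tm p, string_tm x])"

definition complexity :: "fm \<Rightarrow> bool list \<Rightarrow> enat" where
  "complexity D x = Inf {enat (length p) | p. outputs D p x}"

text \<open>\<open>LEAST\<close> refers to the lexicographic order on lists, with \<open>False < True\<close>.\<close>

definition first_random :: "fm \<Rightarrow> nat \<Rightarrow> bool list" where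
  "first_random D n = (LEAST x. length x = n \<and> complexity D x \<ge> enat n)"

section \<open>Complexity of \<open>\<Pi>\<^sub>1\<close>-statements\<close>

definition pi1_statement :: "fm \<Rightarrow> bool" where
  "pi1_statement T \<longleftrightarrow> pi1 T \<and> sentence T"

definition universal :: "fm \<Rightarrow> bool" where
  "universal U \<longleftrightarrow> pi1 U \<and> closed_fm 1 U \<and>
    (\<forall>T. pi1_statement T \<longrightarrow> (\<exists>t. PA \<turnstile> Iff T (inst U [string_tm t])))"

definition pi1_complexity :: "fm \<Rightarrow> fm \<Rightarrow> enat" where
  "pi1_complexity U T = Inf {enat (length t) | t. PA \<turnstile> Iff T (inst U [string_tm t])}"

definition optimal_universal :: "fm \<Rightarrow> bool" where
  "optimal_universal U \<longleftrightarrow> universal U \<and>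
    (\<forall>V. universal V \<longrightarrow>
      (\<exists>c. \<forall>T. pi1_statement T \<longrightarrow> pi1_complexity U T \<le> pi1_complexity V T + enat c))"

section \<open>The three sequences of theories\<close>

definition theory_A :: "fm \<Rightarrow> nat \<Rightarrow> fm set" where
  "theory_A D n = PA \<union> {C_ge D (string_tm (first_random D n)) (num n)}"

definition theory_B :: "fm \<Rightarrow> nat \<Rightarrow> fm set" where
  "theory_B D n = PA
    \<union> {C_eq D (string_tm x) (num k) | x k. complexity D x = enat k \<and> k \<le> n}
    \<union> {Forall (Impl
        (Conjs (map (\<lambda>m. Neg (Eql (Var 0) (num m)))
          (sorted_list_of_set (code ` {x. complexity D x \<le> enat n}))))
        (C_gt D (Var 0) (num n)))}"

definition theory_C :: "fm \<Rightarrow> nat \<Rightarrow> fm set" where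
  "theory_C U n = PA \<union> {T. pi1_statement T \<and> true_fm T \<and> pi1_complexity U T \<le> enat n}"

section \<open>Adequacy with respect to the standard model\<close>

text \<open>Soundness of the calculus and of \<open>PA\<close>, and the meaning of the above formulas in the standard
  model: the formalised length and complexity agree with \<open>length\<close> and \<open>complexity\<close>.\<close>

lemma val_subst_tm: "val e (subst_tm \<sigma> t) = val (\<lambda>i. val e (\<sigma> i)) t"
  by (induction t) auto

lemma val_lift_tm [simp]: "val (case_nat m e) (lift_tm t) = val e t"
  by (simp add: lift_tm_def val_subst_tm)

lemma sat_subst: "sat e (subst \<sigma> \<phi>) = sat (\<lambda>i. val e (\<sigma> i)) \<phi>"
proof (induction \<phi> arbitrary: e \<sigma>)
  case (Forall \<phi>)
  have "(\<lambda>i. val (case_nat m e) (case i of 0 \<Rightarrow> Var 0 | Suc j \<Rightarrow> lift_tm (\<sigma> j))) =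
      case_nat m (\<lambda>i. val e (\<sigma> i))" for m
    by (auto split: nat.split)
  then show ?case by (simp add: Forall)
qed (auto simp: val_subst_tm)

lemma sat_lift [simp]: "sat (case_nat m e) (lift \<phi>) = sat e \<phi>"
  by (simp add: lift_def sat_subst)

lemma val_num [simp]: "val e (num n) = n"
  by (induction n) auto

lemma sat_connectives [simp]:
  "sat e (Neg \<phi>) \<longleftrightarrow> \<not> sat e \<phi>"
  "sat e (Conj \<phi> \<psi>) \<longleftrightarrow> sat e \<phi> \<and> sat e \<psi>"
  "sat e (Disj \<phi> \<psi>) \<longleftrightarrow> sat e \<phi> \<or> sat e \<psi>"
  "sat e (Iff \<phi> \<psi>) \<longleftrightarrow> (sat e \<phi> \<longleftrightarrow> sat e \<psi>)"
  "sat e (Exists \<phi>) \<longleftrightarrow> (\<exists>m. sat (case_nat m e) \<phi>)"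
  by (auto simp: Neg_def Conj_def Disj_def Iff_def Exists_def)

lemma sat_Conjs [simp]: "sat e (Conjs \<phi>s) \<longleftrightarrow> (\<forall>\<phi>\<in>set \<phi>s. sat e \<phi>)"
  by (induction \<phi>s) (auto simp: Conjs_def)

lemma sat_inst: "sat e (inst \<phi> ts) =
    sat (\<lambda>i. if i < length ts then val e (ts ! i) else e (i - length ts)) \<phi>"
  by (simp add: inst_def sat_subst if_distrib cong: if_cong)

lemma sat_inst1: "sat e (inst \<phi> [t]) = sat (case_nat (val e t) e) \<phi>"
proof -
  have "(\<lambda>i. if i < length [t] then val e ([t] ! i) else e (i - length [t])) = case_nat (val e t) e"
    by (auto split: nat.split)
  then show ?thesis by (simp only: sat_inst)
qed

lemma sat_inst2: "sat e (inst \<phi> [s, t]) = sat (case_nat (val e s) (case_nat (val e t) e)) \<phi>"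
proof -
  have "(\<lambda>i. if i < length [s,t] then val e ([s,t] ! i) else e (i - length [s,t])) =
    case_nat (val e s) (case_nat (val e t) e)"
    by (auto split: nat.split simp: less_Suc_eq)
  then show ?thesis by (simp only: sat_inst)
qed

lemma soundness: "\<Gamma> \<turnstile> \<phi> \<Longrightarrow> (\<forall>\<psi>\<in>\<Gamma>. sat e \<psi>) \<Longrightarrow> sat e \<phi>"
proof (induction arbitrary: e rule: proves.induct)
  case (EqE \<Gamma> s t \<phi>) then show ?case by (simp add: sat_inst1)
next
  case (AllE \<Gamma> \<phi> t) then show ?case by (simp add: sat_inst1)
qed auto

lemma sat_Forall_pow: "(\<And>e. sat e \<phi>) \<Longrightarrow> sat e ((Forall ^^ k) \<phi>)"
  by (induction k arbitrary: e) auto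

lemma sat_induction_fm: "sat e (induction_fm \<phi>)"
proof -
  have "(\<lambda>i. val (case_nat m e) (case i of 0 \<Rightarrow> Succ (Var 0) | Suc i \<Rightarrow> Var (Suc i))) =
    case_nat (Suc m) e" for m
    by (auto split: nat.split)
  then show ?thesis
    by (auto simp: induction_fm_def sat_inst1 sat_subst intro: nat_induct)
qed

lemma PA_true: "\<phi> \<in> PA \<Longrightarrow> true_fm \<phi>"
  by (induction rule: PA.induct) (auto simp: true_fm_def sat_Forall_pow sat_induction_fm)

lemma PA_sound: "PA \<turnstile> \<phi> \<Longrightarrow> true_fm \<phi>"
  using soundness PA_true unfolding true_fm_def by blast

lemma code_simps [simp]: "code [] = 0" "code (s @ [b]) = 2 * code s + (if b then 2 else 1)"
  by (simp_all add: code_def)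

lemma inj_code: "inj code"
proof (rule injI)
  fix x y show "code x = code y \<Longrightarrow> x = y"
  proof (induction x arbitrary: y rule: rev_induct)
    case Nil then show ?case by (cases y rule: rev_cases) (auto split: if_splits)
  next
    case (snoc b x)
    then show ?case
    proof (cases y rule: rev_cases)
      case (snoc y' b')
      with snoc.prems have "code x = code y' \<and> b = b'"
        by (auto split: if_splits) presburger+
      with snoc snoc.IH show ?thesis by simp
    qed (auto split: if_splits)
  qed
qed

lemma surj_code: "\<exists>x. code x = n"
proof (induction n rule: less_induct)
  case (less n)
  show ?case
  proof (cases "n = 0")
    case True then show ?thesis using code_simps(1) by blast
  next
    case False
    then obtain x where x: "code x = (n - 1) div 2" using less[of "(n - 1) div 2"] by fastforce
    have "code (x @ [even n]) = n" using x False by (auto elim!: oddE evenE)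
    then show ?thesis by blast
  qed
qed

lemma bij_code: "bij code"
  using inj_code surj_code by (metis bijI surj_def)

lemma sat_Le [simp]: "sat e (Le s t) \<longleftrightarrow> val e s \<le> val e t"
  by (simp add: Le_def) (metis le_iff_add)

lemma sat_Lt [simp]: "sat e (Lt s t) \<longleftrightarrow> val e s < val e t"
  by (auto simp: Lt_def)

lemma sat_Beta [simp]:
  "sat e (Beta a b i r) \<longleftrightarrow> val e a mod (1 + (val e i + 1) * val e b) = val e r"
proof -
  let ?m = "Suc (val e b + val e i * val e b)"
  have "(val e r < ?m \<and> (\<exists>q. val e a = q * ?m + val e r)) \<longleftrightarrow> val e a mod ?m = val e r"
  proof
    assume "val e a mod ?m = val e r"
    then show "val e r < ?m \<and> (\<exists>q. val e a = q * ?m + val e r)"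
      using mod_less_divisor[of ?m "val e a"] div_mult_mod_eq[of "val e a" ?m]
      by (intro conjI exI[of _ "val e a div ?m"]) simp_all
  next
    assume "val e r < ?m \<and> (\<exists>q. val e a = q * ?m + val e r)"
    then obtain q where "val e r < ?m" "val e a = q * ?m + val e r" by blast
    then show "val e a mod ?m = val e r" by (simp only: mod_mult_self3 mod_less)
  qed
  then show ?thesis by (simp add: Beta_def Let_def)
qed

lemma beta_exists: "\<exists>a b. \<forall>i\<le>k. a mod (1 + (i + 1) * b) = (c i :: nat)"
proof -
  define M where "M = Max (insert (Suc k) (c ` {..k}))"
  have M: "c i \<le> M" if "i \<le> k" for i unfolding M_def using that by (intro Max_ge) auto
  have Mk: "Suc k \<le> M" unfolding M_def by auto
  define b where "b = (fact M :: nat)"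
  have bM: "b \<ge> M" unfolding b_def by (rule fact_ge_self)
  have cop: "coprime (1 + (i+1) * b) (1 + (j+1) * b)" if "i \<le> k" "j \<le> k" "i < j" for i j
  proof (rule ccontr)
    assume "\<not> ?thesis"
    then have "gcd (1 + (i+1)*b) (1 + (j+1)*b) \<noteq> 1" by (simp only: coprime_iff_gcd_eq_1) simp
    then obtain p where "prime p" "p dvd gcd (1 + (i+1)*b) (1 + (j+1)*b)"
      using prime_factor_nat by blast
    then have p: "prime p" "p dvd 1 + (i+1)*b" "p dvd 1 + (j+1)*b"
      by (simp_all only: gcd_greatest_iff)
    have "p dvd (1 + (j+1)*b) - (1 + (i+1)*b)" using p dvd_diff_nat by blast
    also have "(1 + (j+1)*b) - (1 + (i+1)*b) = (j - i) * b"
      using that by (simp add: algebra_simps diff_mult_distrib)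
    finally have "p dvd (j - i) \<or> p dvd b" using p prime_dvd_mult_iff by blast
    moreover have "j - i dvd b" unfolding b_def using that Mk by (intro dvd_fact) auto
    ultimately have "p dvd b" by (meson dvd_trans)
    then have "p dvd 1" using p(2) by (subst (asm) dvd_add_left_iff) auto
    then show False using p(1) by simp
  qed
  have "\<forall>i\<in>{..k}. \<forall>j\<in>{..k}. i \<noteq> j \<longrightarrow> coprime (1 + (i + 1) * b) (1 + (j + 1) * b)"
  proof (intro ballI impI)
    fix i j assume "i \<in> {..k}" "j \<in> {..k}" "i \<noteq> j"
    then show "coprime (1 + (i + 1) * b) (1 + (j + 1) * b)"
      using cop[of i j] cop[of j i] by (cases i j rule: linorder_cases) (simp_all only: atMost_iff coprime_commute)
  qed
  from chinese_remainder_nat[OF finite_atMost this, of c]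
  obtain a where a: "\<forall>i\<in>{..k}. [a = c i] (mod (1 + (i+1)*b))" by blast
  have "a mod (1 + (i+1)*b) = c i" if "i \<le> k" for i
  proof -
    have "c i < 1 + (i+1)*b" using M[OF that] bM by (simp add: add.commute less_Suc_eq_le trans_le_add1)
    then show ?thesis using a that by (auto simp: cong_def)
  qed
  then show ?thesis by blast
qed

lemma code_take: "i < length x \<Longrightarrow> code (take (Suc i) x) = 2 * code (take i x) + (if x ! i then 2 else 1)"
  by (simp add: take_Suc_conv_app_nth)

lemma sat_Length [simp]: "sat e (Length x k) \<longleftrightarrow> (\<exists>s. val e x = code s \<and> val e k = length s)"
proof -
  have L: "sat e (Length x k) \<longleftrightarrow> (\<exists>a b. a mod (1 + (0 + 1) * b) = 0 \<and>
     (\<forall>i<val e k. let r = a mod (1 + (i + 1) * b); r' = a mod (1 + (Suc i + 1) * b) in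
          r' = 2 * r + 1 \<or> r' = 2 * r + 2) \<and> a mod (1 + (val e k + 1) * b) = val e x)"
    by (simp add: Length_def length_fm_def sat_inst2 Let_def eval_nat_numeral)
  define P where "P c \<longleftrightarrow> c 0 = 0 \<and>
     (\<forall>i<val e k. c (Suc i) = 2 * c i + 1 \<or> c (Suc i) = 2 * c i + 2) \<and> c (val e k) = val e x"
    for c :: "nat \<Rightarrow> nat"
  have P: "sat e (Length x k) \<longleftrightarrow> (\<exists>a b. P (\<lambda>i. a mod (1 + (i + 1) * b)))"
    unfolding L P_def Let_def by (rule refl)
  have P_cong: "P c \<longleftrightarrow> P c'" if "\<forall>i\<le>val e k. c i = c' i" for c c'
  proof -
    have "c i = c' i" "i < val e k \<Longrightarrow> c (Suc i) = c' (Suc i)" if "i \<le> val e k" for i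
      using that \<open>\<forall>i\<le>val e k. c i = c' i\<close> by (simp_all add: Suc_le_eq)
    then show ?thesis by (simp add: P_def cong: conj_cong)
  qed
  have L': "sat e (Length x k) \<longleftrightarrow> (\<exists>c. P c)"
  proof
    assume "\<exists>c. P c"
    then obtain c where c: "P c" ..
    obtain a b where "\<forall>i\<le>val e k. a mod (1 + (i + 1) * b) = c i"
      using beta_exists[of "val e k" c] by (elim exE)
    then have "P (\<lambda>i. a mod (1 + (i + 1) * b))" using P_cong c by (simp only:)
    then show "sat e (Length x k)" unfolding P by blast
  qed (auto simp only: P)
  show ?thesis
  proof
    assume "sat e (Length x k)"
    then obtain c where c: "c 0 = 0"
      "\<And>i. i < val e k \<Longrightarrow> c (Suc i) = 2 * c i + 1 \<or> c (Suc i) = 2 * c i + 2"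
      "c (val e k) = val e x" unfolding L' P_def by blast
    have "\<exists>s. c i = code s \<and> length s = i" if "i \<le> val e k" for i
      using that
    proof (induction i)
      case 0 then show ?case using c(1) by (intro exI[of _ "[]"]) simp
    next
      case (Suc i)
      then obtain s where s: "c i = code s" "length s = i" by auto
      consider "c (Suc i) = code (s @ [False])" | "c (Suc i) = code (s @ [True])"
        using c(2)[of i] Suc.prems s by auto
      then show ?case
        using s(2) by cases (metis length_append_singleton)+
    qed
    then show "\<exists>s. val e x = code s \<and> val e k = length s" using c(3) by (metis order_refl)
  next
    assume "\<exists>s. val e x = code s \<and> val e k = length s"
    then obtain s where s: "val e x = code s" "val e k = length s" by blast
    show "sat e (Length x k)" unfolding L' P_def s
      by (intro exI[of _ "\<lambda>i. code (take i s)"]) (auto simp: code_take)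
  qed
qed

lemma sat_closed_tm: "closed_tm k t \<Longrightarrow> (\<And>i. i < k \<Longrightarrow> e i = e' i) \<Longrightarrow> val e t = val e' t"
  by (induction t) auto

lemma sat_closed: "closed_fm k \<phi> \<Longrightarrow> (\<And>i. i < k \<Longrightarrow> e i = e' i) \<Longrightarrow> sat e \<phi> = sat e' \<phi>"
proof (induction \<phi> arbitrary: k e e')
  case (Forall \<phi>)
  have "sat (case_nat m e) \<phi> = sat (case_nat m e') \<phi>" for m
    by (rule Forall.IH[of "Suc k"]) (use Forall.prems in \<open>auto split: nat.split\<close>)
  then show ?case by simp
next
  case (Eql s t) then show ?case using sat_closed_tm by (metis closed_fm.simps(2) sat.simps(2))
next
  case (Impl a b) then show ?case by (metis closed_fm.simps(3) sat.simps(3))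
qed auto

lemma sat_outputs:
  assumes "closed_fm 2 D"
  shows "sat e (inst D [s, t]) \<longleftrightarrow> (\<exists>p x. val e s = code p \<and> val e t = code x \<and> outputs D p x)"
proof -
  have *: "sat e' (inst D [s', t']) = sat (case_nat (val e s) (case_nat (val e t) (\<lambda>_. 0))) D"
    if "val e s = val e' s'" "val e t = val e' t'" for e' s' t'
    unfolding sat_inst2
    by (rule sat_closed[OF assms]) (use that in \<open>auto split: nat.split\<close>)
  obtain p x where px: "val e s = code p" "val e t = code x" using surj_code by metis
  then have "outputs D p x \<longleftrightarrow> sat (case_nat (val e s) (case_nat (val e t) (\<lambda>_. 0))) D"
    by (simp add: outputs_def true_fm_def *)
  then show ?thesis using px *[of e s t] inj_code by (auto simp: inj_eq)
qed

lemma sat_C_eq_iff: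
  assumes "closed_fm 2 D" "val e x = code s"
  shows "sat e (C_eq D x k) \<longleftrightarrow> (\<exists>p. outputs D p s \<and> length p = val e k) \<and>
    (\<forall>q. outputs D q s \<longrightarrow> val e k \<le> length q)"
proof -
  have [simp]: "sat (case_nat m0 (case_nat m1 e')) (inst D [Var 0, Var (Suc 0)]) \<longleftrightarrow>
      (\<exists>p x. m0 = code p \<and> m1 = code x \<and> outputs D p x)"
    "sat (case_nat m0 (case_nat m1 (case_nat m2 e'))) (inst D [Var (Suc 0), Var 2]) \<longleftrightarrow>
      (\<exists>p x. m1 = code p \<and> m2 = code x \<and> outputs D p x)" for m0 m1 m2 e'
    by (simp_all add: sat_outputs[OF assms(1)] eval_nat_numeral)
  have "sat e (C_eq D x k) \<longleftrightarrow>
    (\<exists>m. (\<exists>p x. m = code p \<and> code s = code x \<and> outputs D p x) \<and>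
      (\<exists>s. m = code s \<and> val e k = length s)) \<and>
    (\<forall>m l. (\<exists>p x. m = code p \<and> code s = code x \<and> outputs D p x) \<and>
      (\<exists>s. m = code s \<and> l = length s) \<longrightarrow> val e k \<le> l)"
    unfolding C_eq_def sat_inst2[of e "complexity_fm D"]
    by (simp add: complexity_fm_def assms(2))
  also have "\<dots> \<longleftrightarrow> (\<exists>p. outputs D p s \<and> length p = val e k) \<and>
    (\<forall>q. outputs D q s \<longrightarrow> val e k \<le> length q)"
    using inj_code by (auto simp: inj_eq)
  finally show ?thesis .
qed

lemma sat_C_eq:
  assumes "closed_fm 2 D" "val e x = code s"
  shows "sat e (C_eq D x k) \<longleftrightarrow> complexity D s = enat (val e k)"
proof -
  let ?S = "{enat (length p) | p. outputs D p s}"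
  show ?thesis unfolding sat_C_eq_iff[OF assms] complexity_def
  proof safe
    fix p assume "outputs D p s" "\<forall>q. outputs D q s \<longrightarrow> val e k \<le> length q" "length p = val e k"
    then show "Inf ?S = enat (val e k)" by (intro antisym Inf_lower Inf_greatest) force+
  next
    assume a: "Inf ?S = enat (val e k)"
    have "?S \<noteq> {}"
    proof
      assume "?S = {}"
      then have "Inf ?S = \<infinity>" by (simp only: Inf_enat_def) simp
      with a show False by simp
    qed
    then have "Inf ?S \<in> ?S" by (metis (mono_tags, lifting) Inf_enat_def LeastI_ex ex_in_conv)
    then show "\<exists>p. outputs D p s \<and> length p = val e k" using a by auto
    fix q assume "outputs D q s"
    then have "Inf ?S \<le> enat (length q)" by (intro Inf_lower) auto
    then show "val e k \<le> length q" using a by simp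
  qed
qed

lemma sat_C_ge:
  assumes "closed_fm 2 D" "val e x = code s"
  shows "sat e (C_ge D x k) \<longleftrightarrow> enat (val e k) \<le> complexity D s"
  by (cases "complexity D s") (use assms in \<open>auto simp: C_ge_def sat_C_eq\<close>)

lemma sat_C_gt:
  assumes "closed_fm 2 D" "val e x = code s"
  shows "sat e (C_gt D x k) \<longleftrightarrow> enat (val e k) < complexity D s"
  by (cases "complexity D s") (use assms in \<open>auto simp: C_gt_def sat_C_eq\<close>)

lemma outputs_functional:
  assumes "interpreter D" "outputs D p x" "outputs D p y"
  shows "x = y"
proof -
  have D: "closed_fm 2 D" using assms(1) by (simp add: interpreter_def)
  have "true_fm (Forall (Forall (Forall
      (Impl (Conj (inst D [Var 2, Var 1]) (inst D [Var 2, Var 0])) (Eql (Var 1) (Var 0))))))"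
    using assms(1) PA_sound by (simp add: interpreter_def)
  moreover define e where "e = case_nat (code y) (case_nat (code x) (case_nat (code p) (\<lambda>_. 0)))"
  ultimately have "sat e (Impl (Conj (inst D [Var 2, Var 1]) (inst D [Var 2, Var 0]))
      (Eql (Var 1) (Var 0)))"
    unfolding true_fm_def sat.simps(4) by blast
  moreover have e: "e 0 = code y" "e 1 = code x" "e 2 = code p"
    by (simp_all add: e_def eval_nat_numeral)
  have "sat e (inst D [Var 2, Var 1])" "sat e (inst D [Var 2, Var 0])"
    unfolding sat_outputs[OF D] val.simps e using assms(2,3) by blast+
  ultimately have "code x = code y" using e by simp
  then show ?thesis by (rule injD[OF inj_code])
qed

lemma finite_complexity_le:
  assumes "interpreter D"
  shows "finite {x. complexity D x \<le> enat n}"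
proof (rule finite_subset)
  have fin: "finite {p :: bool list. length p \<le> n}"
    using finite_lists_length_le[of "UNIV :: bool set" n] by simp
  show "finite ((\<lambda>p. THE x. outputs D p x) ` {p. length p \<le> n})"
    using fin by (rule finite_imageI)
  show "{x. complexity D x \<le> enat n} \<subseteq> (\<lambda>p. THE x. outputs D p x) ` {p. length p \<le> n}"
  proof
    fix x assume "x \<in> {x. complexity D x \<le> enat n}"
    then have "\<not> enat n < complexity D x" by simp
    then obtain k where k: "complexity D x = enat k" "k \<le> n"
      by (cases "complexity D x") auto
    have "sat (\<lambda>_. 0) (C_eq D (num (code x)) (num k))"
      using assms k(1) by (subst sat_C_eq) (auto simp: interpreter_def)
    then have "\<exists>p. outputs D p x \<and> length p = k"
      using assms sat_C_eq_iff[of D "\<lambda>_. 0" "num (code x)" x "num k"] by (simp add: interpreter_def)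
    then obtain p where p: "outputs D p x" "length p \<le> n" using k(2) by blast
    then have "(THE x. outputs D p x) = x"
      using outputs_functional[OF assms] by blast
    then show "x \<in> (\<lambda>p. THE x. outputs D p x) ` {p. length p \<le> n}" using p(2) by force
  qed
qed

lemma theory_B_true:
  assumes "interpreter D" "\<phi> \<in> theory_B D n"
  shows "true_fm \<phi>"
proof -
  have D: "closed_fm 2 D" using assms(1) by (simp add: interpreter_def)
  let ?S = "code ` {x. complexity D x \<le> enat n}"
  let ?\<psi> = "Forall (Impl (Conjs (map (\<lambda>m. Neg (Eql (Var 0) (num m))) (sorted_list_of_set ?S)))
        (C_gt D (Var 0) (num n)))"
  have "sat (case_nat m e) (C_gt D (Var 0) (num n))" if "m \<notin> ?S" for m e
  proof -
    obtain x where x: "m = code x" using surj_code by metis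
    then have "\<not> complexity D x \<le> enat n" using that by blast
    then show ?thesis using sat_C_gt[OF D, of "case_nat m e" "Var 0" x "num n"] x by simp
  qed
  moreover have "set (sorted_list_of_set ?S) = ?S"
    using finite_complexity_le[OF assms(1)] by (intro set_sorted_list_of_set finite_imageI)
  ultimately have \<psi>: "true_fm ?\<psi>"
    unfolding true_fm_def sat.simps sat_Conjs set_map by auto
  consider "\<phi> \<in> PA" | x k where "\<phi> = C_eq D (num (code x)) (num k)" "complexity D x = enat k"
    | "\<phi> = ?\<psi>"
    using assms(2) unfolding theory_B_def by blast
  then show ?thesis
  proof cases
    case 1 then show ?thesis by (rule PA_true)
  next
    case 2 then show ?thesis using sat_C_eq[OF D] by (simp add: true_fm_def)
  next
    case 3 then show ?thesis using \<psi> by (simp only:)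
  qed
qed

end

theory Submission
  imports Defs
begin

text \<open>Only O(1) bits of side information are affordable, and this shapes the encodings. For
  \<open>B\<close> in \<open>C\<close> the statement about the last halting program must also tell
  n; writing n separately would cost about log n bits, so the single number 2^(n+1) + p carries
  both. Universality of \<open>U\<close> alone gives no control over the code of that statement. It
  is therefore built into a second universal formula \<open>V\<close>, and the optimality of
  \<open>U\<close> pays for it with a constant. For \<open>C\<close> in \<open>A\<close> there is a
  circularity: the program must produce a random string that exceeds its own length by more than the
  constant c of optimality, yet c is known only after the interpreter \<open>D'\<close> is fixed.
  The cure is to let the program carry a number d. It adds d to the length of the program but 2d to
  the length of the random string, so that d = c gives (n + c + 2) + c < n + 2c + 3. Since an
  interpreter must be functional provably in \<open>PA\<close>, \<open>D'\<close> asks for least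
  witnesses, which make its output unique even at nonstandard times.\<close>

text \<open>By completeness it suffices to compare the theories in countable models \<open>M\<close> of \<open>PA\<close>, where
  \<open>\<Delta>\<^sub>0\<close>-formulas are absolute for standard elements.

  \<open>B\<^sub>n\<close> proves \<open>A\<^sub>n\<close> directly. \<open>C\<^bsub>n+O(1)\<^esub>\<close> proves \<open>B\<^sub>n\<close>: the true \<open>\<Pi>\<^sub>1\<close>-statement that \<open>p\<close> is the last
  program of length at most \<open>n\<close> to halt has complexity \<open>n + O(1)\<close>, and it decides the behaviour of
  all programs of length at most \<open>n\<close>. \<open>A\<^bsub>n+O(1)\<^esub>\<close> proves \<open>C\<^sub>n\<close>: if a true \<open>U(t)\<close> with \<open>t\<close> of length at most \<open>n\<close>
  fails in \<open>M\<close>, then it is refuted at a nonstandard time only. By that time all strings of length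
  \<open>n + O(1)\<close> before the first random one are seen to be compressible, so the random string can be
  computed in \<open>M\<close> from \<open>t\<close>, which contradicts its incompressibility.\<close>

section \<open>Substitution\<close>

definition up :: "(nat \<Rightarrow> tm) \<Rightarrow> nat \<Rightarrow> tm" where
  "up \<sigma> = case_nat (Var 0) (\<lambda>i. lift_tm (\<sigma> i))"

lemma up_simps [simp]: "up \<sigma> 0 = Var 0" "up \<sigma> (Suc i) = lift_tm (\<sigma> i)"
  by (simp_all add: up_def)

lemma subst_Forall: "subst \<sigma> (Forall \<phi>) = Forall (subst (up \<sigma>) \<phi>)"
  by (simp add: up_def)

lemma subst_tm_subst_tm: "subst_tm \<sigma> (subst_tm \<tau> t) = subst_tm (\<lambda>i. subst_tm \<sigma> (\<tau> i)) t"
  by (induction t) auto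

lemma subst_up_lift_tm: "subst_tm (up \<sigma>) (lift_tm t) = lift_tm (subst_tm \<sigma> t)"
  by (simp add: lift_tm_def subst_tm_subst_tm)

lemma subst_subst: "subst \<sigma> (subst \<tau> \<phi>) = subst (\<lambda>i. subst_tm \<sigma> (\<tau> i)) \<phi>"
proof (induction \<phi> arbitrary: \<sigma> \<tau>)
  case (Forall \<phi>)
  have "(\<lambda>i. subst_tm (up \<sigma>) (up \<tau> i)) = up (\<lambda>i. subst_tm \<sigma> (\<tau> i))"
    by (rule ext) (auto simp: up_def subst_up_lift_tm[unfolded up_def] split: nat.split)
  then show ?case unfolding subst_Forall by (simp add: Forall.IH)
qed (auto simp: subst_tm_subst_tm)

lemma subst_tm_cong_closed:
  "closed_tm k t \<Longrightarrow> (\<And>i. i < k \<Longrightarrow> \<sigma> i = \<tau> i) \<Longrightarrow> subst_tm \<sigma> t = subst_tm \<tau> t"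
  by (induction t) auto

lemma subst_cong_closed:
  "closed_fm k \<phi> \<Longrightarrow> (\<And>i. i < k \<Longrightarrow> \<sigma> i = \<tau> i) \<Longrightarrow> subst \<sigma> \<phi> = subst \<tau> \<phi>"
proof (induction \<phi> arbitrary: k \<sigma> \<tau>)
  case (Eql s t)
  then show ?case using subst_tm_cong_closed[of k _ \<sigma> \<tau>] by auto
next
  case (Impl \<phi> \<psi>)
  then show ?case using Impl.IH[of k \<sigma> \<tau>] by auto
next
  case (Forall \<phi>)
  have "subst (up \<sigma>) \<phi> = subst (up \<tau>) \<phi>"
    by (rule Forall.IH[of "Suc k"]) (use Forall.prems in \<open>auto simp: up_def split: nat.split\<close>)
  then show ?case unfolding subst_Forall by simp
qed auto

lemma subst_tm_Var: "subst_tm Var t = t"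
  by (induction t) auto

lemma subst_Var: "subst Var \<phi> = \<phi>"
proof (induction \<phi>)
  case (Forall \<phi>)
  have "up Var = Var" by (rule ext) (auto simp: up_def lift_tm_def split: nat.split)
  then show ?case unfolding subst_Forall by (simp add: Forall.IH)
qed (auto simp: subst_tm_Var)

lemma inst1: "inst \<phi> [t] = subst (case_nat t Var) \<phi>"
proof -
  have "(\<lambda>i. if i < length [t] then [t] ! i else Var (i - length [t])) = case_nat t Var"
    by (rule ext) (auto split: nat.split)
  then show ?thesis by (simp only: inst_def)
qed

text \<open>\<open>AllE\<close> and \<open>EqE\<close> conclude with \<open>inst\<close>, so the
  stability of derivations under substitution rests on this commutation.\<close>

lemma subst_inst1: "subst \<sigma> (inst \<phi> [t]) = inst (subst (up \<sigma>) \<phi>) [subst_tm \<sigma> t]"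
proof -
  have "subst_tm \<sigma> (case_nat t Var i) =
    subst_tm (case_nat (subst_tm \<sigma> t) Var) (up \<sigma> i)" for i
    by (cases i) (simp_all add: lift_tm_def subst_tm_subst_tm subst_tm_Var)
  then show ?thesis unfolding inst1 subst_subst by simp
qed

lemma inst_subst_up: "inst (subst (up \<sigma>) \<phi>) [t] = subst (case_nat t \<sigma>) \<phi>"
proof -
  have "subst_tm (case_nat t Var) (up \<sigma> i) = case_nat t \<sigma> i" for i
    by (cases i) (simp_all add: lift_tm_def subst_tm_subst_tm subst_tm_Var)
  then show ?thesis unfolding inst1 subst_subst by simp
qed

lemma subst_Neg [simp]: "subst \<sigma> (Neg \<phi>) = Neg (subst \<sigma> \<phi>)"
  by (simp add: Neg_def)

lemma closed_tm_mono: "closed_tm k t \<Longrightarrow> k \<le> m \<Longrightarrow> closed_tm m t"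
  by (induction t) auto

lemma closed_fm_mono: "closed_fm k \<phi> \<Longrightarrow> k \<le> m \<Longrightarrow> closed_fm m \<phi>"
  by (induction \<phi> arbitrary: k m) (auto intro: closed_tm_mono)

lemma closed_tm_exists: "\<exists>k. closed_tm k t"
proof (induction t)
  case (Var i) then show ?case by (auto intro: exI[of _ "Suc i"])
next
  case (Add s t)
  then obtain j k where "closed_tm j s" "closed_tm k t" by blast
  then show ?case using closed_tm_mono[of j s "max j k"] closed_tm_mono[of k t "max j k"]
    by (intro exI[of _ "max j k"]) simp
next
  case (Mul s t)
  then obtain j k where "closed_tm j s" "closed_tm k t" by blast
  then show ?case using closed_tm_mono[of j s "max j k"] closed_tm_mono[of k t "max j k"]
    by (intro exI[of _ "max j k"]) simp
qed auto

lemma closed_fm_exists: "\<exists>k. closed_fm k \<phi>"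
proof (induction \<phi>)
  case (Eql s t)
  obtain j k where "closed_tm j s" "closed_tm k t" using closed_tm_exists by blast
  then show ?case using closed_tm_mono[of j s "max j k"] closed_tm_mono[of k t "max j k"]
    by (intro exI[of _ "max j k"]) simp
next
  case (Impl \<phi> \<psi>)
  then obtain j k where "closed_fm j \<phi>" "closed_fm k \<psi>" by blast
  then show ?case using closed_fm_mono[of j \<phi> "max j k"] closed_fm_mono[of k \<psi> "max j k"]
    by (intro exI[of _ "max j k"]) simp
next
  case (Forall \<phi>)
  then obtain k where "closed_fm k \<phi>" by blast
  then have "closed_fm k (Forall \<phi>)" using closed_fm_mono[of k \<phi> "Suc k"] by simp
  then show ?case by blast
qed auto

lemma closed_subst_tm:
  "closed_tm k t \<Longrightarrow> (\<And>i. i < k \<Longrightarrow> closed_tm m (\<sigma> i)) \<Longrightarrow> closed_tm m (subst_tm \<sigma> t)"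
  by (induction t) auto

lemma closed_lift_tm: "closed_tm k t \<Longrightarrow> closed_tm (Suc k) (lift_tm t)"
  by (auto simp: lift_tm_def intro: closed_subst_tm)

lemma closed_subst:
  "closed_fm k \<phi> \<Longrightarrow> (\<And>i. i < k \<Longrightarrow> closed_tm m (\<sigma> i)) \<Longrightarrow> closed_fm m (subst \<sigma> \<phi>)"
proof (induction \<phi> arbitrary: k m \<sigma>)
  case (Forall \<phi>)
  have "closed_fm (Suc m) (subst (up \<sigma>) \<phi>)"
    by (rule Forall.IH[of "Suc k"])
      (use Forall.prems in \<open>auto simp: up_def closed_lift_tm split: nat.split\<close>)
  then show ?case unfolding subst_Forall by simp
qed (auto intro: closed_subst_tm)

section \<open>The calculus\<close>

lemma proves_mono: "\<Gamma> \<turnstile> \<phi> \<Longrightarrow> \<Gamma> \<subseteq> \<Delta> \<Longrightarrow> \<Delta> \<turnstile> \<phi>"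
proof (induction arbitrary: \<Delta> rule: proves.induct)
  case (ImpI \<phi> \<Gamma> \<psi>)
  then show ?case by (meson insert_mono proves.ImpI)
next
  case (Contr \<phi> \<Gamma>)
  then show ?case by (meson insert_mono proves.Contr)
next
  case (AllI \<Gamma> \<phi>)
  then show ?case by (meson image_mono proves.AllI)
next
  case (ImpE \<Gamma> \<phi> \<psi>)
  then show ?case by (meson proves.ImpE)
next
  case (AllE \<Gamma> \<phi> t)
  then show ?case by (intro proves.AllE) simp
next
  case (EqE \<Gamma> s t \<phi>)
  then show ?case by (intro proves.EqE[of \<Delta> s t \<phi>]) simp_all
qed (auto intro: Hyp EqI)

lemma proves_subst: "\<Gamma> \<turnstile> \<phi> \<Longrightarrow> subst \<sigma> ` \<Gamma> \<turnstile> subst \<sigma> \<phi>"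
proof (induction arbitrary: \<sigma> rule: proves.induct)
  case (ImpI \<phi> \<Gamma> \<psi>)
  have "insert (subst \<sigma> \<phi>) (subst \<sigma> ` \<Gamma>) \<turnstile> subst \<sigma> \<psi>" using ImpI.IH[of \<sigma>] by simp
  then show ?case by (simp add: proves.ImpI)
next
  case (Contr \<phi> \<Gamma>)
  have "insert (Neg (subst \<sigma> \<phi>)) (subst \<sigma> ` \<Gamma>) \<turnstile> Bot"
    using Contr.IH[of \<sigma>] by simp
  then show ?case by (rule proves.Contr)
next
  case (AllI \<Gamma> \<phi>)
  have "subst (up \<sigma>) ` (lift ` \<Gamma>) = lift ` (subst \<sigma> ` \<Gamma>)"
    by (simp add: image_image lift_def subst_subst lift_tm_def)
  then show ?case unfolding subst_Forall using AllI.IH[of "up \<sigma>"] by (simp add: proves.AllI)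
next
  case (AllE \<Gamma> \<phi> t)
  then show ?case unfolding subst_inst1 by (intro proves.AllE) (simp only: subst_Forall)
next
  case (EqE \<Gamma> s t \<phi>)
  have "subst \<sigma> ` \<Gamma> \<turnstile> Eql (subst_tm \<sigma> s) (subst_tm \<sigma> t)"
    using EqE.IH(1)[of \<sigma>] by simp
  moreover have "subst \<sigma> ` \<Gamma> \<turnstile> inst (subst (up \<sigma>) \<phi>) [subst_tm \<sigma> s]"
    using EqE.IH(2)[of \<sigma>] unfolding subst_inst1 .
  ultimately show ?case unfolding subst_inst1 by (rule proves.EqE)
next
  case (ImpE \<Gamma> \<phi> \<psi>)
  then show ?case by (metis proves.ImpE subst.simps(3))
qed (auto intro: Hyp EqI)

text \<open>This lets a contradiction from the union of the Lindenbaum chain be pulled back to one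
  stage. For \<open>ImpI\<close> and \<open>Contr\<close> the discharged formula is removed from the
  finite set.\<close>

lemma proves_finite: "\<Gamma> \<turnstile> \<phi> \<Longrightarrow> \<exists>\<Delta>. finite \<Delta> \<and> \<Delta> \<subseteq> \<Gamma> \<and> \<Delta> \<turnstile> \<phi>"
proof (induction rule: proves.induct)
  case (Hyp \<phi> \<Gamma>)
  then show ?case by (intro exI[of _ "{\<phi>}"]) (auto intro: proves.Hyp)
next
  case (ImpI \<phi> \<Gamma> \<psi>)
  then obtain \<Delta> where \<Delta>: "finite \<Delta>" "\<Delta> \<subseteq> insert \<phi> \<Gamma>" "\<Delta> \<turnstile> \<psi>" by blast
  from \<Delta>(3) have "insert \<phi> (\<Delta> - {\<phi>}) \<turnstile> \<psi>" by (rule proves_mono) blast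
  then show ?case using \<Delta> by (intro exI[of _ "\<Delta> - {\<phi>}"]) (auto intro: proves.ImpI)
next
  case (ImpE \<Gamma> \<phi> \<psi>)
  then obtain \<Delta> \<Delta>' where "finite \<Delta>" "\<Delta> \<subseteq> \<Gamma>" "\<Delta> \<turnstile> Impl \<phi> \<psi>" "finite \<Delta>'" "\<Delta>' \<subseteq> \<Gamma>" "\<Delta>' \<turnstile> \<phi>"
    by blast
  moreover from this have "\<Delta> \<union> \<Delta>' \<turnstile> \<psi>"
    by (intro proves.ImpE[of _ \<phi> \<psi>]) (erule proves_mono, blast)+
  ultimately show ?case by (intro exI[of _ "\<Delta> \<union> \<Delta>'"]) simp
next
  case (Contr \<phi> \<Gamma>)
  then obtain \<Delta> where \<Delta>: "finite \<Delta>" "\<Delta> \<subseteq> insert (Neg \<phi>) \<Gamma>" "\<Delta> \<turnstile> Bot" by blast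
  from \<Delta>(3) have "insert (Neg \<phi>) (\<Delta> - {Neg \<phi>}) \<turnstile> Bot" by (rule proves_mono) blast
  then show ?case using \<Delta> by (intro exI[of _ "\<Delta> - {Neg \<phi>}"]) (auto intro: proves.Contr)
next
  case (AllI \<Gamma> \<phi>)
  then obtain \<Delta> where \<Delta>: "finite \<Delta>" "\<Delta> \<subseteq> lift ` \<Gamma>" "\<Delta> \<turnstile> \<phi>" by blast
  then obtain \<Delta>' where "\<Delta>' \<subseteq> \<Gamma>" "finite \<Delta>'" "\<Delta> = lift ` \<Delta>'" by (meson finite_subset_image)
  then show ?case using \<Delta> by (intro exI[of _ \<Delta>']) (auto intro: proves.AllI)
next
  case (EqI \<Gamma> t)
  then show ?case by (intro exI[of _ "{}"]) (auto intro: proves.EqI)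
next
  case (EqE \<Gamma> s t \<phi>)
  then obtain \<Delta> \<Delta>' where "finite \<Delta>" "\<Delta> \<subseteq> \<Gamma>" "\<Delta> \<turnstile> Eql s t" "finite \<Delta>'" "\<Delta>' \<subseteq> \<Gamma>"
    "\<Delta>' \<turnstile> inst \<phi> [s]"
    by blast
  moreover from this have "\<Delta> \<union> \<Delta>' \<turnstile> inst \<phi> [t]"
    by (intro proves.EqE[of _ s t]) (erule proves_mono, blast)+
  ultimately show ?case by (intro exI[of _ "\<Delta> \<union> \<Delta>'"]) simp
next
  case (AllE \<Gamma> \<phi> t)
  then show ?case by (meson proves.AllE)
qed

lemma proves_cut: "\<Gamma> \<turnstile> \<phi> \<Longrightarrow> insert \<phi> \<Gamma> \<turnstile> \<psi> \<Longrightarrow> \<Gamma> \<turnstile> \<psi>"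
  using ImpE ImpI by blast

lemma proves_NegE: "\<Gamma> \<turnstile> Neg \<phi> \<Longrightarrow> \<Gamma> \<turnstile> \<phi> \<Longrightarrow> \<Gamma> \<turnstile> Bot"
  unfolding Neg_def by (rule ImpE)

lemma proves_BotE: "\<Gamma> \<turnstile> Bot \<Longrightarrow> \<Gamma> \<turnstile> \<phi>"
  by (meson Contr proves_mono subset_insertI)

text \<open>A fresh variable acts as an eigenvariable: rename \<open>Var m\<close> to \<open>Var 0\<close> and lift the others.\<close>

lemma proves_generalize:
  assumes "\<Gamma> \<turnstile> inst \<phi> [Var m]" "\<And>\<psi>. \<psi> \<in> \<Gamma> \<Longrightarrow> closed_fm m \<psi>" "closed_fm m (Forall \<phi>)"
  shows "\<Gamma> \<turnstile> Forall \<phi>"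
proof -
  define \<sigma> where "\<sigma> i = (if i = m then Var 0 else Var (Suc i))" for i
  have "subst \<sigma> ` \<Gamma> = lift ` \<Gamma>" unfolding lift_def
    using assms(2) by (intro image_cong refl subst_cong_closed) (auto simp: \<sigma>_def)
  moreover have "subst \<sigma> (inst \<phi> [Var m]) = subst Var \<phi>"
    unfolding inst1 subst_subst using assms(3)
    by (intro subst_cong_closed[of "Suc m"]) (auto simp: \<sigma>_def split: nat.split)
  ultimately show ?thesis using proves_subst[OF assms(1), of \<sigma>]
    by (auto simp: subst_Var intro: AllI)
qed

section \<open>Structures and completeness\<close>

text \<open>The universe is always \<open>nat\<close>: every theory considered contains \<open>PA\<close> and is countable, so its
  countable models are infinite and can be renamed.\<close>

record struct =
  zr :: nat
  sc :: "nat \<Rightarrow> nat"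
  ad :: "nat \<Rightarrow> nat \<Rightarrow> nat"
  ml :: "nat \<Rightarrow> nat \<Rightarrow> nat"

primrec mval :: "struct \<Rightarrow> (nat \<Rightarrow> nat) \<Rightarrow> tm \<Rightarrow> nat" where
  "mval M e (Var i) = e i"
| "mval M e Zero = zr M"
| "mval M e (Succ t) = sc M (mval M e t)"
| "mval M e (Add s t) = ad M (mval M e s) (mval M e t)"
| "mval M e (Mul s t) = ml M (mval M e s) (mval M e t)"

primrec msat :: "struct \<Rightarrow> (nat \<Rightarrow> nat) \<Rightarrow> fm \<Rightarrow> bool" where
  "msat M e Bot = False"
| "msat M e (Eql s t) = (mval M e s = mval M e t)"
| "msat M e (Impl \<phi> \<psi>) = (msat M e \<phi> \<longrightarrow> msat M e \<psi>)"
| "msat M e (Forall \<phi>) = (\<forall>m. msat M (case_nat m e) \<phi>)"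

text \<open>Free variables of the formulas in \<open>S\<close> serve as Henkin constants, so the
  language is not extended. \<open>PA_subset\<close> is what makes the term model infinite.\<close>

locale maximal_Henkin =
  fixes S :: "fm set"
  assumes consistent: "\<not> S \<turnstile> Bot"
    and maximal: "\<not> insert \<phi> S \<turnstile> Bot \<Longrightarrow> \<phi> \<in> S"
    and Henkin: "Neg (Forall \<psi>) \<in> S \<Longrightarrow> \<exists>t. Neg (inst \<psi> [t]) \<in> S"
    and PA_subset: "PA \<subseteq> S"
begin

lemma closed: "S \<turnstile> \<phi> \<Longrightarrow> \<phi> \<in> S"
  using maximal consistent proves_cut by blast

lemma Neg_iff: "Neg \<phi> \<in> S \<longleftrightarrow> \<phi> \<notin> S"
proof
  assume "Neg \<phi> \<in> S"
  then show "\<phi> \<notin> S" using consistent by (meson proves_NegE Hyp)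
next
  assume "\<phi> \<notin> S"
  then have "insert \<phi> S \<turnstile> Bot" using maximal by blast
  then show "Neg \<phi> \<in> S" unfolding Neg_def by (rule closed[OF ImpI])
qed

lemma Impl_iff: "Impl \<phi> \<psi> \<in> S \<longleftrightarrow> (\<phi> \<in> S \<longrightarrow> \<psi> \<in> S)"
proof
  assume *: "\<phi> \<in> S \<longrightarrow> \<psi> \<in> S"
  show "Impl \<phi> \<psi> \<in> S"
  proof (cases "\<psi> \<in> S")
    case True then show ?thesis by (simp add: closed[OF ImpI[OF Hyp]])
  next
    case False
    then have "Neg \<phi> \<in> S" using * Neg_iff by blast
    then have "insert \<phi> S \<turnstile> Bot" by (metis proves_NegE Hyp insertCI)
    then show ?thesis by (rule closed[OF ImpI[OF proves_BotE]])
  qed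
qed (meson closed ImpE Hyp)

lemma Forall_iff: "Forall \<phi> \<in> S \<longleftrightarrow> (\<forall>t. inst \<phi> [t] \<in> S)"
proof
  assume "Forall \<phi> \<in> S"
  then show "\<forall>t. inst \<phi> [t] \<in> S" using closed[OF AllE[OF Hyp]] by blast
qed (use Henkin Neg_iff in blast)

definition eqv :: "tm \<Rightarrow> tm \<Rightarrow> bool" where "eqv s t \<longleftrightarrow> Eql s t \<in> S"

lemma eqv_refl: "eqv t t"
  unfolding eqv_def by (rule closed[OF EqI])

lemma eqv_subst:
  assumes "eqv s t" "inst \<phi> [s] \<in> S"
  shows "inst \<phi> [t] \<in> S"
  using closed[OF EqE[OF Hyp Hyp]] assms unfolding eqv_def by blast

text \<open>\<open>EqE\<close> rewrites at the hole \<open>Var 0\<close>; a lifted term has no hole,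
  so only the other side of the equation is rewritten. Congruence, transitivity and symmetry all
  come from this choice of formula.\<close>

lemma inst_Eql: "inst (Eql (lift_tm u) v) [t] = Eql u (subst_tm (case_nat t Var) v)"
  by (simp add: inst1 lift_tm_def subst_tm_subst_tm subst_tm_Var)

lemma eqv_cong: "eqv s t \<Longrightarrow> eqv (subst_tm (case_nat s Var) u) (subst_tm (case_nat t Var) u)"
  using eqv_subst[of s t "Eql (lift_tm (subst_tm (case_nat s Var) u)) u"]
    eqv_refl[unfolded eqv_def] unfolding inst_Eql eqv_def by blast

lemma eqv_trans: "eqv s t \<Longrightarrow> eqv t u \<Longrightarrow> eqv s u"
  using eqv_subst[of t u "Eql (lift_tm s) (Var 0)"] unfolding inst_Eql eqv_def by simp

lemma eqv_sym: "eqv s t \<Longrightarrow> eqv t s"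
  using eqv_subst[of s t "Eql (Var 0) (lift_tm s)"] eqv_refl[of s]
  by (simp add: inst1 lift_tm_def subst_tm_subst_tm subst_tm_Var eqv_def)

lemma eqv_Succ: "eqv s t \<Longrightarrow> eqv (Succ s) (Succ t)"
  using eqv_cong[of s t "Succ (Var 0)"] by simp

lemma subst_tm_lift_tm [simp]: "subst_tm (case_nat s Var) (lift_tm t) = t"
  by (simp add: lift_tm_def subst_tm_subst_tm subst_tm_Var)

lemma eqv_Add: "eqv s s' \<Longrightarrow> eqv t t' \<Longrightarrow> eqv (Add s t) (Add s' t')"
  using eqv_cong[of s s' "Add (Var 0) (lift_tm t)"] eqv_cong[of t t' "Add (lift_tm s') (Var 0)"]
  by (simp add: eqv_trans)

lemma eqv_Mul: "eqv s s' \<Longrightarrow> eqv t t' \<Longrightarrow> eqv (Mul s t) (Mul s' t')"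
  using eqv_cong[of s s' "Mul (Var 0) (lift_tm t)"] eqv_cong[of t t' "Mul (lift_tm s') (Var 0)"]
  by (simp add: eqv_trans)

lemma not_eqv_Succ_Zero: "\<not> eqv (Succ t) Zero"
proof -
  have "Forall (Neg (Eql (Succ (Var 0)) Zero)) \<in> S" using PA_subset PA.Succ_neq_Zero by blast
  then have "inst (Neg (Eql (Succ (Var 0)) Zero)) [t] \<in> S" unfolding Forall_iff by blast
  then show ?thesis by (simp add: inst1 Neg_iff eqv_def)
qed

lemma eqv_Succ_inject: "eqv (Succ s) (Succ t) \<Longrightarrow> eqv s t"
proof -
  have "Forall (Forall (Impl (Eql (Succ (Var 1)) (Succ (Var 0))) (Eql (Var 1) (Var 0)))) \<in> S"
    using PA_subset PA.Succ_inject by blast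
  then have "inst (Forall (Impl (Eql (Succ (Var 1)) (Succ (Var 0))) (Eql (Var 1) (Var 0)))) [s] \<in> S"
    unfolding Forall_iff by blast
  then have "inst (Impl (Eql (Succ (lift_tm s)) (Succ (Var 0))) (Eql (lift_tm s) (Var 0))) [t] \<in> S"
    unfolding inst1[of _ s] subst_Forall unfolding Forall_iff by simp
  then show "eqv (Succ s) (Succ t) \<Longrightarrow> eqv s t" by (simp add: inst1 Impl_iff eqv_def)
qed

end

instance tm :: countable by countable_datatype
instance fm :: countable by countable_datatype

context maximal_Henkin
begin

text \<open>Successor acts injectively on the classes and misses the class of \<open>Zero\<close>,
  so the classes are infinitely many. Being countable, they can be numbered by all of
  \<open>nat\<close>; \<open>h\<close> is the quotient map.\<close>

lemma naming: "\<exists>h :: tm \<Rightarrow> nat. surj h \<and> (\<forall>s t. h s = h t \<longleftrightarrow> eqv s t)"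
proof -
  define cls where "cls t = Collect (eqv t)" for t
  have cls: "cls s = cls t \<longleftrightarrow> eqv s t" for s t
    unfolding cls_def using eqv_refl eqv_sym eqv_trans by blast
  have "infinite (range cls)"
  proof
    assume fin: "finite (range cls)"
    define g where "g X = cls (Succ (SOME t. cls t = X))" for X
    have g: "g (cls t) = cls (Succ t)" for t
    proof -
      have "cls (SOME t'. cls t' = cls t) = cls t" by (rule someI) (rule refl)
      then show ?thesis unfolding g_def cls by (rule eqv_Succ)
    qed
    have "inj_on g (range cls)"
      by (rule inj_onI) (metis g cls eqv_Succ_inject imageE)
    moreover have "g ` range cls \<subseteq> range cls" using g by auto
    ultimately have "g ` range cls = range cls" using fin by (simp add: endo_inj_surj)
    then have "cls Zero \<in> g ` range cls" by blast
    then show False using g cls not_eqv_Succ_Zero eqv_sym by (metis imageE)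
  qed
  moreover have "countable (range cls)" by simp
  ultimately have bij: "bij_betw (to_nat_on (range cls)) (range cls) UNIV"
    by (rule to_nat_on_infinite[rotated])
  define h where "h t = to_nat_on (range cls) (cls t)" for t
  have "surj h" using bij unfolding h_def bij_betw_def by (metis image_image)
  moreover have "h s = h t \<longleftrightarrow> eqv s t" for s t
    unfolding h_def cls[symmetric] using bij by (auto simp: bij_betw_def inj_on_eq_iff)
  ultimately show ?thesis by blast
qed

lemma model_exists: "\<exists>M e. \<forall>\<phi>. msat M e \<phi> \<longleftrightarrow> \<phi> \<in> S"
proof -
  obtain h :: "tm \<Rightarrow> nat" where h: "surj h" "\<And>s t. h s = h t \<longleftrightarrow> eqv s t" using naming by blast
  define i where "i = inv h"
  have i: "h (i x) = x" for x unfolding i_def using h(1) by (rule surj_f_inv_f)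
  then have ih: "eqv (i (h t)) t" for t using h(2) by metis
  define M where "M = \<lparr>zr = h Zero, sc = \<lambda>x. h (Succ (i x)),
    ad = \<lambda>x y. h (Add (i x) (i y)), ml = \<lambda>x y. h (Mul (i x) (i y))\<rparr>"
  have val: "mval M (\<lambda>j. h (\<sigma> j)) t = h (subst_tm \<sigma> t)" for \<sigma> t
    by (induction t) (simp_all add: M_def h(2) eqv_Succ eqv_Add eqv_Mul ih)
  \<comment> \<open>The truth lemma is stated for all substitutions, since passing under a
    quantifier changes the assignment. Surjectivity of \<open>h\<close> makes every element of the
    universe the value of some term.\<close>
  have sat: "msat M (\<lambda>j. h (\<sigma> j)) \<phi> \<longleftrightarrow> subst \<sigma> \<phi> \<in> S" for \<sigma> \<phi>
  proof (induction \<phi> arbitrary: \<sigma>)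
    case Bot then show ?case using consistent Hyp by auto
  next
    case (Eql s t) then show ?case by (simp add: val h(2) eqv_def)
  next
    case (Impl \<phi> \<psi>) then show ?case by (simp add: Impl_iff)
  next
    case (Forall \<phi>)
    have "(\<lambda>j. h (case_nat t \<sigma> j)) = case_nat (h t) (\<lambda>j. h (\<sigma> j))" for t
      by (rule ext) (simp split: nat.split)
    then have "msat M (case_nat (h t) (\<lambda>j. h (\<sigma> j))) \<phi> \<longleftrightarrow> inst (subst (up \<sigma>) \<phi>) [t] \<in> S" for t
      unfolding inst_subst_up using Forall.IH[of "case_nat t \<sigma>"] by simp
    then show ?case unfolding subst_Forall Forall_iff using i by (metis msat.simps(4))
  qed
  show ?thesis using sat[of Var] unfolding subst_Var by blast
qed

end

text \<open>The bound on the free variables is carried along because it supplies a fresh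
  \<open>Var m\<close> as witness: if adding the counterexample at \<open>Var m\<close> were
  inconsistent, \<open>proves_generalize\<close> would derive the universal formula itself.\<close>

lemma Henkin_step:
  assumes "\<not> S \<turnstile> Bot" "\<forall>\<psi>\<in>S. closed_fm k \<psi>"
  shows "\<exists>S' k'. S \<subseteq> S' \<and> \<not> S' \<turnstile> Bot \<and> (\<forall>\<psi>\<in>S'. closed_fm k' \<psi>) \<and> (\<chi> \<in> S' \<or> insert \<chi> S \<turnstile> Bot) \<and>
    (\<forall>\<psi>. \<chi> = Neg (Forall \<psi>) \<longrightarrow> \<chi> \<in> S' \<longrightarrow> (\<exists>t. Neg (inst \<psi> [t]) \<in> S'))"
proof (cases "insert \<chi> S \<turnstile> Bot")
  case True
  then have "\<chi> \<notin> S" using assms(1) by (auto simp: insert_absorb)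
  then show ?thesis using assms True by (intro exI[of _ S] exI[of _ k]) auto
next
  case False
  obtain j where j: "closed_fm j \<chi>" using closed_fm_exists by blast
  define m where "m = max j k"
  have m: "\<forall>\<psi>\<in>insert \<chi> S. closed_fm m \<psi>"
    unfolding m_def using j assms(2) closed_fm_mono by (metis insertE max.cobounded1 max.cobounded2)
  show ?thesis
  proof (cases "\<exists>\<psi>. \<chi> = Neg (Forall \<psi>)")
    case True
    then obtain \<psi> where \<psi>: "\<chi> = Neg (Forall \<psi>)" by blast
    let ?\<theta> = "Neg (inst \<psi> [Var m])"
    obtain l where l: "closed_fm l ?\<theta>" using closed_fm_exists by blast
    have "\<not> insert ?\<theta> (insert \<chi> S) \<turnstile> Bot"
    proof
      assume "insert ?\<theta> (insert \<chi> S) \<turnstile> Bot"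
      then have "insert \<chi> S \<turnstile> inst \<psi> [Var m]" by (rule Contr)
      then have "insert \<chi> S \<turnstile> Forall \<psi>"
        using m \<psi> by (intro proves_generalize) (auto simp: Neg_def)
      moreover have "insert \<chi> S \<turnstile> Neg (Forall \<psi>)" unfolding \<psi> by (rule Hyp) simp
      ultimately show False using False proves_NegE by blast
    qed
    moreover have "\<forall>\<psi>\<in>insert ?\<theta> (insert \<chi> S). closed_fm (max l m) \<psi>"
      using l m closed_fm_mono by (metis insertE max.cobounded1 max.cobounded2)
    ultimately show ?thesis using \<psi> False
      by (intro exI[of _ "insert ?\<theta> (insert \<chi> S)"] exI[of _ "max l m"]) (auto simp: Neg_def)
  next
    case no_Forall: False
    show ?thesis using False m no_Forall
      by (intro exI[of _ "insert \<chi> S"] exI[of _ m]) auto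
  qed
qed

text \<open>Stage n + 1 treats the formula numbered n. Each stage has a bound on its free variables,
  while the union need not have one.\<close>

lemma Lindenbaum:
  assumes "\<not> S \<turnstile> Bot" "\<forall>\<psi>\<in>S. closed_fm k \<psi>" "PA \<subseteq> S"
  shows "\<exists>S'. S \<subseteq> S' \<and> maximal_Henkin S'"
proof -
  define good where "good S = (\<not> S \<turnstile> Bot \<and> (\<exists>k. \<forall>\<psi>\<in>S. closed_fm k \<psi>))" for S
  define ext where "ext \<chi> S S' \<longleftrightarrow> S \<subseteq> S' \<and> (\<chi> \<in> S' \<or> insert \<chi> S \<turnstile> Bot) \<and>
    (\<forall>\<psi>. \<chi> = Neg (Forall \<psi>) \<longrightarrow> \<chi> \<in> S' \<longrightarrow> (\<exists>t. Neg (inst \<psi> [t]) \<in> S'))" for \<chi> S S'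
  have "\<exists>f. \<forall>n. (good (f n) \<and> (n = 0 \<longrightarrow> f n = S)) \<and> ext (from_nat n) (f n) (f (Suc n))"
  proof (rule dependent_nat_choice)
    show "\<exists>x. good x \<and> (0 = (0::nat) \<longrightarrow> x = S)" using assms by (auto simp: good_def)
  next
    fix X and n :: nat assume "good X \<and> (n = 0 \<longrightarrow> X = S)"
    then obtain k where "\<not> X \<turnstile> Bot" "\<forall>\<psi>\<in>X. closed_fm k \<psi>" unfolding good_def by blast
    from Henkin_step[OF this, of "from_nat n"]
    show "\<exists>y. (good y \<and> (Suc n = 0 \<longrightarrow> y = S)) \<and> ext (from_nat n) X y"
      unfolding good_def ext_def by blast
  qed
  then obtain f where f: "\<And>n. good (f n)" "f 0 = S" "\<And>n. ext (from_nat n) (f n) (f (Suc n))"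
    by metis
  have mono: "f m \<subseteq> f n" if "m \<le> n" for m n
    by (rule lift_Suc_mono_le[OF _ that]) (use f(3) in \<open>auto simp: ext_def\<close>)
  define S' where "S' = (\<Union>n. f n)"
  have fin: "\<exists>n. \<Delta> \<subseteq> f n" if "finite \<Delta>" "\<Delta> \<subseteq> S'" for \<Delta>
    using that
  proof (induction rule: finite_induct)
    case (insert \<psi> \<Delta>)
    then obtain m n where "\<Delta> \<subseteq> f m" "\<psi> \<in> f n" by (auto simp: S'_def)
    then have "insert \<psi> \<Delta> \<subseteq> f (max m n)" using mono[of m "max m n"] mono[of n "max m n"] by auto
    then show ?case by blast
  qed auto
  have S': "f n \<subseteq> S'" for n unfolding S'_def by blast
  have "maximal_Henkin S'"
  proof
    show con: "\<not> S' \<turnstile> Bot"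
    proof
      assume "S' \<turnstile> Bot"
      then obtain n where "f n \<turnstile> Bot" using proves_finite fin proves_mono by meson
      then show False using f(1) by (simp add: good_def)
    qed
    show "\<phi> \<in> S'" if "\<not> insert \<phi> S' \<turnstile> Bot" for \<phi>
    proof -
      have "\<not> insert \<phi> (f (to_nat \<phi>)) \<turnstile> Bot"
        using that proves_mono S' by (meson insert_mono)
      then show ?thesis using f(3)[of "to_nat \<phi>"] S' by (auto simp: ext_def)
    qed
    show "\<exists>t. Neg (inst \<psi> [t]) \<in> S'" if "Neg (Forall \<psi>) \<in> S'" for \<psi>
    proof -
      let ?n = "to_nat (Neg (Forall \<psi>))"
      have "\<not> insert (Neg (Forall \<psi>)) (f ?n) \<turnstile> Bot"
        using con that proves_mono[of _ _ S'] S' by blast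
      then have "\<exists>t. Neg (inst \<psi> [t]) \<in> f (Suc ?n)"
        using f(3)[of ?n] by (auto simp: ext_def)
      then show ?thesis using S' by blast
    qed
    show "PA \<subseteq> S'" using assms(3) S'[of 0] f(2) by blast
  qed
  then show ?thesis using S'[of 0] f(2) by blast
qed

lemma mval_cong_closed: "closed_tm k t \<Longrightarrow> (\<And>i. i < k \<Longrightarrow> e i = e' i) \<Longrightarrow> mval M e t = mval M e' t"
  by (induction t) auto

lemma msat_cong_closed:
  "closed_fm k \<phi> \<Longrightarrow> (\<And>i. i < k \<Longrightarrow> e i = e' i) \<Longrightarrow> msat M e \<phi> = msat M e' \<phi>"
proof (induction \<phi> arbitrary: k e e')
  case (Forall \<phi>)
  have "msat M (case_nat m e) \<phi> = msat M (case_nat m e') \<phi>" for m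
    by (rule Forall.IH[of "Suc k"]) (use Forall.prems in \<open>auto split: nat.split\<close>)
  then show ?case by simp
next
  case (Eql s t) then show ?case using mval_cong_closed by (metis closed_fm.simps(2) msat.simps(2))
next
  case (Impl \<phi> \<psi>) then show ?case by (metis closed_fm.simps(3) msat.simps(3))
qed auto

lemma completeness:
  assumes "\<forall>\<psi>\<in>\<Gamma>. sentence \<psi>" "PA \<subseteq> \<Gamma>"
    and sem: "\<And>M e. (\<And>\<psi> e. \<psi> \<in> \<Gamma> \<Longrightarrow> msat M e \<psi>) \<Longrightarrow> msat M e \<phi>"
  shows "\<Gamma> \<turnstile> \<phi>"
proof (rule ccontr)
  assume not: "\<not> \<Gamma> \<turnstile> \<phi>"
  obtain k where k: "closed_fm k \<phi>" using closed_fm_exists by blast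
  have "\<not> insert (Neg \<phi>) \<Gamma> \<turnstile> Bot" using not Contr by blast
  moreover have "\<forall>\<psi>\<in>insert (Neg \<phi>) \<Gamma>. closed_fm k \<psi>"
    using k assms(1) closed_fm_mono[of 0 _ k] by (auto simp: Neg_def)
  ultimately obtain S where S: "insert (Neg \<phi>) \<Gamma> \<subseteq> S" "maximal_Henkin S"
    using Lindenbaum assms(2) by (meson subset_insertI2)
  interpret maximal_Henkin S by fact
  obtain M e where M: "\<And>\<psi>. msat M e \<psi> \<longleftrightarrow> \<psi> \<in> S" using model_exists by blast
  have "msat M e' \<psi>" if "\<psi> \<in> \<Gamma>" for \<psi> e'
  proof -
    have "msat M e' \<psi> = msat M e \<psi>" using assms(1) that by (intro msat_cong_closed[of 0]) auto
    then show ?thesis using M S(1) that by blast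
  qed
  then have "msat M e \<phi>" by (rule sem)
  then show False using M S(1) Neg_iff by blast
qed

section \<open>Models of Peano arithmetic\<close>

lemma mval_subst_tm: "mval M e (subst_tm \<sigma> t) = mval M (\<lambda>i. mval M e (\<sigma> i)) t"
  by (induction t) auto

lemma mval_lift_tm [simp]: "mval M (case_nat m e) (lift_tm t) = mval M e t"
  by (simp add: lift_tm_def mval_subst_tm)

lemma msat_subst: "msat M e (subst \<sigma> \<phi>) = msat M (\<lambda>i. mval M e (\<sigma> i)) \<phi>"
proof (induction \<phi> arbitrary: e \<sigma>)
  case (Forall \<phi>)
  have "(\<lambda>i. mval M (case_nat m e) (up \<sigma> i)) = case_nat m (\<lambda>i. mval M e (\<sigma> i))" for m
    by (rule ext) (simp add: up_def split: nat.split)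
  then show ?case unfolding subst_Forall by (simp add: Forall)
qed (auto simp: mval_subst_tm)

lemma msat_lift [simp]: "msat M (case_nat m e) (lift \<phi>) = msat M e \<phi>"
  by (simp add: lift_def msat_subst)

lemma msat_connectives [simp]:
  "msat M e (Neg \<phi>) \<longleftrightarrow> \<not> msat M e \<phi>"
  "msat M e (Conj \<phi> \<psi>) \<longleftrightarrow> msat M e \<phi> \<and> msat M e \<psi>"
  "msat M e (Disj \<phi> \<psi>) \<longleftrightarrow> msat M e \<phi> \<or> msat M e \<psi>"
  "msat M e (Iff \<phi> \<psi>) \<longleftrightarrow> (msat M e \<phi> \<longleftrightarrow> msat M e \<psi>)"
  "msat M e (Exists \<phi>) \<longleftrightarrow> (\<exists>m. msat M (case_nat m e) \<phi>)"
  by (auto simp: Neg_def Conj_def Disj_def Iff_def Exists_def)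

lemma msat_Conjs [simp]: "msat M e (Conjs \<phi>s) \<longleftrightarrow> (\<forall>\<phi>\<in>set \<phi>s. msat M e \<phi>)"
  by (induction \<phi>s) (auto simp: Conjs_def)

lemma inst2: "inst \<phi> [s, t] = subst (case_nat s (case_nat t Var)) \<phi>"
proof -
  have "(\<lambda>i. if i < length [s, t] then [s, t] ! i else Var (i - length [s, t])) =
    case_nat s (case_nat t Var)"
    by (rule ext) (auto split: nat.split simp: less_Suc_eq)
  then show ?thesis by (simp only: inst_def)
qed

lemma msat_inst1: "msat M e (inst \<phi> [t]) = msat M (case_nat (mval M e t) e) \<phi>"
proof -
  have "(\<lambda>i. mval M e (case_nat t Var i)) = case_nat (mval M e t) e"
    by (rule ext) (simp split: nat.split)
  then show ?thesis by (simp add: inst1 msat_subst)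
qed

lemma msat_inst2:
  "msat M e (inst \<phi> [s, t]) = msat M (case_nat (mval M e s) (case_nat (mval M e t) e)) \<phi>"
proof -
  have "(\<lambda>i. mval M e (case_nat s (case_nat t Var) i)) =
    case_nat (mval M e s) (case_nat (mval M e t) e)"
    by (rule ext) (simp split: nat.split)
  then show ?thesis by (simp add: inst2 msat_subst)
qed

text \<open>Finite assignments let concrete formulas be evaluated by simplification. Beyond the list
  the value 0 is a dummy, which a formula closed at that length does not read.\<close>

definition env :: "nat list \<Rightarrow> nat \<Rightarrow> nat" where
  "env xs i = (if i < length xs then xs ! i else 0)"

lemma env_nth [simp]: "i < length xs \<Longrightarrow> env xs i = xs ! i"
  by (simp add: env_def)

lemma case_nat_env [simp]: "case_nat x (env xs) = env (x # xs)"
  by (rule ext) (simp add: env_def split: nat.split)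

lemma msat_inst:
  assumes "closed_fm (length ts) \<phi>"
  shows "msat M e (inst \<phi> ts) \<longleftrightarrow> msat M (env (map (mval M e) ts)) \<phi>"
  unfolding inst_def msat_subst by (rule msat_cong_closed[OF assms]) simp

lemma msat_Forall_pow:
  "msat M e ((Forall ^^ k) \<phi>) \<Longrightarrow> msat M (\<lambda>i. if i < k then f i else e (i - k)) \<phi>"
proof (induction k arbitrary: e)
  case (Suc k)
  have "(\<lambda>i. if i < k then f i else case_nat (f k) e (i - k)) =
    (\<lambda>i. if i < Suc k then f i else e (i - Suc k))"
    by (rule ext) (auto split: nat.split simp: less_Suc_eq intro!: arg_cong[of _ _ e])
  moreover have "msat M (case_nat (f k) e) ((Forall ^^ k) \<phi>)" using Suc.prems by simp
  ultimately show ?case using Suc.IH by fastforce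
qed simp

definition std :: struct where
  "std = \<lparr>zr = 0, sc = Suc, ad = (+), ml = (*)\<rparr>"

lemma mval_std [simp]: "mval std e t = val e t"
  by (induction t) (simp_all add: std_def)

lemma msat_std [simp]: "msat std e \<phi> = sat e \<phi>"
  by (induction \<phi> arbitrary: e) simp_all

locale PA_model =
  fixes M :: struct
  assumes PA: "\<phi> \<in> PA \<Longrightarrow> msat M e \<phi>"
begin

abbreviation zero ("\<zero>") where "\<zero> \<equiv> zr M"
abbreviation plus (infixl "\<oplus>" 65) where "x \<oplus> y \<equiv> ad M x y"
abbreviation times (infixl "\<otimes>" 70) where "x \<otimes> y \<equiv> ml M x y"
abbreviation S where "S \<equiv> sc M"

lemma S_neq_zero [simp]: "S x \<noteq> \<zero>"
  using PA[OF PA.Succ_neq_Zero] by simp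

lemma zero_neq_S [simp]: "\<zero> \<noteq> S x"
  using S_neq_zero[of x] by (rule not_sym)

lemma S_inject [simp]: "S x = S y \<longleftrightarrow> x = y"
  using PA[OF PA.Succ_inject] by auto

lemma add_zero [simp]: "x \<oplus> \<zero> = x"
  using PA[OF PA.Add_Zero] by simp

lemma add_S [simp]: "x \<oplus> S y = S (x \<oplus> y)"
  using PA[OF PA.Add_Succ] by simp

lemma mult_zero [simp]: "x \<otimes> \<zero> = \<zero>"
  using PA[OF PA.Mul_Zero] by simp

lemma mult_S [simp]: "x \<otimes> S y = x \<otimes> y \<oplus> x"
  using PA[OF PA.Mul_Succ] by simp

text \<open>The universal prefix of the induction axiom is instantiated with the values of
  \<open>e\<close>, which gives induction with parameters. Induction inside \<open>M\<close> holds
  for formulas only, so each arithmetical law below that needs it is first written as an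
  \<open>fm\<close>.\<close>

lemma induct_fm:
  assumes zero: "msat M (case_nat \<zero> e) \<phi>"
    and step: "\<And>x. msat M (case_nat x e) \<phi> \<Longrightarrow> msat M (case_nat (S x) e) \<phi>"
  shows "msat M (case_nat x e) \<phi>"
proof -
  obtain k where k: "closed_fm k (induction_fm \<phi>)" using closed_fm_exists by blast
  have "msat M (\<lambda>i. if i < k then e i else e (i - k)) (induction_fm \<phi>)"
    by (rule msat_Forall_pow) (rule PA[OF PA.Induction[OF k]])
  also have "msat M (\<lambda>i. if i < k then e i else e (i - k)) (induction_fm \<phi>) =
      msat M e (induction_fm \<phi>)"
    using k by (rule msat_cong_closed) simp
  finally have "msat M e (induction_fm \<phi>)" .
  moreover have "(\<lambda>i. mval M (case_nat m e) (case_nat (Succ (Var 0)) (\<lambda>i. Var (Suc i)) i)) =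
      case_nat (S m) e" for m
    by (rule ext) (simp split: nat.split)
  ultimately show ?thesis using assms by (simp add: induction_fm_def msat_inst1 msat_subst)
qed

section \<open>Arithmetic and order inside a model\<close>

lemma zero_add [simp]: "\<zero> \<oplus> x = x"
  using induct_fm[of undefined "Eql (Add Zero (Var 0)) (Var 0)"] by simp

lemma S_add [simp]: "S x \<oplus> y = S (x \<oplus> y)"
  using induct_fm[of "\<lambda>_. x" "Eql (Add (Succ (Var 1)) (Var 0)) (Succ (Add (Var 1) (Var 0)))"]
  by simp

lemma add_comm: "x \<oplus> y = y \<oplus> x"
  using induct_fm[of "\<lambda>_. x" "Eql (Add (Var 1) (Var 0)) (Add (Var 0) (Var 1))"] by simp

lemma add_assoc: "x \<oplus> y \<oplus> z = x \<oplus> (y \<oplus> z)"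
  using induct_fm[of "case_nat x (\<lambda>_. y)"
    "Eql (Add (Add (Var 1) (Var 2)) (Var 0)) (Add (Var 1) (Add (Var 2) (Var 0)))"]
  by (simp add: numeral_2_eq_2)

lemma add_left_comm: "x \<oplus> (y \<oplus> z) = y \<oplus> (x \<oplus> z)"
  by (metis add_assoc add_comm)

lemmas add_ac = add_assoc add_comm add_left_comm

lemma add_right_cancel [simp]: "x \<oplus> z = y \<oplus> z \<longleftrightarrow> x = y"
  using induct_fm[of "case_nat x (\<lambda>_. y)"
    "Impl (Eql (Add (Var 1) (Var 0)) (Add (Var 2) (Var 0))) (Eql (Var 1) (Var 2))"]
  by (auto simp: numeral_2_eq_2)

lemma add_left_cancel [simp]: "z \<oplus> x = z \<oplus> y \<longleftrightarrow> x = y"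
  using add_right_cancel by (simp add: add_comm[of z])

lemma zero_or_S: "x = \<zero> \<or> (\<exists>y. x = S y)"
  using induct_fm[of undefined "Disj (Eql (Var 0) Zero) (Exists (Eql (Var 1) (Succ (Var 0))))"]
  by auto

lemma add_distrib_mult: "(x \<oplus> y) \<otimes> z = x \<otimes> z \<oplus> y \<otimes> z"
  using induct_fm[of "case_nat x (\<lambda>_. y)"
    "Eql (Mul (Add (Var 1) (Var 2)) (Var 0)) (Add (Mul (Var 1) (Var 0)) (Mul (Var 2) (Var 0)))"]
  by (simp add: add_ac numeral_2_eq_2)

lemma S_mult: "S x \<otimes> y = x \<otimes> y \<oplus> y"
  using induct_fm[of "\<lambda>_. x" "Eql (Mul (Succ (Var 1)) (Var 0)) (Add (Mul (Var 1) (Var 0)) (Var 0))"]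
  by (simp add: add_ac)

definition le (infix "\<preceq>" 50) where "x \<preceq> y \<longleftrightarrow> (\<exists>z. x \<oplus> z = y)"

abbreviation lt (infix "\<prec>" 50) where "x \<prec> y \<equiv> S x \<preceq> y"

lemma msat_Le [simp]: "msat M e (Le s t) \<longleftrightarrow> mval M e s \<preceq> mval M e t"
  by (simp add: Le_def le_def)

lemma msat_Lt [simp]: "msat M e (Lt s t) \<longleftrightarrow> mval M e s \<prec> mval M e t"
  by (simp add: Lt_def)

lemma zero_le [simp]: "\<zero> \<preceq> x"
  by (simp add: le_def)

lemma le_refl [simp]: "x \<preceq> x"
  unfolding le_def by (intro exI[of _ \<zero>]) simp

lemma le_trans: "x \<preceq> y \<Longrightarrow> y \<preceq> z \<Longrightarrow> x \<preceq> z"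
  unfolding le_def using add_assoc by metis

lemma add_eq_zero: "x \<oplus> y = \<zero> \<Longrightarrow> x = \<zero> \<and> y = \<zero>"
  using zero_or_S[of x] zero_or_S[of y] by auto

lemma le_antisym: "x \<preceq> y \<Longrightarrow> y \<preceq> x \<Longrightarrow> x = y"
  unfolding le_def by (metis add_assoc add_eq_zero add_left_cancel add_zero)

lemma le_S_iff: "x \<preceq> S y \<longleftrightarrow> x \<preceq> y \<or> x = S y"
proof
  assume "x \<preceq> S y"
  then obtain z where "x \<oplus> z = S y" unfolding le_def by blast
  then show "x \<preceq> y \<or> x = S y" using zero_or_S[of z] by (auto simp: le_def)
next
  assume "x \<preceq> y \<or> x = S y"
  then show "x \<preceq> S y" unfolding le_def using add_S add_zero by metis
qed

lemma S_le_S [simp]: "S x \<preceq> S y \<longleftrightarrow> x \<preceq> y"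
  by (simp add: le_def)

lemma S_le_iff: "S x \<preceq> y \<longleftrightarrow> x \<preceq> y \<and> x \<noteq> y"
proof
  assume "S x \<preceq> y"
  then obtain z where z: "x \<oplus> S z = y" by (auto simp: le_def)
  then have "x \<noteq> y" using add_left_cancel[of x "S z" \<zero>] by auto
  then show "x \<preceq> y \<and> x \<noteq> y" using z le_def by blast
next
  assume *: "x \<preceq> y \<and> x \<noteq> y"
  then obtain z where z: "x \<oplus> z = y" unfolding le_def by blast
  with * have "z \<noteq> \<zero>" by auto
  then show "S x \<preceq> y" using z zero_or_S[of z] by (auto simp: le_def)
qed

lemma le_total: "x \<preceq> y \<or> y \<preceq> x"
proof -
  have "msat M (case_nat z (\<lambda>_. y)) (Disj (Le (Var 0) (Var 1)) (Le (Var 1) (Var 0)))" for z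
    by (rule induct_fm) (auto simp: le_S_iff S_le_iff)
  then show ?thesis by simp
qed

lemma le_zero_iff [simp]: "x \<preceq> \<zero> \<longleftrightarrow> x = \<zero>"
  using le_antisym zero_le le_refl by blast

lemma not_le: "\<not> x \<preceq> y \<longleftrightarrow> y \<prec> x"
  using le_total le_antisym S_le_iff by metis

lemma le_add [simp]: "x \<preceq> x \<oplus> y" "x \<preceq> y \<oplus> x"
  by (auto simp: le_def add_comm[of y])

text \<open>Induction on \<open>?\<psi>\<close>, which says that no element up to y satisfies
  \<phi>. The substitution in it keeps the inner variable at \<open>Var 0\<close> and skips the
  index of y, so that \<phi> sees its own parameters.\<close>

lemma least_number:
  assumes "msat M (case_nat x e) \<phi>"
  shows "\<exists>y. msat M (case_nat y e) \<phi> \<and> (\<forall>z. msat M (case_nat z e) \<phi> \<longrightarrow> y \<preceq> z)"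
proof (rule ccontr)
  assume no: "\<nexists>y. msat M (case_nat y e) \<phi> \<and> (\<forall>z. msat M (case_nat z e) \<phi> \<longrightarrow> y \<preceq> z)"
  let ?\<psi> = "Forall (Impl (Le (Var 0) (Var 1)) (Neg (subst (case_nat (Var 0) (\<lambda>i. Var (Suc (Suc i)))) \<phi>)))"
  have "(\<lambda>i. mval M (case_nat z (case_nat y e)) (case_nat (Var 0) (\<lambda>i. Var (Suc (Suc i))) i)) =
      case_nat z e" for y z
    by (rule ext) (simp split: nat.split)
  then have \<psi>: "msat M (case_nat y e) ?\<psi> \<longleftrightarrow> (\<forall>z. z \<preceq> y \<longrightarrow> \<not> msat M (case_nat z e) \<phi>)" for y
    by (simp add: msat_subst)
  have "msat M (case_nat x e) ?\<psi>"
  proof (rule induct_fm)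
    show "msat M (case_nat \<zero> e) ?\<psi>" unfolding \<psi> using no le_antisym zero_le by metis
    fix y assume "msat M (case_nat y e) ?\<psi>"
    then show "msat M (case_nat (S y) e) ?\<psi>" unfolding \<psi> using no le_S_iff not_le by metis
  qed
  then show False unfolding \<psi> using assms le_refl by blast
qed

subsection \<open>Standard elements\<close>

primrec emb :: "nat \<Rightarrow> nat" where
  "emb 0 = \<zero>"
| "emb (Suc n) = S (emb n)"

lemma mval_num [simp]: "mval M e (num n) = emb n"
  by (induction n) auto

lemma emb_add: "emb (m + n) = emb m \<oplus> emb n"
  by (induction n) auto

lemma emb_mult: "emb (m * n) = emb m \<otimes> emb n"
  by (induction n) (auto simp: emb_add add_comm)

text \<open>The standard elements are an initial segment of \<open>M\<close>; absoluteness and every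
  passage from bounded elements to numbers rest on this.\<close>

lemma le_emb_iff: "x \<preceq> emb n \<longleftrightarrow> (\<exists>m\<le>n. x = emb m)"
proof (induction n)
  case (Suc n)
  have "(\<exists>m\<le>Suc n. x = emb m) \<longleftrightarrow> (\<exists>m\<le>n. x = emb m) \<or> x = emb (Suc n)"
    by (auto simp: le_Suc_eq simp del: emb.simps)
  then show ?case using Suc.IH by (simp add: le_S_iff)
qed simp

lemma emb_le_emb [simp]: "emb m \<preceq> emb n \<longleftrightarrow> m \<le> n"
proof (induction m arbitrary: n)
  case (Suc m)
  then show ?case by (cases n) simp_all
qed simp

lemma emb_inject [simp]: "emb m = emb n \<longleftrightarrow> m = n"
  by (metis emb_le_emb le_refl le_antisym order_antisym order_refl)

lemma emb_lt_emb [simp]: "emb m \<prec> emb n \<longleftrightarrow> m < n"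
  using emb_le_emb[of "Suc m" n] unfolding emb.simps Suc_le_eq .

lemma lt_emb_iff: "x \<prec> emb n \<longleftrightarrow> (\<exists>m<n. x = emb m)"
proof
  assume x: "x \<prec> emb n"
  then obtain m where "x = emb m" using S_le_iff le_emb_iff by blast
  then show "\<exists>m<n. x = emb m" using x by auto
qed auto

lemma emb_le_nonstandard: "x \<notin> range emb \<Longrightarrow> emb n \<preceq> x"
  using le_total le_emb_iff by blast

lemma mval_emb: "mval M (\<lambda>i. emb (e i)) t = emb (val e t)"
  by (induction t) (simp_all add: emb_add emb_mult)

lemma case_nat_emb: "case_nat (emb m) (\<lambda>i. emb (e i)) = (\<lambda>i. emb (case_nat m e i))"
  by (rule ext) (simp split: nat.split)

text \<open>By \<open>le_emb_iff\<close> a quantifier with a standard bound has the same range in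
  \<open>M\<close> as among the natural numbers.\<close>

lemma delta0_absolute: "delta0 \<phi> \<Longrightarrow> msat M (\<lambda>i. emb (e i)) \<phi> = sat e \<phi>"
proof (induction arbitrary: e rule: delta0.induct)
  case (4 \<phi> t)
  have "msat M (\<lambda>i. emb (e i)) (Forall (Impl (Le (Var 0) (lift_tm t)) \<phi>)) \<longleftrightarrow>
      (\<forall>m\<le>val e t. msat M (case_nat (emb m) (\<lambda>i. emb (e i))) \<phi>)"
    by (auto simp: mval_emb le_emb_iff)
  then show ?case unfolding case_nat_emb 4 by simp
next
  case (5 \<phi> t)
  have "msat M (\<lambda>i. emb (e i)) (Exists (Conj (Le (Var 0) (lift_tm t)) \<phi>)) \<longleftrightarrow>
      (\<exists>m\<le>val e t. msat M (case_nat (emb m) (\<lambda>i. emb (e i))) \<phi>)"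
    by (auto simp: mval_emb le_emb_iff)
  then show ?case unfolding case_nat_emb 5 by simp
qed (auto simp: mval_emb)

lemma delta0_absolute_env:
  assumes "delta0 \<phi>" "closed_fm (length xs) \<phi>"
  shows "msat M (env (map emb xs)) \<phi> = sat (env xs) \<phi>"
proof -
  have "msat M (env (map emb xs)) \<phi> = msat M (\<lambda>i. emb (env xs i)) \<phi>"
    by (rule msat_cong_closed[OF assms(2)]) simp
  then show ?thesis by (simp only: delta0_absolute[OF assms(1)])
qed

subsection \<open>Lengths of standard strings\<close>

definition beta where
  "beta a b i r \<longleftrightarrow> r \<prec> S (S i \<otimes> b) \<and> (\<exists>q. a = q \<otimes> S (S i \<otimes> b) \<oplus> r)"

lemma msat_Beta [simp]:
  "msat M e (Beta a b i r) \<longleftrightarrow> beta (mval M e a) (mval M e b) (mval M e i) (mval M e r)"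
  by (simp add: Beta_def Let_def beta_def)

lemma division_unique_le:
  assumes "q \<otimes> m \<oplus> r = q' \<otimes> m \<oplus> r'" "r \<prec> m" "r' \<prec> m" "q \<preceq> q'"
  shows "r = r'"
proof -
  obtain z where z: "q \<oplus> z = q'" using assms(4) by (auto simp: le_def)
  have eq: "r = z \<otimes> m \<oplus> r'" using assms(1) z[symmetric] by (simp add: add_distrib_mult add_assoc)
  show ?thesis
  proof (cases "z = \<zero>")
    case True
    then show ?thesis using assms(1) z by simp
  next
    case False
    then obtain y where "z = S y" using zero_or_S by blast
    then have "m \<preceq> r" using eq by (simp add: S_mult add_ac)
    then show ?thesis using assms(2) not_le by blast
  qed
qed

lemma division_unique:
  assumes "q \<otimes> m \<oplus> r = q' \<otimes> m \<oplus> r'" "r \<prec> m" "r' \<prec> m"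
  shows "r = r'"
  using division_unique_le[of q m r q' r'] division_unique_le[of q' m r' q r] assms le_total by metis

lemma beta_unique: "beta a b i r \<Longrightarrow> beta a b i r' \<Longrightarrow> r = r'"
  unfolding beta_def using division_unique by blast

lemma beta_emb:
  assumes "a mod (1 + (i + 1) * b) = r"
  shows "beta (emb a) (emb b) (emb i) (emb r)"
proof -
  let ?m = "Suc (Suc i * b)"
  have m: "emb ?m = S (S (emb i) \<otimes> emb b)" by (simp only: emb.simps emb_mult)
  have r: "a mod ?m = r" using assms by simp
  then have "r < ?m" by (metis mod_less_divisor zero_less_Suc)
  then have "emb r \<prec> emb ?m" by simp
  moreover have "emb a = emb (a div ?m * ?m + r)" using r by (metis div_mult_mod_eq)
  ultimately show ?thesis unfolding beta_def m emb_add emb_mult by blast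
qed

lemma msat_Length:
  "msat M e (Length x k) \<longleftrightarrow> (\<exists>a b. beta a b \<zero> \<zero> \<and>
     (\<forall>i. i \<prec> mval M e k \<longrightarrow> (\<exists>r. beta a b i r \<and> (beta a b (S i) (S (r \<oplus> r)) \<or>
       beta a b (S i) (S (S (r \<oplus> r)))))) \<and> beta a b (mval M e k) (mval M e x))"
  by (simp add: Length_def length_fm_def msat_inst2 eval_nat_numeral del: mult_S)

text \<open>The pair a, b that codes the prefixes may be nonstandard, but \<open>beta\<close> is
  functional in \<open>M\<close>. Ordinary induction on i therefore forces the first entries to be
  codes of standard strings. Conversely \<open>beta_exists\<close> supplies a standard pair.\<close>

lemma msat_Length_standard:
  assumes "mval M e k = emb l"
  shows "msat M e (Length x k) \<longleftrightarrow> (\<exists>s. length s = l \<and> mval M e x = emb (code s))"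
proof
  assume "msat M e (Length x k)"
  then obtain a b where ab: "beta a b \<zero> \<zero>" "beta a b (emb l) (mval M e x)"
    "\<And>i. i \<prec> emb l \<Longrightarrow> \<exists>r. beta a b i r \<and> (beta a b (S i) (S (r \<oplus> r)) \<or>
       beta a b (S i) (S (S (r \<oplus> r))))"
    unfolding msat_Length assms by blast
  have "\<exists>s. length s = i \<and> beta a b (emb i) (emb (code s))" if "i \<le> l" for i
    using that
  proof (induction i)
    case 0 then show ?case using ab(1) by simp
  next
    case (Suc i)
    then obtain s where s: "length s = i" "beta a b (emb i) (emb (code s))" by auto
    have code: "emb (code (s @ [False])) = S (emb (code s) \<oplus> emb (code s))"
      "emb (code (s @ [True])) = S (S (emb (code s) \<oplus> emb (code s)))"
      by (simp_all add: emb_add[symmetric] mult_2)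
    obtain r where "beta a b (emb i) r"
      "beta a b (S (emb i)) (S (r \<oplus> r)) \<or> beta a b (S (emb i)) (S (S (r \<oplus> r)))"
      using ab(3)[of "emb i"] Suc.prems by auto
    then have "\<exists>c. beta a b (emb (Suc i)) (emb (code (s @ [c])))"
      using beta_unique[OF s(2)] code by auto
    then show ?case using s(1) by (metis length_append_singleton)
  qed
  then show "\<exists>s. length s = l \<and> mval M e x = emb (code s)"
    using ab(2) beta_unique by blast
next
  assume "\<exists>s. length s = l \<and> mval M e x = emb (code s)"
  then obtain s where s: "length s = l" "mval M e x = emb (code s)" by blast
  obtain a b where ab: "\<forall>i\<le>l. a mod (1 + (i + 1) * b) = code (take i s)"
    using beta_exists[of l "\<lambda>i. code (take i s)"] by (elim exE)
  then have beta: "beta (emb a) (emb b) (emb i) (emb (code (take i s)))" if "i \<le> l" for i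
    using that by (intro beta_emb) blast
  have step: "\<exists>r. beta (emb a) (emb b) i r \<and> (beta (emb a) (emb b) (S i) (S (r \<oplus> r)) \<or>
      beta (emb a) (emb b) (S i) (S (S (r \<oplus> r))))" if i: "i \<prec> emb l" for i
  proof -
    obtain j where j: "i = emb j" "j < l" using i lt_emb_iff by blast
    let ?r = "code (take j s)"
    have "emb (code (take (Suc j) s)) = S (emb ?r \<oplus> emb ?r) \<or>
        emb (code (take (Suc j) s)) = S (S (emb ?r \<oplus> emb ?r))"
      using j(2) s(1) by (simp add: code_take emb_add[symmetric] mult_2)
    then show ?thesis using beta[of j] beta[of "Suc j"] j by (intro exI[of _ "emb ?r"]) auto
  qed
  have "beta (emb a) (emb b) \<zero> \<zero>" using beta[of 0] by simp
  moreover have "beta (emb a) (emb b) (emb l) (emb (code s))" using beta[of l] s(1) by simp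
  ultimately show "msat M e (Length x k)" unfolding msat_Length assms s(2) using step by blast
qed

subsection \<open>Complexity in a model\<close>

definition out :: "fm \<Rightarrow> nat \<Rightarrow> nat \<Rightarrow> bool" where
  "out D q x \<longleftrightarrow> msat M (env [q, x]) D"

lemma msat_out:
  assumes "closed_fm 2 D"
  shows "msat M e (inst D [s, t]) \<longleftrightarrow> out D (mval M e s) (mval M e t)"
  using msat_inst[of "[s, t]"] assms by (simp add: out_def numeral_2_eq_2)

definition len :: "nat \<Rightarrow> nat \<Rightarrow> bool" where
  "len x k \<longleftrightarrow> msat M (env [x, k]) (Length (Var 0) (Var 1))"

lemma msat_len: "msat M e (Length s t) \<longleftrightarrow> len (mval M e s) (mval M e t)"
  unfolding len_def msat_Length by simp

lemma len_emb_iff: "len x (emb l) \<longleftrightarrow> (\<exists>s. length s = l \<and> x = emb (code s))"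
  unfolding len_def by (subst msat_Length_standard) auto

definition ceq :: "fm \<Rightarrow> nat \<Rightarrow> nat \<Rightarrow> bool" where
  "ceq D x k \<longleftrightarrow> (\<exists>q. out D q x \<and> len q k) \<and> (\<forall>q l. out D q x \<and> len q l \<longrightarrow> k \<preceq> l)"

lemma msat_C_eq:
  assumes "closed_fm 2 D"
  shows "msat M e (C_eq D x k) \<longleftrightarrow> ceq D (mval M e x) (mval M e k)"
  unfolding C_eq_def msat_inst2 ceq_def complexity_fm_def
  by (simp add: msat_out[OF assms] msat_len eval_nat_numeral)

lemma msat_C_ge:
  assumes "closed_fm 2 D"
  shows "msat M e (C_ge D x k) \<longleftrightarrow> (\<forall>l. ceq D (mval M e x) l \<longrightarrow> mval M e k \<preceq> l)"
  by (simp add: C_ge_def msat_C_eq[OF assms])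

lemma msat_C_gt:
  assumes "closed_fm 2 D"
  shows "msat M e (C_gt D x k) \<longleftrightarrow> (\<forall>l. ceq D (mval M e x) l \<longrightarrow> mval M e k \<prec> l)"
  by (simp add: C_gt_def msat_C_eq[OF assms])

lemma ceq_unique: "ceq D x k \<Longrightarrow> ceq D x l \<Longrightarrow> k = l"
  unfolding ceq_def by (blast intro: le_antisym)

text \<open>All lengths below that of a standard program are standard, so the minimum can be taken
  outside \<open>M\<close> by \<open>LEAST\<close>. The complexity in \<open>M\<close> is then a
  standard number even if x is not.\<close>

lemma ceq_exists:
  assumes "out D (emb (code p)) x"
  shows "\<exists>k\<le>length p. ceq D x (emb k)"
proof -
  define P where "P k \<longleftrightarrow> (\<exists>q. out D q x \<and> len q (emb k))" for k
  have P: "P (length p)" unfolding P_def len_emb_iff using assms by blast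
  define k where "k = (LEAST k. P k)"
  have k: "P k" "k \<le> length p" unfolding k_def using P by (auto intro: LeastI Least_le)
  have "emb k \<preceq> l" if "out D q x" "len q l" for q l
  proof (rule ccontr)
    assume "\<not> emb k \<preceq> l"
    then obtain j where "l = emb j" "j < k" unfolding not_le lt_emb_iff by blast
    then show False using that not_less_Least[of j P] unfolding k_def P_def by blast
  qed
  then have "ceq D x (emb k)" using k(1) unfolding ceq_def P_def by blast
  then show ?thesis using k(2) by blast
qed

end

lemma PA_model_std: "PA_model std"
  by unfold_locales (use PA_true in \<open>auto simp: true_fm_def\<close>)

lemma msat_sound: "\<Gamma> \<turnstile> \<phi> \<Longrightarrow> (\<And>\<psi>. \<psi> \<in> \<Gamma> \<Longrightarrow> msat M e \<psi>) \<Longrightarrow> msat M e \<phi>"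
proof (induction arbitrary: e rule: proves.induct)
  case (EqE \<Gamma> s t \<phi>) then show ?case by (simp add: msat_inst1)
next
  case (AllE \<Gamma> \<phi> t) then show ?case by (simp add: msat_inst1)
next
  case (ImpI \<phi> \<Gamma> \<psi>) then show ?case by auto
next
  case (ImpE \<Gamma> \<phi> \<psi>) then show ?case by (metis msat.simps(3))
next
  case (Contr \<phi> \<Gamma>) then show ?case by (metis insert_iff msat.simps(1) msat_connectives(1))
next
  case (AllI \<Gamma> \<phi>)
  have "msat M (case_nat m e) \<phi>" for m
    by (rule AllI.IH) (use AllI.prems in auto)
  then show ?case by simp
qed auto

section \<open>Closedness and bounded quantifiers\<close>

lemma lift_tm_simps [simp]:
  "lift_tm (Var i) = Var (Suc i)" "lift_tm Zero = Zero" "lift_tm (Succ t) = Succ (lift_tm t)"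
  "lift_tm (Add s t) = Add (lift_tm s) (lift_tm t)" "lift_tm (Mul s t) = Mul (lift_tm s) (lift_tm t)"
  by (simp_all add: lift_tm_def)

lemma closed_lift_tm_iff [simp]: "closed_tm (Suc k) (lift_tm t) = closed_tm k t"
  by (induction t) auto

lemma closed_num [simp]: "closed_tm k (num n)"
  by (induction n) auto

lemma closed_connectives [simp]:
  "closed_fm k (Neg \<phi>) = closed_fm k \<phi>"
  "closed_fm k (Conj \<phi> \<psi>) \<longleftrightarrow> closed_fm k \<phi> \<and> closed_fm k \<psi>"
  "closed_fm k (Disj \<phi> \<psi>) \<longleftrightarrow> closed_fm k \<phi> \<and> closed_fm k \<psi>"
  "closed_fm k (Iff \<phi> \<psi>) \<longleftrightarrow> closed_fm k \<phi> \<and> closed_fm k \<psi>"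
  "closed_fm k (Exists \<phi>) = closed_fm (Suc k) \<phi>"
  "closed_fm k (Le s t) \<longleftrightarrow> closed_tm k s \<and> closed_tm k t"
  "closed_fm k (Lt s t) \<longleftrightarrow> closed_tm k s \<and> closed_tm k t"
  by (auto simp: Neg_def Conj_def Disj_def Iff_def Exists_def Le_def Lt_def)

lemma closed_Conjs [simp]: "closed_fm k (Conjs \<phi>s) \<longleftrightarrow> (\<forall>\<phi>\<in>set \<phi>s. closed_fm k \<phi>)"
  by (induction \<phi>s) (auto simp: Conjs_def)

lemma closed_inst:
  assumes "closed_fm (length ts) \<phi>" "\<And>t. t \<in> set ts \<Longrightarrow> closed_tm k t"
  shows "closed_fm k (inst \<phi> ts)"
  unfolding inst_def using assms by (intro closed_subst) auto

lemma closed_complexity: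
  assumes "closed_fm 2 D" "closed_tm m x" "closed_tm m k"
  shows "closed_fm m (C_eq D x k)" "closed_fm m (C_ge D x k)" "closed_fm m (C_gt D x k)"
proof -
  have "closed_fm 2 length_fm"
    by (simp add: length_fm_def Beta_def Let_def)
  then have L: "closed_fm j (Length s t)" if "closed_tm j s" "closed_tm j t" for j s t
    unfolding Length_def using that by (intro closed_inst) (auto simp: numeral_2_eq_2)
  have "closed_fm j (inst D [s, t])" if "closed_tm j s" "closed_tm j t" for j s t
    using assms(1) that by (intro closed_inst) (auto simp: numeral_2_eq_2)
  then have C: "closed_fm 2 (complexity_fm D)"
    unfolding complexity_fm_def using L by simp
  then have C': "closed_fm j (C_eq D s t)" if "closed_tm j s" "closed_tm j t" for j s t
    unfolding C_eq_def using that by (intro closed_inst) (auto simp: numeral_2_eq_2)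
  then show "closed_fm m (C_eq D x k)" "closed_fm m (C_ge D x k)" "closed_fm m (C_gt D x k)"
    using assms(2,3) by (simp_all add: C_ge_def C_gt_def)
qed

lemma sentence_Forall_pow: "closed_fm (k + j) \<phi> \<Longrightarrow> closed_fm j ((Forall ^^ k) \<phi>)"
  by (induction k arbitrary: j) auto

lemma PA_sentence: "\<phi> \<in> PA \<Longrightarrow> sentence \<phi>"
  by (induction rule: PA.induct) (auto intro: sentence_Forall_pow)

lemma subtheoryI:
  assumes "\<And>\<psi>. \<psi> \<in> T \<Longrightarrow> sentence \<psi>" "PA \<subseteq> T"
    and "\<And>M \<psi> e. PA_model M \<Longrightarrow> (\<And>\<psi> e. \<psi> \<in> T \<Longrightarrow> msat M e \<psi>) \<Longrightarrow> \<psi> \<in> S \<Longrightarrow> msat M e \<psi>"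
  shows "subtheory S T"
  unfolding subtheory_def
proof (intro allI impI)
  fix \<phi> assume \<phi>: "S \<turnstile> \<phi>"
  show "T \<turnstile> \<phi>"
  proof (rule completeness)
    fix M e assume M: "\<And>\<psi> e. \<psi> \<in> T \<Longrightarrow> msat M e \<psi>"
    then have "PA_model M" using assms(2) by unfold_locales blast
    then show "msat M e \<phi>" using assms(3) M by (intro msat_sound[OF \<phi>]) blast
  qed (use assms in auto)
qed

text \<open>Universality of \<open>V\<close> and functionality of \<open>D'\<close> demand
  provability in \<open>PA\<close>; it is obtained here from truth in all models, without any formal
  derivation.\<close>

lemma PA_complete: "(\<And>M e. PA_model M \<Longrightarrow> msat M e \<phi>) \<Longrightarrow> PA \<turnstile> \<phi>"
  by (rule completeness) (auto simp: PA_sentence PA_model_def)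

lemma (in PA_model) PA_provable: "PA \<turnstile> \<phi> \<Longrightarrow> msat M e \<phi>"
  using PA msat_sound by blast

definition BAll :: "tm \<Rightarrow> fm \<Rightarrow> fm" where
  "BAll t \<phi> = Forall (Impl (Le (Var 0) (lift_tm t)) \<phi>)"

definition BEx :: "tm \<Rightarrow> fm \<Rightarrow> fm" where
  "BEx t \<phi> = Exists (Conj (Le (Var 0) (lift_tm t)) \<phi>)"

text \<open>\<open>Le\<close> is not literally a \<open>\<Delta>\<^sub>0\<close>-formula; \<open>Leq\<close> is an equivalent one.\<close>

definition Leq :: "tm \<Rightarrow> tm \<Rightarrow> fm" where
  "Leq s t = BEx t (Eql (Var 0) (lift_tm s))"

lemma closed_bounded [simp]:
  "closed_fm k (BAll t \<phi>) \<longleftrightarrow> closed_tm k t \<and> closed_fm (Suc k) \<phi>"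
  "closed_fm k (BEx t \<phi>) \<longleftrightarrow> closed_tm k t \<and> closed_fm (Suc k) \<phi>"
  "closed_fm k (Leq s t) \<longleftrightarrow> closed_tm k s \<and> closed_tm k t"
  by (auto simp: BAll_def BEx_def Leq_def)

lemma sat_bounded [simp]:
  "sat e (BAll t \<phi>) \<longleftrightarrow> (\<forall>x\<le>val e t. sat (case_nat x e) \<phi>)"
  "sat e (BEx t \<phi>) \<longleftrightarrow> (\<exists>x\<le>val e t. sat (case_nat x e) \<phi>)"
  "sat e (Leq s t) \<longleftrightarrow> val e s \<le> val e t"
  by (auto simp: BAll_def BEx_def Leq_def)

lemma (in PA_model) msat_bounded [simp]:
  "msat M e (BAll t \<phi>) \<longleftrightarrow> (\<forall>x. x \<preceq> mval M e t \<longrightarrow> msat M (case_nat x e) \<phi>)"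
  "msat M e (BEx t \<phi>) \<longleftrightarrow> (\<exists>x. x \<preceq> mval M e t \<and> msat M (case_nat x e) \<phi>)"
  "msat M e (Leq s t) \<longleftrightarrow> mval M e s \<preceq> mval M e t"
  by (auto simp: BAll_def BEx_def Leq_def)

lemma delta0_connectives [intro, simp]:
  "delta0 (Eql s t)"
  "delta0 \<phi> \<Longrightarrow> delta0 (Neg \<phi>)"
  "delta0 \<phi> \<Longrightarrow> delta0 \<psi> \<Longrightarrow> delta0 (Impl \<phi> \<psi>)"
  "delta0 \<phi> \<Longrightarrow> delta0 \<psi> \<Longrightarrow> delta0 (Conj \<phi> \<psi>)"
  "delta0 \<phi> \<Longrightarrow> delta0 \<psi> \<Longrightarrow> delta0 (Disj \<phi> \<psi>)"
  by (simp_all add: Neg_def Conj_def Disj_def delta0.intros)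

lemma delta0_bounded [intro, simp]:
  "delta0 \<phi> \<Longrightarrow> delta0 (BAll t \<phi>)"
  "delta0 \<phi> \<Longrightarrow> delta0 (BEx t \<phi>)"
  "delta0 (Leq s t)"
  unfolding Leq_def BAll_def BEx_def by (rule delta0.intros; simp)+

lemma delta0_Conjs [intro, simp]: "\<forall>\<phi>\<in>set \<phi>s. delta0 \<phi> \<Longrightarrow> delta0 (Conjs \<phi>s)"
  by (induction \<phi>s) (auto simp: Conjs_def delta0.intros(1))

lemma subst_Exists: "subst \<sigma> (Exists \<phi>) = Exists (subst (up \<sigma>) \<phi>)"
  unfolding Exists_def by (simp only: subst_Neg subst_Forall)

lemma subst_Conj: "subst \<sigma> (Conj \<phi> \<psi>) = Conj (subst \<sigma> \<phi>) (subst \<sigma> \<psi>)"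
  by (simp add: Conj_def)

lemma subst_bounded_Le: "subst (up \<sigma>) (Le (Var 0) (lift_tm t)) = Le (Var 0) (lift_tm (subst_tm \<sigma> t))"
  unfolding Le_def subst_Exists by (simp add: subst_up_lift_tm)

lemma delta0_subst [intro, simp]: "delta0 \<phi> \<Longrightarrow> delta0 (subst \<sigma> \<phi>)"
proof (induction arbitrary: \<sigma> rule: delta0.induct)
  case (4 \<phi> t)
  then show ?case unfolding subst_Forall by (simp add: subst_bounded_Le delta0.intros)
next
  case (5 \<phi> t)
  then show ?case unfolding subst_Exists subst_Conj by (simp add: subst_bounded_Le delta0.intros)
qed (auto intro: delta0.intros)

lemma delta0_inst [intro, simp]: "delta0 \<phi> \<Longrightarrow> delta0 (inst \<phi> ts)"
  by (simp add: inst_def)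

lemma pi1_subst: "pi1 \<phi> \<Longrightarrow> pi1 (subst \<sigma> \<phi>)"
  by (induction arbitrary: \<sigma> rule: pi1.induct) (auto intro: pi1.intros)

subsection \<open>One unbounded quantifier suffices\<close>

text \<open>Two witnesses are merged without a pairing function: one z that bounds both replaces
  them. The substitution skips the index of z.\<close>

definition contract :: "fm \<Rightarrow> fm" where
  "contract \<delta> =
    BEx (Var 0) (BEx (Var 1) (subst (\<lambda>i. Var (if i < 2 then i else Suc i)) \<delta>))"

lemma delta0_contract: "delta0 \<delta> \<Longrightarrow> delta0 (contract \<delta>)"
  by (simp add: contract_def)

lemma closed_contract: "closed_fm (Suc (Suc k)) \<delta> \<Longrightarrow> closed_fm (Suc k) (contract \<delta>)"
  by (auto simp: contract_def intro!: closed_subst)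

lemma (in PA_model) msat_contract:
  "(\<exists>z. msat M (case_nat z e) (contract \<delta>)) \<longleftrightarrow> (\<exists>x w. msat M (case_nat w (case_nat x e)) \<delta>)"
proof -
  have "(\<lambda>i. mval M (case_nat w (case_nat x (case_nat z e))) (Var (if i < 2 then i else Suc i))) =
      case_nat w (case_nat x e)" for w x z
    by (rule ext) (auto split: nat.split)
  then have *: "msat M (case_nat z e) (contract \<delta>) \<longleftrightarrow>
      (\<exists>x. x \<preceq> z \<and> (\<exists>w. w \<preceq> z \<and> msat M (case_nat w (case_nat x e)) \<delta>))" for z
    by (simp add: contract_def msat_subst)
  have "\<exists>z. x \<preceq> z \<and> w \<preceq> z" for x w using le_total le_refl by blast
  then show ?thesis unfolding * by blast
qed

lemma delta0_dummy:
  assumes "delta0 \<phi>" "closed_fm k \<phi>"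
  shows "delta0 (lift \<phi>) \<and> closed_fm (Suc k) (lift \<phi>)"
  unfolding lift_def using assms by (auto intro: closed_subst)

text \<open>One \<delta> serves all models at once, the standard one included; only so can a halting
  time in \<open>M\<close> be compared with a real one.\<close>

lemma sigma1_normal_form:
  assumes "sigma1 \<phi>" "closed_fm k \<phi>"
  shows "\<exists>\<delta>. delta0 \<delta> \<and> closed_fm (Suc k) \<delta> \<and>
    (\<forall>M e. PA_model M \<longrightarrow> msat M e \<phi> = (\<exists>w. msat M (case_nat w e) \<delta>))"
  using assms
proof (induction arbitrary: k rule: sigma1.induct)
  case (1 \<phi>)
  then show ?case using delta0_dummy[of \<phi> k] by (intro exI[of _ "lift \<phi>"]) simp
next
  case (2 \<phi>)
  then have "closed_fm (Suc k) \<phi>" by simp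
  from "2.IH"[OF this] obtain \<delta> where \<delta>: "delta0 \<delta>" "closed_fm (Suc (Suc k)) \<delta>"
    "\<And>M e. PA_model M \<Longrightarrow> msat M e \<phi> = (\<exists>w. msat M (case_nat w e) \<delta>)"
    by blast
  then show ?case
    by (intro exI[of _ "contract \<delta>"])
      (simp add: delta0_contract closed_contract PA_model.msat_contract)
qed

text \<open>Stated for the negation, so that \<epsilon> describes the search for a refutation and
  its first variable is a refutation time.\<close>

lemma pi1_normal_form:
  assumes "pi1 \<phi>" "closed_fm k \<phi>"
  shows "\<exists>\<delta>. delta0 \<delta> \<and> closed_fm (Suc k) \<delta> \<and>
    (\<forall>M e. PA_model M \<longrightarrow> (\<not> msat M e \<phi>) = (\<exists>w. msat M (case_nat w e) \<delta>))"
  using assms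
proof (induction arbitrary: k rule: pi1.induct)
  case (1 \<phi>)
  then show ?case using delta0_dummy[of "Neg \<phi>" k] by (intro exI[of _ "lift (Neg \<phi>)"]) simp
next
  case (2 \<phi>)
  then have "closed_fm (Suc k) \<phi>" by simp
  from "2.IH"[OF this] obtain \<delta> where \<delta>: "delta0 \<delta>" "closed_fm (Suc (Suc k)) \<delta>"
    "\<And>M e. PA_model M \<Longrightarrow> (\<not> msat M e \<phi>) = (\<exists>w. msat M (case_nat w e) \<delta>)"
    by blast
  then show ?case
    by (intro exI[of _ "contract \<delta>"])
      (simp add: delta0_contract closed_contract PA_model.msat_contract)
qed

section \<open>Strings and their codes\<close>

text \<open>\<open>code x + 1\<close> is the number with binary expansion 1x. Hence the extensions
  of u by a fixed number of bits occupy an interval, which yields both the length and the order of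
  strings from their codes.\<close>

lemma code_append_bounds:
  "(code u + 1) * 2 ^ length s \<le> code (u @ s) + 1 \<and> code (u @ s) + 1 < (code u + 2) * 2 ^ length s"
proof (induction s rule: rev_induct)
  case (snoc b s)
  have "code (u @ s @ [b]) = 2 * code (u @ s) + (if b then 2 else 1)"
    unfolding append_assoc[symmetric] by (rule code_simps)
  then show ?case using snoc by (auto simp: algebra_simps)
qed simp

lemma code_bounds: "2 ^ length s \<le> code s + 1" "code s + 1 < 2 * 2 ^ length s"
  using code_append_bounds[of "[]" s] by auto

lemma power2_interval_unique:
  fixes m :: nat
  assumes "2 ^ i \<le> m" "m < 2 * 2 ^ i" "2 ^ j \<le> m" "m < 2 * 2 ^ j"
  shows "i = j"
proof -
  have "(2::nat) ^ i < 2 ^ Suc j" "(2::nat) ^ j < 2 ^ Suc i" using assms by auto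
  then have "i < Suc j" "j < Suc i" by (simp_all only: power_strict_increasing_iff)
  then show ?thesis by simp
qed

lemma length_le_iff: "length s \<le> n \<longleftrightarrow> code s + 1 < 2 * 2 ^ n"
proof
  assume "length s \<le> n"
  then have "(2::nat) ^ length s \<le> 2 ^ n" by simp
  then show "code s + 1 < 2 * 2 ^ n" using code_bounds(2)[of s] by linarith
next
  assume "code s + 1 < 2 * 2 ^ n"
  then have "(2::nat) ^ length s < 2 ^ Suc n" using code_bounds(1)[of s] by simp
  then show "length s \<le> n" by (simp only: power_strict_increasing_iff less_Suc_eq_le)
qed

lemma length_less_iff: "length s < n \<longleftrightarrow> code s + 1 < 2 ^ n"
proof (cases n)
  case (Suc m) then show ?thesis using length_le_iff[of s m] by (simp add: less_Suc_eq_le)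
qed simp

text \<open>At the first difference the strings continue a common u by \<open>False\<close> and by
  \<open>True\<close>, and the two sets of extensions occupy adjacent intervals.\<close>

lemma code_less:
  assumes "length x = length y" "x < y"
  shows "code x < code y"
proof -
  have "(x, y) \<in> lexord {(u, v). u < v}" using assms(2) by (simp add: list_less_def)
  then obtain u v w where *: "x = u @ False # v" "y = u @ True # w"
    using assms(1) unfolding lexord_def by auto
  then have l: "length v = length w" using assms(1) by simp
  have "code x + 1 < (code (u @ [False]) + 2) * 2 ^ length v"
    using code_append_bounds[of "u @ [False]" v] * by simp
  also have "\<dots> = (code (u @ [True]) + 1) * 2 ^ length w" using l by simp
  also have "\<dots> \<le> code y + 1" using code_append_bounds[of "u @ [True]" w] * by simp
  finally show ?thesis by simp
qed

lemma code_replicate_False: "code (x @ replicate k False) + 1 = (code x + 1) * 2 ^ k"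
proof (induction k)
  case (Suc k)
  have "code (x @ replicate (Suc k) False) = 2 * code (x @ replicate k False) + 1"
    unfolding replicate_append_same[symmetric] append_assoc[symmetric] replicate_Suc code_simps by simp
  then show ?case using Suc by simp
qed simp

lemma complexity_le:
  assumes "interpreter D"
  shows "complexity D x \<le> enat n \<longleftrightarrow> (\<exists>p. outputs D p x \<and> length p \<le> n)"
proof
  assume "\<exists>p. outputs D p x \<and> length p \<le> n"
  then obtain p where p: "outputs D p x" "length p \<le> n" by blast
  then have "complexity D x \<le> enat (length p)" unfolding complexity_def by (intro Inf_lower) auto
  then show "complexity D x \<le> enat n" using p(2) by (meson enat_ord_simps(1) order_trans)
next
  assume "complexity D x \<le> enat n"
  then obtain k where k: "complexity D x = enat k" "k \<le> n" by (cases "complexity D x") auto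
  then have "sat (\<lambda>_. 0) (C_eq D (num (code x)) (num k))"
    using assms by (subst sat_C_eq) (auto simp: interpreter_def)
  then show "\<exists>p. outputs D p x \<and> length p \<le> n"
    using assms k(2) sat_C_eq_iff[of D "\<lambda>_. 0" "num (code x)" x "num k"]
    by (auto simp: interpreter_def)
qed

lemma complexity_less:
  assumes "interpreter D"
  shows "complexity D x < enat n \<longleftrightarrow> (\<exists>p. outputs D p x \<and> length p < n)"
proof (cases n)
  case 0 then show ?thesis by (simp add: zero_enat_def[symmetric])
next
  case (Suc m)
  have "complexity D x < enat n \<longleftrightarrow> complexity D x \<le> enat m"
    unfolding Suc by (cases "complexity D x") auto
  then show ?thesis using complexity_le[OF assms] Suc by (simp add: less_Suc_eq_le)
qed

text \<open>Pigeonhole: 2^n strings against 2^n - 1 shorter programs, each with at most one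
  output.\<close>

lemma random_string_exists:
  assumes "interpreter D"
  shows "\<exists>x. length x = n \<and> enat n \<le> complexity D x"
proof (rule ccontr)
  assume no: "\<nexists>x. length x = n \<and> enat n \<le> complexity D x"
  define X where "X = {x :: bool list. length x = n}"
  have "\<forall>x\<in>X. \<exists>p. outputs D p x \<and> length p < n"
    unfolding complexity_less[OF assms, symmetric] using no by (auto simp: X_def not_le)
  then obtain f where f: "\<And>x. x \<in> X \<Longrightarrow> outputs D (f x) x \<and> length (f x) < n" by metis
  have "inj_on f X"
    using f outputs_functional[OF assms] by (intro inj_onI) metis
  then have inj: "inj_on (\<lambda>x. code (f x)) X"
    using inj_code by (auto simp: inj_on_def)
  have "(\<lambda>x. code (f x)) ` X \<subseteq> {..<2 ^ n - 1}"
    using f length_less_iff by fastforce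
  then have "card X \<le> card {..<2 ^ n - (1::nat)}" by (intro card_inj_on_le[OF inj]) auto
  moreover have "card X = 2 ^ n"
    using card_lists_length_eq[of "UNIV :: bool set" n] by (simp add: X_def)
  moreover have "(2::nat) ^ n > 0" by simp
  ultimately show False by (simp del: zero_less_power)
qed

text \<open>The lexicographic order on all strings is not well-founded, so \<open>LEAST\<close> is
  first turned into the minimum of a finite set.\<close>

lemma first_random:
  assumes "interpreter D"
  shows "length (first_random D n) = n" "enat n \<le> complexity D (first_random D n)"
    and "length x = n \<Longrightarrow> code x < code (first_random D n) \<Longrightarrow> complexity D x < enat n"
proof -
  let ?P = "\<lambda>x. length x = n \<and> enat n \<le> complexity D x"
  have fin: "finite {x. ?P x}"
    using finite_lists_length_eq[of "UNIV :: bool set" n] by simp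
  then have r: "first_random D n = Min {x. ?P x}"
    unfolding first_random_def using random_string_exists[OF assms] by (intro Least_Min) auto
  moreover have "Min {x. ?P x} \<in> {x. ?P x}"
    using fin random_string_exists[OF assms] by (intro Min_in) auto
  ultimately show l: "length (first_random D n) = n" "enat n \<le> complexity D (first_random D n)"
    by simp_all
  assume x: "length x = n" "code x < code (first_random D n)"
  show "complexity D x < enat n"
  proof (rule ccontr)
    assume "\<not> complexity D x < enat n"
    then have "first_random D n \<le> x" unfolding r using fin x(1) by (intro Min_le) auto
    moreover have "first_random D n \<noteq> x" using x(2) by auto
    ultimately have "first_random D n < x" using order_neq_le_trans by blast
    then show False using code_less[of "first_random D n" x] x l(1) by simp
  qed
qed

subsection \<open>Powers of two\<close>

text \<open>The language has no exponentiation. A nonzero number is a power of two iff each divisor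
  is 1 or even, and this needs only bounded quantifiers.\<close>

definition Pow2 :: fm where
  "Pow2 = Conj (Neg (Eql (Var 0) Zero)) (BAll (Var 0) (BAll (Var 1) (Impl
    (Eql (Mul (Var 1) (Var 0)) (Var 2))
    (Disj (Eql (Var 0) (Succ Zero)) (BEx (Var 0) (Eql (Add (Var 0) (Var 0)) (Var 1)))))))"

lemma Pow2_simps [simp]: "delta0 Pow2" "closed_fm (Suc 0) Pow2"
  by (simp_all add: Pow2_def)

lemma power2_iff_divisors_even:
  fixes y :: nat
  shows "(\<exists>k. y = 2 ^ k) \<longleftrightarrow> y \<noteq> 0 \<and> (\<forall>z. z dvd y \<longrightarrow> z = 1 \<or> even z)"
proof
  assume "\<exists>k. y = 2 ^ k"
  then obtain k where k: "y = 2 ^ k" by blast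
  have "z = 1 \<or> even z" if z: "z dvd y" for z
  proof -
    have "\<exists>j\<le>k. z = 2 ^ j"
      using z unfolding k divides_primepow_nat[OF two_is_prime_nat] .
    then obtain j where "z = 2 ^ j" by blast
    then show ?thesis by (cases j) auto
  qed
  then show "y \<noteq> 0 \<and> (\<forall>z. z dvd y \<longrightarrow> z = 1 \<or> even z)" using k by simp
next
  assume "y \<noteq> 0 \<and> (\<forall>z. z dvd y \<longrightarrow> z = 1 \<or> even z)"
  then show "\<exists>k. y = 2 ^ k"
  proof (induction y rule: less_induct)
    case (less y)
    show ?case
    proof (cases "y = 1")
      case True then show ?thesis by (intro exI[of _ 0]) simp
    next
      case False
      then have "even y" using less.prems dvd_refl[of y] by blast
      then obtain x where x: "y = 2 * x" by blast
      then have "x < y" "x \<noteq> 0" using less.prems by auto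
      moreover have "\<forall>z. z dvd x \<longrightarrow> z = 1 \<or> even z" using less.prems unfolding x by (meson dvd_mult)
      ultimately obtain k where "x = 2 ^ k" using less.IH by blast
      then show ?thesis using x by (intro exI[of _ "Suc k"]) simp
    qed
  qed
qed

lemma sat_Pow2 [simp]: "sat (env [y]) Pow2 \<longleftrightarrow> (\<exists>k. y = 2 ^ k)"
proof -
  have even: "(\<exists>v\<le>z. v + v = z) \<longleftrightarrow> even z" for z :: nat
  proof
    assume "even z"
    then obtain v where "z = v + v" by (metis evenE mult_2)
    then show "\<exists>v\<le>z. v + v = z" by (intro exI[of _ v]) simp
  qed auto
  have "(\<forall>w\<le>y. \<forall>z\<le>y. w * z = y \<longrightarrow> z = 1 \<or> even z) \<longleftrightarrow>
      (\<forall>z. z dvd y \<longrightarrow> z = 1 \<or> even z)" if "y \<noteq> 0"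
  proof (intro iffI allI impI)
    fix z assume *: "\<forall>w\<le>y. \<forall>z\<le>y. w * z = y \<longrightarrow> z = 1 \<or> even z" "z dvd y"
    then obtain w where "y = z * w" by blast
    then have "w * z = y" "w \<le> y" "z \<le> y" using that by (auto simp: mult.commute)
    then show "z = 1 \<or> even z" using *(1) by blast
  qed (metis dvd_triv_right)
  moreover have "sat (env [y]) Pow2 \<longleftrightarrow>
      y \<noteq> 0 \<and> (\<forall>w\<le>y. \<forall>z\<le>y. w * z = y \<longrightarrow> z = 1 \<or> even z)"
    by (simp add: Pow2_def even)
  ultimately show ?thesis unfolding power2_iff_divisors_even by blast
qed

lemma val_std: "mval std = val"
  by (intro ext) simp

lemma sat_inst_env:
  assumes "closed_fm (length ts) \<phi>"
  shows "sat e (inst \<phi> ts) \<longleftrightarrow> sat (env (map (val e) ts)) \<phi>"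
  using msat_inst[OF assms, of std e] by (simp add: val_std)

lemma (in PA_model) out_functional:
  assumes "interpreter D" "out D q x" "out D q y"
  shows "x = y"
proof -
  have D: "closed_fm 2 D" using assms(1) by (simp add: interpreter_def)
  have "msat M undefined (Forall (Forall (Forall
      (Impl (Conj (inst D [Var 2, Var 1]) (inst D [Var 2, Var 0])) (Eql (Var 1) (Var 0))))))"
    using assms(1) by (intro PA_provable) (simp add: interpreter_def)
  then show ?thesis using assms(2,3) by (auto simp: msat_out[OF D] eval_nat_numeral)
qed

section \<open>Theory B is contained in theory C\<close>

text \<open>\<delta> and \<epsilon> are the matrices of \<open>D\<close> and of the negation of
  \<open>U\<close>; their \<open>Var 0\<close> plays the part of a time.\<close>

locale optimal_pair =
  fixes D U \<delta> \<epsilon> :: fm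
  assumes D: "provably_optimal D" and U: "optimal_universal U"
    and delta: "delta0 \<delta>" "closed_fm (Suc (Suc (Suc 0))) \<delta>"
    "PA_model M \<Longrightarrow> msat M e D \<longleftrightarrow> (\<exists>w. msat M (case_nat w e) \<delta>)"
    and epsilon: "delta0 \<epsilon>" "closed_fm (Suc (Suc 0)) \<epsilon>"
    "PA_model M \<Longrightarrow> \<not> msat M e U \<longleftrightarrow> (\<exists>w. msat M (case_nat w e) \<epsilon>)"
begin

lemma interpreter_D: "interpreter D"
  using D by (simp add: provably_optimal_def)

lemma closed_D [simp]: "closed_fm 2 D" "closed_fm (Suc (Suc 0)) D"
  using interpreter_D by (simp_all add: interpreter_def numeral_2_eq_2)

lemma closed_U [simp]: "closed_fm (Suc 0) U"
  using U by (simp add: optimal_universal_def universal_def)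

lemma formula_simps [simp]:
  "delta0 \<delta>" "closed_fm (Suc (Suc (Suc 0))) \<delta>" "delta0 \<epsilon>" "closed_fm (Suc (Suc 0)) \<epsilon>"
  using delta(1,2) epsilon(1,2) by auto

lemma outputs_iff: "outputs D p x \<longleftrightarrow> (\<exists>v. sat (env [v, code p, code x]) \<delta>)"
  using delta(3)[OF PA_model_std, of "env [code p, code x]"]
  by (simp add: outputs_def true_fm_def sat_inst_env)

text \<open>The time bounds the output along with the witness, so the formula is bounded, and a
  standard program seen in \<open>M\<close> to halt by a standard time has a real output.\<close>

definition Halt :: fm where
  "Halt = BEx (Var 1) (BEx (Var 2) (inst \<delta> [Var 0, Var 2, Var 1]))"

lemma Halt_simps [simp]: "delta0 Halt" "closed_fm (Suc (Suc 0)) Halt"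
  by (auto simp: Halt_def intro!: closed_inst)

definition halts :: "nat \<Rightarrow> nat \<Rightarrow> bool" where
  "halts q w \<longleftrightarrow> sat (env [q, w]) Halt"

lemma halts_iff: "halts q w \<longleftrightarrow> (\<exists>y\<le>w. \<exists>v\<le>w. sat (env [v, q, y]) \<delta>)"
  by (simp add: halts_def Halt_def sat_inst_env)

lemma halts_mono: "halts q w \<Longrightarrow> w \<le> w' \<Longrightarrow> halts q w'"
  unfolding halts_iff by (meson order_trans)

text \<open>\<open>Last\<close> has the variables \<open>w\<close>, \<open>w'\<close>, \<open>s\<close>. If \<open>s = N + p\<close> where \<open>p < N\<close> and \<open>N\<close> is a power of
  two, and the program \<open>p - 1\<close> halts by time \<open>w'\<close> (no condition for \<open>p = 0\<close>), then every program
  of code at most \<open>N - 2\<close> that halts by time \<open>w\<close> already halts by time \<open>w'\<close>.\<close>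

definition Last :: fm where
  "Last = BAll (Var 2) (BAll (Var 3) (BAll (Var 4)
    (Impl (Eql (Var 5) (Add (Var 2) (Var 1)))
    (Impl (Leq (Succ (Var 1)) (Var 2))
    (Impl (inst Pow2 [Var 2])
    (Impl (BAll (Var 1) (Impl (Eql (Var 2) (Succ (Var 0))) (inst Halt [Var 0, Var 5])))
    (Impl (Leq (Succ (Succ (Var 0))) (Var 2))
    (Impl (inst Halt [Var 0, Var 3]) (inst Halt [Var 0, Var 4])))))))))"

lemma Last_simps [simp]: "delta0 Last" "closed_fm (Suc (Suc (Suc 0))) Last"
  by (auto simp: Last_def intro!: closed_inst)

text \<open>\<open>Last\<close> ranges over all decompositions of s, but only one has p below a
  power of two: that power is the largest one not exceeding s.\<close>

lemma sat_Last:
  assumes "p < 2 ^ i"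
    and last: "\<And>q w w'. q + 2 \<le> 2 ^ i \<Longrightarrow> halts q w \<Longrightarrow> (\<And>r. p = Suc r \<Longrightarrow> halts r w') \<Longrightarrow> halts q w'"
  shows "sat (env [w, w', 2 ^ i + p]) Last"
proof -
  have "halts q w'" if "2 ^ i + p = 2 ^ j + p'" "p' < 2 ^ j" "\<forall>r\<le>p'. p' = Suc r \<longrightarrow> halts r w'"
    "q + 2 \<le> 2 ^ j" "halts q w" for j p' q
  proof -
    have "i = j" using that(1,2) assms(1) by (intro power2_interval_unique[of i "2 ^ i + p"]) auto
    then show ?thesis using that by (intro last[of q w w']) auto
  qed
  then show ?thesis by (auto simp: Last_def sat_inst_env halts_def Suc_le_eq)
qed

text \<open>Among the halting programs r below the bound take one with the largest halting time; any
  time by which it has halted suffices for the others. The shift p = r + 1 leaves p = 0 for the case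
  that none halts.\<close>

lemma last_halting_exists:
  "\<exists>p < 2 ^ i. (\<forall>r. p = Suc r \<longrightarrow> (\<exists>w. halts r w)) \<and> (\<forall>q w w'. q + 2 \<le> 2 ^ i \<longrightarrow> halts q w \<longrightarrow>
    (\<forall>r. p = Suc r \<longrightarrow> halts r w') \<longrightarrow> halts q w')"
proof (cases "\<exists>q w. q + 2 \<le> 2 ^ i \<and> halts q w")
  case False
  then show ?thesis by (intro exI[of _ 0]) auto
next
  case True
  define Q where "Q = {q. q + 2 \<le> 2 ^ i \<and> (\<exists>w. halts q w)}"
  have fin: "finite Q" unfolding Q_def by (rule finite_subset[of _ "{..2 ^ i}"]) auto
  define time where "time q = (LEAST w. halts q w)" for q
  have time: "halts q w \<longleftrightarrow> time q \<le> w" if "q \<in> Q" for q w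
  proof
    obtain w0 where "halts q w0" using \<open>q \<in> Q\<close> unfolding Q_def by blast
    then have "halts q (time q)" unfolding time_def by (rule LeastI)
    then show "time q \<le> w \<Longrightarrow> halts q w" by (rule halts_mono)
  qed (simp add: time_def Least_le)
  have "Q \<noteq> {}" using True unfolding Q_def by blast
  then have "Max (time ` Q) \<in> time ` Q" using fin by (intro Max_in) auto
  then obtain r where r: "r \<in> Q" "time r = Max (time ` Q)" by auto
  have le: "time q \<le> time r" if "q \<in> Q" for q unfolding r(2) using fin that by (intro Max_ge) auto
  have last: "halts q w'" if "q + 2 \<le> 2 ^ i" "halts q w" "halts r w'" for q w w'
  proof -
    have q: "q \<in> Q" using that unfolding Q_def by blast
    have "time q \<le> w'" using le[OF q] time[OF r(1), of w'] that(3) by linarith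
    then show ?thesis using time[OF q] by blast
  qed
  have "Suc r < 2 ^ i" "\<exists>w. halts r w" using r(1) unfolding Q_def by auto
  then show ?thesis using last by (intro exI[of _ "Suc r"] conjI) (simp, simp, metis)
qed

subsection \<open>A universal formula that also expresses Last\<close>

text \<open>The last bit of the argument selects the meaning: \<open>False\<close> copies
  \<open>U\<close>, which makes \<open>V\<close> universal, and \<open>True\<close> asserts
  \<open>Last\<close>. In codes these are the odd numbers 2u + 1 and the positive even numbers 2s +
  2.\<close>

definition V :: fm where
  "V = Forall (Forall (Conj
    (BAll (Var 2) (Impl (Eql (Var 3) (Succ (Add (Var 0) (Var 0)))) (Neg (inst \<epsilon> [Var 1, Var 0]))))
    (BAll (Var 2) (Impl (Eql (Var 3) (Succ (Succ (Add (Var 0) (Var 0)))))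
      (inst Last [Var 1, Var 2, Var 0])))))"

lemma pi1_V: "pi1 V"
  unfolding V_def by (intro pi1.intros) simp

lemma closed_V [simp]: "closed_fm (Suc 0) V"
  by (auto simp: V_def intro!: closed_inst)

end

section \<open>The formulas \<open>Last\<close> and \<open>V\<close> in a model\<close>

locale optimal_pair_model = optimal_pair D U \<delta> \<epsilon> + PA_model M for D U \<delta> \<epsilon> M
begin

lemma msat_U: "\<not> msat M (env [u]) U \<longleftrightarrow> (\<exists>w. msat M (env [w, u]) \<epsilon>)"
  using epsilon(3)[OF PA_model_axioms, of "env [u]"] by simp

lemma out_D_iff: "out D q y \<longleftrightarrow> (\<exists>v. msat M (env [v, q, y]) \<delta>)"
  using delta(3)[OF PA_model_axioms, of "env [q, y]"] by (simp add: out_def)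

lemma out_D_emb: "outputs D p x \<Longrightarrow> out D (emb (code p)) (emb (code x))"
  unfolding outputs_iff out_D_iff using delta0_absolute_env[of \<delta> "[_, code p, code x]"] by auto

lemma msat_Halt: "msat M (env [q, w]) Halt \<longleftrightarrow>
    (\<exists>y. y \<preceq> w \<and> (\<exists>v. v \<preceq> w \<and> msat M (env [v, q, y]) \<delta>))"
  by (simp add: Halt_def msat_inst)

lemma Last_elim:
  assumes "msat M (env [w, w', s]) Last" "s = N \<oplus> p" "p \<prec> N" "msat M (env [N]) Pow2"
    and "\<And>r. p = S r \<Longrightarrow> msat M (env [r, w']) Halt"
    and "S (S q) \<preceq> N" "q \<preceq> s" "msat M (env [q, w]) Halt"
  shows "msat M (env [q, w']) Halt"
proof -
  have "N \<preceq> s" "p \<preceq> s" using assms(2) by simp_all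
  then show ?thesis using assms(1,3-) assms(2)[symmetric] by (simp add: Last_def msat_inst)
qed

lemma msat_V:
  "msat M (env [emb (2 * u + 1)]) V \<longleftrightarrow> msat M (env [emb u]) U"
  "msat M (env [emb (2 * s + 2)]) V \<longleftrightarrow> (\<forall>w w'. msat M (env [w, w', emb s]) Last)"
proof -
  have V: "msat M (env [emb v]) V \<longleftrightarrow> (\<forall>w' w.
    (\<forall>u\<le>v. v = 2 * u + 1 \<longrightarrow> \<not> msat M (env [w, emb u]) \<epsilon>) \<and>
    (\<forall>s\<le>v. v = 2 * s + 2 \<longrightarrow> msat M (env [w, w', emb s]) Last))" for v
  proof -
    have 1: "(\<forall>u. u \<preceq> emb v \<longrightarrow> P u) \<longleftrightarrow> (\<forall>u\<le>v. P (emb u))" for P by (auto simp: le_emb_iff)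
    have 2: "emb v = S (emb u \<oplus> emb u) \<longleftrightarrow> v = 2 * u + 1" for u
      using emb_inject[of v "2 * u + 1"] by (simp add: emb_add mult_2)
    have 3: "emb v = S (S (emb u \<oplus> emb u)) \<longleftrightarrow> v = 2 * u + 2" for u
      using emb_inject[of v "2 * u + 2"] by (simp add: emb_add mult_2)
    show ?thesis by (simp add: V_def msat_inst 1 2 3)
  qed
  have "2 * u \<noteq> Suc (2 * s)" "Suc (2 * s) \<noteq> 2 * u" for u s :: nat by presburger+
  then show "msat M (env [emb (2 * u + 1)]) V \<longleftrightarrow> msat M (env [emb u]) U"
    "msat M (env [emb (2 * s + 2)]) V \<longleftrightarrow> (\<forall>w w'. msat M (env [w, w', emb s]) Last)"
    unfolding V using msat_U[of "emb u"] by auto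
qed

lemma msat_V_string:
  "msat M e (inst V [string_tm (u @ [False])]) \<longleftrightarrow> msat M e (inst U [string_tm u])"
  "msat M e (inst V [string_tm (u @ [True])]) \<longleftrightarrow>
    (\<forall>w w'. msat M (env [w, w', emb (code u)]) Last)"
  using msat_V[of "code u"] by (simp_all add: msat_inst)

end

context optimal_pair
begin

lemma optimal_pair_model: "PA_model M \<Longrightarrow> optimal_pair_model D U \<delta> \<epsilon> M"
  by (intro optimal_pair_model.intro optimal_pair_axioms)

lemma universal_V: "universal V"
  unfolding universal_def
proof (intro conjI allI impI)
  fix T assume "pi1_statement T"
  then obtain t where t: "PA \<turnstile> Iff T (inst U [string_tm t])"
    using U unfolding optimal_universal_def universal_def by blast
  have "PA \<turnstile> Iff T (inst V [string_tm (t @ [False])])"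
  proof (rule PA_complete)
    fix M e assume "PA_model M"
    then interpret optimal_pair_model D U \<delta> \<epsilon> M by (rule optimal_pair_model)
    show "msat M e (Iff T (inst V [string_tm (t @ [False])]))"
      using PA_provable[OF t] msat_V_string(1) by simp
  qed
  then show "\<exists>t. PA \<turnstile> Iff T (inst V [string_tm t])" by blast
qed (use pi1_V closed_V in simp_all)

text \<open>Relative to \<open>V\<close> the statement costs the length of s and one bit for
  \<open>True\<close>; optimality of \<open>U\<close> adds a constant independent of s.\<close>

lemma Last_in_theory_C:
  "\<exists>c. \<forall>n s. length s \<le> n \<longrightarrow> (\<forall>w w'. sat (env [w, w', code s]) Last) \<longrightarrow>
    inst V [string_tm (s @ [True])] \<in> theory_C U (n + c)"
proof -
  obtain c where c: "\<And>T. pi1_statement T \<Longrightarrow> pi1_complexity U T \<le> pi1_complexity V T + enat c"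
    using U universal_V unfolding optimal_universal_def by blast
  have "inst V [string_tm (s @ [True])] \<in> theory_C U (n + Suc c)"
    if s: "length s \<le> n" "\<forall>w w'. sat (env [w, w', code s]) Last" for n s
  proof -
    let ?T = "inst V [string_tm (s @ [True])]"
    have T: "pi1_statement ?T"
      unfolding pi1_statement_def by (auto simp: inst_def intro: pi1_subst pi1_V closed_subst[OF closed_V])
    interpret std: optimal_pair_model D U \<delta> \<epsilon> std by (rule optimal_pair_model[OF PA_model_std])
    have emb: "std.emb k = k" for k using std.mval_num[of undefined k] by simp
    have "true_fm ?T"
      using s(2) std.msat_V_string(2)[of _ s] by (simp add: true_fm_def emb)
    moreover have "PA \<turnstile> Iff ?T ?T" by (rule PA_complete) simp
    then have "pi1_complexity V ?T \<le> enat (length (s @ [True]))"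
      unfolding pi1_complexity_def by (intro Inf_lower) blast
    then have "pi1_complexity V ?T \<le> enat (Suc n)" using s(1) by (rule_tac order_trans) auto
    then have "pi1_complexity U ?T \<le> enat (Suc n) + enat c"
      using c[OF T] by (meson add_right_mono order_trans)
    ultimately show ?thesis using T unfolding theory_C_def by simp
  qed
  then show ?thesis by blast
qed

end

section \<open>Short programs and their outputs in a model\<close>

context optimal_pair_model
begin

text \<open>The last program has a real halting time \<open>w0\<close>, and its halting by then is
  absolute. If q halts in \<open>M\<close> at any time, even a nonstandard one, \<open>Last\<close>
  moves this back to \<open>w0\<close>; absoluteness makes q really halt, and functionality of
  \<open>D\<close> in \<open>M\<close> identifies the output.\<close>

lemma Last_decides:
  assumes last: "\<And>w w'. msat M (env [w, w', emb (2 ^ i + p)]) Last"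
    and p: "p < 2 ^ i" "\<And>r. p = Suc r \<Longrightarrow> \<exists>w. halts r w"
    and q: "code q + 2 \<le> 2 ^ i" "out D (emb (code q)) y"
  shows "\<exists>x. y = emb (code x) \<and> outputs D q x"
proof -
  let ?q = "code q"
  \<comment> \<open>For p = 0 any number serves as \<open>w0\<close>.\<close>
  obtain w0 where w0: "\<And>r. p = Suc r \<Longrightarrow> halts r w0" using p(2) by (cases p) auto
  have abs: "msat M (env [emb k, emb w0]) Halt \<longleftrightarrow> halts k w0" for k
    using delta0_absolute_env[of Halt "[k, w0]"] by (simp add: halts_def)
  obtain v where v: "msat M (env [v, emb ?q, y]) \<delta>" using q(2) out_D_iff by blast
  obtain w where w: "v \<preceq> w" "y \<preceq> w" using le_total le_refl by blast
  then have halt: "msat M (env [emb ?q, w]) Halt" using v msat_Halt by blast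
  have "msat M (env [emb ?q, emb w0]) Halt"
  proof (rule Last_elim[OF last])
    show "emb (2 ^ i + p) = emb (2 ^ i) \<oplus> emb p" by (rule emb_add)
    show "msat M (env [emb (2 ^ i)]) Pow2"
      using delta0_absolute_env[of Pow2 "[2 ^ i]"] by auto
    show "msat M (env [r, emb w0]) Halt" if "emb p = S r" for r
      using that w0 abs by (cases p) auto
    show "S (S (emb ?q)) \<preceq> emb (2 ^ i)" using emb_le_emb[of "?q + 2" "2 ^ i"] q(1) by simp
    show "emb ?q \<preceq> emb (2 ^ i + p)" using q(1) by simp
  qed (use p(1) halt in simp_all)
  then have "halts ?q w0" using abs by blast
  then obtain v0 x where x: "sat (env [v0, ?q, code x]) \<delta>"
    unfolding halts_iff using surj_code by metis
  then have "outputs D q x" using outputs_iff by blast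
  then show ?thesis using out_functional[OF interpreter_D q(2)] out_D_emb by blast
qed

text \<open>Programs of length at most n are standard in \<open>M\<close>, and \<open>dec\<close>
  says that they output only what they really output. So no element gains a short description in
  \<open>M\<close>, while real descriptions persist by \<open>out_D_emb\<close>.\<close>

lemma theory_B_holds:
  assumes dec: "\<And>q y. length q \<le> n \<Longrightarrow> out D (emb (code q)) y \<Longrightarrow> \<exists>x. y = emb (code x) \<and> outputs D q x"
    and \<psi>: "\<psi> \<in> theory_B D n"
  shows "msat M e \<psi>"
proof -
  let ?X = "code ` {x. complexity D x \<le> enat n}"
  consider "\<psi> \<in> PA"
    | x k where "\<psi> = C_eq D (string_tm x) (num k)" "complexity D x = enat k" "k \<le> n"
    | "\<psi> = Forall (Impl (Conjs (map (\<lambda>m. Neg (Eql (Var 0) (num m))) (sorted_list_of_set ?X)))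
        (C_gt D (Var 0) (num n)))"
    using \<psi> unfolding theory_B_def by blast
  then show ?thesis
  proof cases
    case 1 then show ?thesis by (rule PA)
  next
    case 2
    have "complexity D x \<le> enat k" using 2 by simp
    then obtain p where p: "outputs D p x" "length p \<le> k" using complexity_le interpreter_D by blast
    have shortest: "k \<le> length q" if "outputs D q x" for q
      using 2(2) complexity_less[OF interpreter_D, of x k] that by fastforce
    have "ceq D (emb (code x)) (emb k)"
      unfolding ceq_def
    proof (intro conjI allI impI)
      have "length p = k" using shortest[OF p(1)] p(2) by simp
      then show "\<exists>q. out D q (emb (code x)) \<and> len q (emb k)"
        using out_D_emb[OF p(1)] len_emb_iff by blast
      fix q l assume q: "out D q (emb (code x)) \<and> len q l"
      show "emb k \<preceq> l"
      proof (rule ccontr)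
        assume "\<not> emb k \<preceq> l"
        then obtain j where j: "l = emb j" "j < k" unfolding not_le lt_emb_iff by blast
        then obtain s where s: "length s = j" "q = emb (code s)" using q len_emb_iff by blast
        then obtain y where "emb (code x) = emb (code y)" "outputs D s y"
          using dec[of s "emb (code x)"] q j 2(3) by auto
        then have "outputs D s x" using injD[OF inj_code, of x y] by simp
        then show False using shortest s j by force
      qed
    qed
    then show ?thesis using 2 by (simp add: msat_C_eq)
  next
    case 3
    have "emb n \<prec> l" if x: "ceq D x l" "x \<notin> emb ` ?X" for x l
    proof (rule ccontr)
      assume "\<not> emb n \<prec> l"
      then have "l \<preceq> emb n" using not_le by blast
      then obtain j where j: "l = emb j" "j \<le> n" using le_emb_iff by blast
      obtain q where q: "out D q x" "len q l" using x(1) unfolding ceq_def by blast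
      then obtain s where s: "length s = j" "q = emb (code s)" using j len_emb_iff by blast
      then obtain y where "x = emb (code y)" "outputs D s y" using dec[of s] q j by auto
      then have "x = emb (code y)" "complexity D y \<le> enat n"
        using complexity_le[OF interpreter_D] s j by blast+
      then show False using x(2) by blast
    qed
    moreover have "set (sorted_list_of_set ?X) = ?X"
      using finite_complexity_le[OF interpreter_D] by (intro set_sorted_list_of_set finite_imageI)
    ultimately show ?thesis unfolding 3 by (auto simp: msat_C_gt)
  qed
qed

end

context optimal_pair
begin

lemma theory_C_sentence: "\<psi> \<in> theory_C U n \<Longrightarrow> sentence \<psi>"
  by (auto simp: theory_C_def pi1_statement_def PA_sentence)

lemma theory_B_subset_C: "\<exists>c. \<forall>n. subtheory (theory_B D n) (theory_C U (n + c))"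
proof -
  obtain c where c: "\<And>n s. length s \<le> n \<Longrightarrow> (\<forall>w w'. sat (env [w, w', code s]) Last) \<Longrightarrow>
    inst V [string_tm (s @ [True])] \<in> theory_C U (n + c)"
    using Last_in_theory_C by blast
  have "subtheory (theory_B D n) (theory_C U (n + (2 + c)))" for n
  proof -
    \<comment> \<open>A program has length at most n exactly when its code is at most 2^(n+1) - 2;
      hence the exponent \<open>Suc n\<close>.\<close>
    obtain p where p: "p < 2 ^ Suc n" "\<And>r. p = Suc r \<Longrightarrow> \<exists>w. halts r w"
      "\<And>q w w'. q + 2 \<le> 2 ^ Suc n \<Longrightarrow> halts q w \<Longrightarrow> (\<And>r. p = Suc r \<Longrightarrow> halts r w') \<Longrightarrow> halts q w'"
      using last_halting_exists[of "Suc n"] by blast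
    obtain s where s: "code s = 2 ^ Suc n + p" using surj_code by blast
    \<comment> \<open>As p is below 2^(n+1), the sum is below 2^(n+2): the leading power of two that
      records n costs only a constant number of bits.\<close>
    have "length s \<le> n + 2" unfolding length_le_iff s using p(1) by simp
    moreover have "\<forall>w w'. sat (env [w, w', code s]) Last"
      unfolding s by (intro allI sat_Last[OF p(1)]) (rule p(3))
    ultimately have T: "inst V [string_tm (s @ [True])] \<in> theory_C U (n + 2 + c)" by (rule c)
    show ?thesis
    proof (rule subtheoryI)
      show "sentence \<psi>" if "\<psi> \<in> theory_C U (n + (2 + c))" for \<psi>
        using that by (rule theory_C_sentence)
      show "PA \<subseteq> theory_C U (n + (2 + c))" by (auto simp: theory_C_def)
    next
      fix M \<psi> e
      assume M: "PA_model M" "\<And>\<psi> e. \<psi> \<in> theory_C U (n + (2 + c)) \<Longrightarrow> msat M e \<psi>"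
        and \<psi>: "\<psi> \<in> theory_B D n"
      interpret optimal_pair_model D U \<delta> \<epsilon> M using M(1) by (rule optimal_pair_model)
      have "msat M e (inst V [string_tm (s @ [True])])" for e
        using M(2) T by (simp add: add.assoc)
      then have last: "msat M (env [w, w', emb (2 ^ Suc n + p)]) Last" for w w'
        unfolding msat_V_string s by blast
      show "msat M e \<psi>"
      proof (rule theory_B_holds[OF _ \<psi>])
        fix q y assume q: "length q \<le> n" "out D (emb (code q)) y"
        then have "code q + 2 \<le> 2 ^ Suc n" using length_le_iff[of q n] by simp
        then show "\<exists>x. y = emb (code x) \<and> outputs D q x"
          using Last_decides[OF last p(1,2) _ q(2)] by blast
      qed
    qed
  qed
  then show ?thesis by blast
qed

end

section \<open>Theory C is contained in theory A\<close>

text \<open>\<open>Parse\<close> has the variables \<open>N\<close>, \<open>t\<close>, \<open>p\<close>. It says that \<open>p\<close> is the program \<open>t 1 0\<^sup>a 1 0\<^sup>d\<close>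
  for some \<open>a\<close> and \<open>d\<close>, and that \<open>N + 1 = 2\<^sup>k\<close> for \<open>k = length p + d + 1\<close>. The bound variables
  are \<open>2\<^sup>a\<close>, \<open>2\<^bsup>length p\<^esup>\<close> and \<open>2\<^sup>d\<close>. The block \<open>0\<^sup>a\<close> is padding; the block \<open>0\<^sup>d\<close> lets the
  program know the constant of optimality of the interpreter that runs it.\<close>

definition Parse :: fm where
  "Parse = BEx (Succ (Var 2)) (BEx (Succ (Var 3)) (BEx (Succ (Var 4)) (Conjs [
    inst Pow2 [Var 0], inst Pow2 [Var 1], inst Pow2 [Var 2],
    Leq (Var 1) (Succ (Var 5)), Leq (Succ (Succ (Var 5))) (Add (Var 1) (Var 1)),
    Eql (Succ (Var 5)) (Mul (Succ (Mul (num 2) (Mul (Add (Mul (num 2) (Var 4)) (num 3)) (Var 0)))) (Var 2)),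
    Eql (Succ (Var 3)) (Mul (Mul (num 2) (Var 1)) (Var 2))])))"

lemma Parse_simps [simp]: "delta0 Parse" "closed_fm (Suc (Suc (Suc 0))) Parse"
  by (auto simp: Parse_def intro!: closed_inst)

lemma sat_Parse: "sat (env [N, t, p]) Parse \<longleftrightarrow> (\<exists>d i a. 2 ^ i \<le> p + 1 \<and> p + 1 < 2 * 2 ^ i \<and>
  p + 1 = Suc (2 * ((2 * t + 3) * 2 ^ a)) * 2 ^ d \<and> N + 1 = 2 * 2 ^ i * 2 ^ d)"
  (is "_ \<longleftrightarrow> ?R")
proof -
  have "sat (env [N, t, p]) Parse \<longleftrightarrow> (\<exists>E\<le>p + 1. \<exists>P\<le>p + 1. \<exists>A\<le>p + 1.
    (\<exists>k. A = 2 ^ k) \<and> (\<exists>k. P = 2 ^ k) \<and> (\<exists>k. E = 2 ^ k) \<and> P \<le> p + 1 \<and> p + 2 \<le> P + P \<and>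
    p + 1 = Suc (2 * ((2 * t + 3) * A)) * E \<and> N + 1 = 2 * P * E)" (is "_ \<longleftrightarrow> ?L")
    by (simp add: Parse_def sat_inst_env)
  also have "?L \<longleftrightarrow> ?R"
  proof
    assume ?L
    then obtain d i a where "(2::nat) ^ i \<le> p + 1" "p + 2 \<le> 2 ^ i + 2 ^ i"
      "p + 1 = Suc (2 * ((2 * t + 3) * 2 ^ a)) * 2 ^ d" "N + 1 = 2 * 2 ^ i * 2 ^ d"
      by blast
    then show ?R by (intro exI[of _ d] exI[of _ i] exI[of _ a]) simp
  next
    assume ?R
    then obtain d i a where *: "2 ^ i \<le> p + 1" "p + 1 < 2 * 2 ^ i"
      "p + 1 = Suc (2 * ((2 * t + 3) * 2 ^ a)) * 2 ^ d" "N + 1 = 2 * 2 ^ i * 2 ^ d" by blast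
    have d: "2 ^ d \<le> p + 1" unfolding *(3) by simp
    have a: "2 ^ a \<le> p + 1"
    proof -
      define y where "y = (2 * t + 3) * 2 ^ a"
      have "1 * 2 ^ a \<le> y" unfolding y_def by (intro mult_le_mono) auto
      then have "2 ^ a \<le> Suc (2 * y) * 1" by simp
      also have "\<dots> \<le> Suc (2 * y) * 2 ^ d" by (intro mult_le_mono) auto
      finally show ?thesis unfolding *(3) y_def[symmetric] .
    qed
    have i: "p + 2 \<le> 2 ^ i + 2 ^ i" using *(2) by simp
    show ?L
      by (rule exI[of _ "2 ^ d"], rule conjI[OF d], rule exI[of _ "2 ^ i"], rule conjI[OF *(1)],
          rule exI[of _ "2 ^ a"], rule conjI[OF a]) (use i * in blast)
  qed
  finally show ?thesis .
qed

lemma odd_part_unique: "Suc (2 * x) * 2 ^ i = Suc (2 * y) * 2 ^ j \<Longrightarrow> x = y \<and> i = j"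
proof (induction i arbitrary: j)
  case 0
  have "j = 0"
  proof (rule ccontr)
    assume "j \<noteq> 0"
    then have "even (Suc (2 * y) * 2 ^ j)" by simp
    then show False unfolding 0[symmetric] by simp
  qed
  then show ?case using 0 by simp
next
  case (Suc i)
  have "j \<noteq> 0"
  proof
    assume "j = 0"
    have "even (Suc (2 * x) * 2 ^ Suc i)" by simp
    then show False unfolding Suc.prems \<open>j = 0\<close> by simp
  qed
  then obtain k where "j = Suc k" by (cases j) auto
  then show ?case using Suc.prems Suc.IH[of k] by simp
qed

text \<open>The position of p + 1 between powers of two gives i. The odd part is then split off
  twice, for the final zeros d and for the padding a, and what remains is t.\<close>

lemma Parse_unique:
  assumes "sat (env [N, t, p]) Parse" "sat (env [N', t', p]) Parse"
  shows "N = N' \<and> t = t'"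
proof -
  obtain d i a where 1: "2 ^ i \<le> p + 1" "p + 1 < 2 * 2 ^ i"
      "p + 1 = Suc (2 * ((2 * t + 3) * 2 ^ a)) * 2 ^ d" "N + 1 = 2 * 2 ^ i * 2 ^ d"
    using assms(1) sat_Parse by blast
  obtain d' i' a' where 2: "2 ^ i' \<le> p + 1" "p + 1 < 2 * 2 ^ i'"
      "p + 1 = Suc (2 * ((2 * t' + 3) * 2 ^ a')) * 2 ^ d'" "N' + 1 = 2 * 2 ^ i' * 2 ^ d'"
    using assms(2) sat_Parse by blast
  have "i = i'" using 1(1,2) 2(1,2) by (rule power2_interval_unique)
  moreover have d: "(2 * t + 3) * 2 ^ a = (2 * t' + 3) * 2 ^ a' \<and> d = d'"
    using 1(3) 2(3) by (intro odd_part_unique) simp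
  then have "Suc (2 * (t + 1)) * 2 ^ a = Suc (2 * (t' + 1)) * 2 ^ a'"
    by (simp add: eval_nat_numeral)
  then have "t + 1 = t' + 1" using odd_part_unique by blast
  ultimately show ?thesis using 1(4) 2(4) d by simp
qed

text \<open>These bounds allow \<open>Phi\<close> and \<open>Psi\<close> to search for t and N by
  bounded quantifiers. The second is quadratic because N + 1 is twice a product of two powers, each
  at most p + 1.\<close>

lemma Parse_bounds:
  assumes "sat (env [N, t, p]) Parse"
  shows "t \<le> p" "N \<le> 2 * (p + 1) * (p + 1)"
proof -
  obtain d i a where *: "2 ^ i \<le> p + 1"
      "p + 1 = Suc (2 * ((2 * t + 3) * 2 ^ a)) * 2 ^ d" "N + 1 = 2 * 2 ^ i * 2 ^ d"
    using assms sat_Parse by blast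
  define y where "y = (2 * t + 3) * 2 ^ a"
  have "(2 * t + 3) * 1 \<le> y" unfolding y_def by (intro mult_le_mono) auto
  moreover have "Suc (2 * y) * 1 \<le> Suc (2 * y) * 2 ^ d" by (intro mult_le_mono) auto
  then have "Suc (2 * y) \<le> p + 1" using *(2) unfolding y_def by simp
  ultimately show "t \<le> p" by simp
  have "2 ^ d \<le> p + 1" unfolding *(2) by simp
  then have "2 * 2 ^ i * 2 ^ d \<le> 2 * (p + 1) * (p + 1)" using *(1) by (intro mult_le_mono) auto
  then show "N \<le> 2 * (p + 1) * (p + 1)" using *(3) by linarith
qed

lemma Parse_exists:
  assumes "length t \<le> n"
  shows "\<exists>p. length p = n + d + 2 \<and> sat (env [2 ^ (n + 2 * d + 3) - 1, code t, code p]) Parse"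
proof -
  \<comment> \<open>Padding makes the length of the program depend on n and d only, so that n need
    not be written down.\<close>
  define a where "a = n - length t"
  define u where "u = (t @ [True]) @ replicate a False"
  define p where "p = (u @ [True]) @ replicate d False"
  have u: "code u + 1 = (2 * code t + 3) * 2 ^ a"
    unfolding u_def code_replicate_False by (simp add: algebra_simps)
  then have "code (u @ [True]) + 1 = Suc (2 * ((2 * code t + 3) * 2 ^ a))"
    unfolding u[symmetric] by simp
  then have p: "code p + 1 = Suc (2 * ((2 * code t + 3) * 2 ^ a)) * 2 ^ d"
    unfolding p_def code_replicate_False by simp
  have l: "length p = n + d + 2" using assms unfolding p_def u_def a_def by simp
  have "n + 2 * d + 3 = Suc (n + d + 2) + d" by simp
  then have "2 ^ (n + 2 * d + 3) - 1 + 1 = 2 * 2 ^ (n + d + 2) * (2::nat) ^ d"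
    by (simp only: power_add power_Suc) simp
  then have "sat (env [2 ^ (n + 2 * d + 3) - 1, code t, code p]) Parse"
    unfolding sat_Parse using p code_bounds[of p] l by metis
  then show ?thesis using l by blast
qed

context optimal_pair
begin

definition bound :: "tm \<Rightarrow> tm" where
  "bound t = Mul (Mul (num 2) (Succ t)) (Succ t)"

lemma closed_bound [simp]: "closed_tm k (bound t) = closed_tm k t"
  by (simp add: bound_def)

text \<open>\<open>Phi\<close> has the variables \<open>w\<close>, \<open>p\<close> and says that a refutation of \<open>U(t)\<close> occurs by time \<open>w\<close>,
  where \<open>t\<close> is parsed from \<open>p\<close>. \<open>Psi\<close> has the variables \<open>x\<close>, \<open>w\<close>, \<open>p\<close> and says that no program of
  code less than \<open>N\<close> outputs \<open>x \<ge> N\<close> by time \<open>w\<close>, where \<open>N\<close> is parsed from \<open>p\<close>.\<close>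

definition Phi :: fm where
  "Phi = BEx (Var 1) (BEx (bound (Var 2)) (Conj (inst Parse [Var 0, Var 1, Var 3])
    (BEx (Var 2) (inst \<epsilon> [Var 0, Var 2]))))"

definition Psi :: fm where
  "Psi = BEx (Var 2) (BEx (bound (Var 3)) (Conj (inst Parse [Var 0, Var 1, Var 4])
    (Conj (Leq (Var 0) (Var 2)) (BAll (Var 0) (Impl (Leq (Succ (Var 0)) (Var 1))
      (BAll (Var 4) (Neg (inst \<delta> [Var 0, Var 1, Var 4]))))))))"

lemma Phi_simps [simp]: "delta0 Phi" "closed_fm (Suc (Suc 0)) Phi"
  by (auto simp: Phi_def intro!: closed_inst)

lemma Psi_simps [simp]: "delta0 Psi" "closed_fm (Suc (Suc (Suc 0))) Psi"
  by (auto simp: Psi_def intro!: closed_inst)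

text \<open>The least time w for \<open>Phi\<close>, followed by the least x for \<open>Psi\<close>
  at that time. Minimality is stated with bounded quantifiers: the matrix stays delta0, and the
  output is unique in every model.\<close>

definition D' :: fm where
  "D' = Exists (Conjs [
    inst Phi [Var 0, Var 1], BAll (Var 0) (Impl (inst Phi [Var 0, Var 2]) (Eql (Var 0) (Var 1))),
    inst Psi [Var 2, Var 0, Var 1],
    BAll (Var 2) (Impl (inst Psi [Var 0, Var 1, Var 2]) (Eql (Var 0) (Var 3)))])"

lemma sigma1_D': "sigma1 D'"
  unfolding D'_def by (intro sigma1.intros delta0_Conjs) auto

lemma closed_D' [simp]: "closed_fm 2 D'" "closed_fm (Suc (Suc 0)) D'"
  by (auto simp: D'_def numeral_2_eq_2 intro!: closed_inst)

end

section \<open>The interpreter \<open>D'\<close> in a model\<close>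

context optimal_pair_model
begin

lemma out_D': "out D' p x \<longleftrightarrow> (\<exists>w. msat M (env [w, p]) Phi \<and>
  (\<forall>w'. w' \<preceq> w \<longrightarrow> msat M (env [w', p]) Phi \<longrightarrow> w' = w) \<and> msat M (env [x, w, p]) Psi \<and>
  (\<forall>x'. x' \<preceq> x \<longrightarrow> msat M (env [x', w, p]) Psi \<longrightarrow> x' = x))"
  by (simp add: out_def D'_def msat_inst)

lemma D'_functional:
  assumes "out D' p x" "out D' p y"
  shows "x = y"
proof -
  obtain v where v: "msat M (env [v, p]) Phi"
      "\<forall>w'. w' \<preceq> v \<longrightarrow> msat M (env [w', p]) Phi \<longrightarrow> w' = v" "msat M (env [x, v, p]) Psi"
      "\<forall>x'. x' \<preceq> x \<longrightarrow> msat M (env [x', v, p]) Psi \<longrightarrow> x' = x"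
    using assms(1) unfolding out_D' by (elim exE conjE)
  obtain w where w: "msat M (env [w, p]) Phi"
      "\<forall>w'. w' \<preceq> w \<longrightarrow> msat M (env [w', p]) Phi \<longrightarrow> w' = w" "msat M (env [y, w, p]) Psi"
      "\<forall>x'. x' \<preceq> y \<longrightarrow> msat M (env [x', w, p]) Psi \<longrightarrow> x' = y"
    using assms(2) unfolding out_D' by (elim exE conjE)
  have "v = w" using le_total[of v w] v(1,2) w(1,2) by metis
  then show ?thesis using le_total[of x y] v(3,4) w(3,4) by metis
qed

text \<open>For standard p both bounded quantifiers range over standard elements, where
  \<open>Parse\<close> is absolute and has a single solution; the search in \<open>Phi\<close> and
  \<open>Psi\<close> collapses to the intended N and t.\<close>

lemma Parse_standard:
  assumes "sat (env [N, t, p]) Parse"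
  shows "(\<exists>t'. t' \<preceq> emb p \<and> (\<exists>N'. N' \<preceq> emb (2 * (p + 1) * (p + 1)) \<and>
    msat M (env [N', t', emb p]) Parse \<and> Q N' t')) \<longleftrightarrow> Q (emb N) (emb t)"
proof -
  have *: "msat M (env [emb N', emb t', emb p]) Parse \<longleftrightarrow> N' = N \<and> t' = t" for N' t'
  proof -
    have "msat M (env [emb N', emb t', emb p]) Parse \<longleftrightarrow> sat (env [N', t', p]) Parse"
      using delta0_absolute_env[of Parse "[N', t', p]"] by simp
    then show ?thesis using Parse_unique[OF assms] assms by blast
  qed
  show ?thesis
  proof
    assume "Q (emb N) (emb t)"
    moreover have "emb t \<preceq> emb p" "emb N \<preceq> emb (2 * (p + 1) * (p + 1))"
      using Parse_bounds[OF assms] unfolding emb_le_emb .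
    moreover have "msat M (env [emb N, emb t, emb p]) Parse" unfolding * by simp
    ultimately show "\<exists>t'. t' \<preceq> emb p \<and> (\<exists>N'. N' \<preceq> emb (2 * (p + 1) * (p + 1)) \<and>
        msat M (env [N', t', emb p]) Parse \<and> Q N' t')" by blast
  next
    assume "\<exists>t'. t' \<preceq> emb p \<and> (\<exists>N'. N' \<preceq> emb (2 * (p + 1) * (p + 1)) \<and>
        msat M (env [N', t', emb p]) Parse \<and> Q N' t')"
    then obtain t' N' where t': "t' \<preceq> emb p" "N' \<preceq> emb (2 * (p + 1) * (p + 1))"
      "msat M (env [N', t', emb p]) Parse" "Q N' t'" by blast
    obtain t'' where "t' = emb t''" using t'(1) le_emb_iff by blast
    moreover obtain N'' where "N' = emb N''" using t'(2) le_emb_iff by blast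
    ultimately show "Q (emb N) (emb t)" using t'(3,4) * by simp
  qed
qed

lemma mval_bound:
  assumes "mval M e t = emb k"
  shows "mval M e (bound t) = emb (2 * (k + 1) * (k + 1))"
proof -
  have "mval M e (bound t) = emb 2 \<otimes> S (emb k) \<otimes> S (emb k)"
    unfolding bound_def mval.simps mval_num assms ..
  also have "\<dots> = emb (2 * Suc k * Suc k)" unfolding emb_mult emb.simps(2) ..
  finally show ?thesis unfolding Suc_eq_plus1 .
qed

lemma msat_Phi:
  assumes "sat (env [N, t, p]) Parse"
  shows "msat M (env [w, emb p]) Phi \<longleftrightarrow> (\<exists>v. v \<preceq> w \<and> msat M (env [v, emb t]) \<epsilon>)"
  using Parse_standard[OF assms, of "\<lambda>N t. \<exists>v. v \<preceq> w \<and> msat M (env [v, t]) \<epsilon>"]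
  by (simp add: Phi_def msat_inst mval_bound)

lemma msat_Psi:
  assumes "sat (env [N, t, p]) Parse"
  shows "msat M (env [x, w, emb p]) Psi \<longleftrightarrow> emb N \<preceq> x \<and>
    (\<forall>q<N. \<forall>v. v \<preceq> w \<longrightarrow> \<not> msat M (env [v, emb q, x]) \<delta>)"
proof -
  have "msat M (env [x, w, emb p]) Psi \<longleftrightarrow> emb N \<preceq> x \<and> (\<forall>q. q \<preceq> emb N \<longrightarrow> q \<prec> emb N \<longrightarrow>
      (\<forall>v. v \<preceq> w \<longrightarrow> \<not> msat M (env [v, q, x]) \<delta>))"
    using Parse_standard[OF assms, of "\<lambda>N t. N \<preceq> x \<and> (\<forall>q. q \<preceq> N \<longrightarrow> q \<prec> N \<longrightarrow>
      (\<forall>v. v \<preceq> w \<longrightarrow> \<not> msat M (env [v, q, x]) \<delta>))"]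
    by (simp add: Psi_def msat_inst mval_bound)
  moreover have "q \<preceq> emb N \<and> q \<prec> emb N \<longleftrightarrow> (\<exists>m<N. q = emb m)" for q
    using lt_emb_iff[of q N] S_le_iff[of q "emb N"] by blast
  then have "(\<forall>q. q \<preceq> emb N \<longrightarrow> q \<prec> emb N \<longrightarrow> P q) \<longleftrightarrow> (\<forall>q<N. P (emb q))" for P by metis
  ultimately show ?thesis by (simp only:)
qed

text \<open>A refutation in \<open>M\<close> of the true statement \<open>U(t)\<close> occurs only at a nonstandard time, when all
  strings of length \<open>n\<close> before \<open>r\<^sub>n\<close> have been found to be compressible.\<close>

lemma out_D'_first_random:
  assumes random: "msat M e (C_ge D (string_tm (first_random D n)) (num n))"
    and parse: "sat (env [2 ^ n - 1, code t, code p]) Parse"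
    and true: "sat (env [code t]) U" and false: "\<not> msat M (env [emb (code t)]) U"
  shows "out D' (emb (code p)) (emb (code (first_random D n)))"
proof -
  let ?p = "emb (code p)" and ?r = "first_random D n" and ?N = "2 ^ n - 1 :: nat"
  note r = first_random[OF interpreter_D, where n = n]
  interpret std: optimal_pair_model D U \<delta> \<epsilon> std by (rule optimal_pair_model[OF PA_model_std])
  have "\<not> sat (env [v, code t]) \<epsilon>" for v using std.msat_U[of "code t"] true by auto
  then have nonstd: "v \<notin> range emb" if "msat M (env [v, emb (code t)]) \<epsilon>" for v
    using that delta0_absolute_env[of \<epsilon> "[_, code t]"] by auto
  obtain v0 where "msat M (env [v0, emb (code t)]) \<epsilon>" using false msat_U by blast
  then have "msat M (env [v0, ?p]) Phi" using msat_Phi[OF parse] le_refl by blast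
  then obtain w where w: "msat M (env [w, ?p]) Phi" "\<And>z. msat M (env [z, ?p]) Phi \<Longrightarrow> w \<preceq> z"
    using least_number[of v0 "env [?p]" Phi] by auto
  obtain v where v: "v \<preceq> w" "msat M (env [v, emb (code t)]) \<epsilon>" using w(1) msat_Phi[OF parse] by blast
  \<comment> \<open>w lies above a nonstandard refutation time, hence above every real halting
    time.\<close>
  have large: "emb k \<preceq> w" for k using v(1) emb_le_nonstandard[OF nonstd[OF v(2)]] le_trans by blast
  have N: "code s < ?N \<longleftrightarrow> length s < n" for s using length_less_iff[of s n] by linarith
  \<comment> \<open>The added axiom of \<open>A\<close> enters here: in \<open>M\<close> no shorter
    program outputs the random string at any time, so it survives the test \<open>Psi\<close>
    although w is nonstandard.\<close>
  have "\<not> out D (emb q) (emb (code ?r))" if "q < ?N" for q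
  proof
    assume *: "out D (emb q) (emb (code ?r))"
    obtain s where s: "q = code s" using surj_code by metis
    then obtain k where "k \<le> length s" "ceq D (emb (code ?r)) (emb k)" using ceq_exists * by blast
    then have "n \<le> length s" using random by (fastforce simp: msat_C_ge)
    then show False using that s N by simp
  qed
  then have "msat M (env [emb (code ?r), w, ?p]) Psi"
    unfolding msat_Psi[OF parse] using N[of ?r] r(1) out_D_iff by auto
  moreover have "x = emb (code ?r)" if x: "x \<preceq> emb (code ?r)" "msat M (env [x, w, ?p]) Psi" for x
  proof (rule ccontr)
    assume neq: "x \<noteq> emb (code ?r)"
    then obtain m where m: "x = emb m" "m < code ?r"
      using x(1) le_emb_iff[of x "code ?r"] by (metis nat_less_le)
    obtain y where y: "m = code y" using surj_code by metis
    have "?N \<le> code y" using x(2) m y unfolding msat_Psi[OF parse] by simp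
    then have "length y = n"
      using N[of y] length_le_iff[of y n] length_le_iff[of ?r n] m(2) y r(1) by linarith
    then have "complexity D y < enat n" using r(3) m(2) y by blast
    then obtain s where s: "outputs D s y" "length s < n"
      using complexity_less[OF interpreter_D] by blast
    then obtain k where "sat (env [k, code s, code y]) \<delta>" using outputs_iff by blast
    \<comment> \<open>The real witness k is standard, hence below w, so y is already seen to be
      compressible.\<close>
    then have "msat M (env [emb k, emb (code s), x]) \<delta>"
      using delta0_absolute_env[of \<delta> "[k, code s, code y]"] m(1) y by simp
    then show False using x(2) s(2) N large unfolding msat_Psi[OF parse] by blast
  qed
  ultimately show ?thesis unfolding out_D' using w le_antisym by blast
qed

lemma optimal_ceq:
  assumes "PA \<turnstile> Forall (Forall (Impl (C_eq D\<^sub>1 (Var 1) (Var 0))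
      (Exists (Conj (C_eq D (Var 2) (Var 0)) (Le (Var 0) (Add (Var 1) (num c)))))))"
    and "closed_fm 2 D\<^sub>1" "ceq D\<^sub>1 x k"
  shows "\<exists>l. ceq D x l \<and> l \<preceq> k \<oplus> emb c"
  using PA_provable[OF assms(1)] assms(2,3) by (simp add: msat_C_eq numeral_2_eq_2)

end

context optimal_pair
begin

lemma interpreter_D': "interpreter D'"
  unfolding interpreter_def
proof (intro conjI PA_complete)
  fix M e assume "PA_model M"
  then interpret optimal_pair_model D U \<delta> \<epsilon> M by (rule optimal_pair_model)
  show "msat M e (Forall (Forall (Forall
      (Impl (Conj (inst D' [Var 2, Var 1]) (inst D' [Var 2, Var 0])) (Eql (Var 1) (Var 0))))))"
    using D'_functional by (auto simp: msat_out)
qed (simp_all add: sigma1_D')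

text \<open>If a true U(t) failed in \<open>M\<close>, then \<open>D'\<close> would output the
  random string from a program of length n + c + 2. By optimality its \<open>D\<close>-complexity in
  \<open>M\<close> would be at most n + 2c + 2, one less than the axiom of \<open>A\<close> at index
  n + 2c + 3 allows.\<close>

lemma theory_C_subset_A: "\<exists>c. \<forall>n. subtheory (theory_C U n) (theory_A D (n + c))"
proof -
  obtain c where c: "PA \<turnstile> Forall (Forall (Impl (C_eq D' (Var 1) (Var 0))
      (Exists (Conj (C_eq D (Var 2) (Var 0)) (Le (Var 0) (Add (Var 1) (num c)))))))"
    using D interpreter_D' unfolding provably_optimal_def by blast
  have "subtheory (theory_C U n) (theory_A D (n + (2 * c + 3)))" for n
  proof (rule subtheoryI)
    fix M T e
    assume M: "PA_model M" "\<And>\<psi> e. \<psi> \<in> theory_A D (n + (2 * c + 3)) \<Longrightarrow> msat M e \<psi>"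
      and "T \<in> theory_C U n"
    then consider "T \<in> PA" | "true_fm T" "pi1_complexity U T \<le> enat n"
      unfolding theory_C_def by blast
    then show "msat M e T"
    proof cases
      case 1 then show ?thesis using M(1) by (rule PA_model.PA[rotated])
    next
      case 2
      let ?n = "n + 2 * c + 3"
      interpret optimal_pair_model D U \<delta> \<epsilon> M using M(1) by (rule optimal_pair_model)
      let ?S = "{enat (length t) | t. PA \<turnstile> Iff T (inst U [string_tm t])}"
      have "?S \<noteq> {}"
      proof
        assume "?S = {}"
        then have "pi1_complexity U T = \<infinity>"
          unfolding pi1_complexity_def by (simp only: Inf_enat_def) simp
        then show False using 2 by simp
      qed
      then have "Inf ?S \<in> ?S" by (metis (mono_tags, lifting) Inf_enat_def LeastI_ex ex_in_conv)
      then obtain t where t: "PA \<turnstile> Iff T (inst U [string_tm t])" "length t \<le> n"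
        using 2(2) unfolding pi1_complexity_def by auto
      have "sat (env [code t]) U"
        using PA_sound[OF t(1)] 2(1) by (simp add: true_fm_def sat_inst_env)
      \<comment> \<open>The number d stored in the program is taken to be the constant c of
        optimality.\<close>
      obtain p where p: "length p = n + c + 2" "sat (env [2 ^ ?n - 1, code t, code p]) Parse"
        using Parse_exists[OF t(2)] by blast
      have random: "msat M e (C_ge D (string_tm (first_random D ?n)) (num ?n))" for e
        by (rule M(2)) (simp add: theory_A_def add.assoc)
      have "msat M (env [emb (code t)]) U"
      proof (rule ccontr)
        let ?r = "emb (code (first_random D ?n))"
        assume "\<not> msat M (env [emb (code t)]) U"
        then have "out D' (emb (code p)) ?r"
          using random p(2) \<open>sat (env [code t]) U\<close> by (intro out_D'_first_random)
        then obtain k where k: "k \<le> length p" "ceq D' ?r (emb k)" using ceq_exists by blast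
        then obtain l where l: "ceq D ?r l" "le l (emb (k + c))"
          using optimal_ceq[OF c closed_D'(1)] unfolding emb_add by blast
        then have "le (emb ?n) l" using random by (simp only: msat_C_ge[OF closed_D(1)] mval_num)
        then have "le (emb ?n) (emb (k + c))" using l(2) by (rule le_trans)
        then show False using k(1) p(1) by simp
      qed
      then show ?thesis using PA_provable[OF t(1), of e] by (simp add: msat_inst)
    qed
  qed (auto simp: theory_A_def PA_sentence closed_complexity)
  then show ?thesis by blast
qed

section \<open>Theory A is contained in theory B\<close>

lemma theory_B_sentence: "\<psi> \<in> theory_B D n \<Longrightarrow> sentence \<psi>"
  by (auto simp: theory_B_def PA_sentence closed_complexity)

text \<open>The complexity of the random string is either exactly n, which is an axiom of
  \<open>B\<close>, or larger, and then the axiom about all remaining strings applies. No shift of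
  the index arises.\<close>

lemma theory_A_subset_B: "subtheory (theory_A D n) (theory_B D n)"
proof (rule subtheoryI)
  let ?X = "code ` {x. complexity D x \<le> enat n}" and ?r = "first_random D n"
  let ?\<psi> = "Forall (Impl (Conjs (map (\<lambda>m. Neg (Eql (Var 0) (num m))) (sorted_list_of_set ?X)))
    (C_gt D (Var 0) (num n)))"
  fix M T e
  assume M: "PA_model M" "\<And>\<psi> e. \<psi> \<in> theory_B D n \<Longrightarrow> msat M e \<psi>" and T: "T \<in> theory_A D n"
  interpret optimal_pair_model D U \<delta> \<epsilon> M using M(1) by (rule optimal_pair_model)
  note r = first_random[OF interpreter_D, where n = n]
  have "le (emb n) l" if l: "ceq D (emb (code ?r)) l" for l
  proof (cases "complexity D ?r \<le> enat n")
    case True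
    then have "complexity D ?r = enat n" using r(2) by simp
    then have "C_eq D (string_tm ?r) (num n) \<in> theory_B D n" unfolding theory_B_def by blast
    then have "msat M e (C_eq D (string_tm ?r) (num n))" by (rule M(2))
    then have "ceq D (emb (code ?r)) (emb n)" by (simp add: msat_C_eq)
    then have "l = emb n" using l by (rule ceq_unique[rotated])
    then show ?thesis by simp
  next
    case False
    then have "code ?r \<notin> ?X" using inj_code by (auto simp: inj_eq)
    moreover have "set (sorted_list_of_set ?X) = ?X"
      using finite_complexity_le[OF interpreter_D] by (intro set_sorted_list_of_set finite_imageI)
    moreover have "msat M e ?\<psi>" by (rule M(2)) (simp add: theory_B_def)
    then have "msat M (case_nat (emb (code ?r)) e) (Impl (Conjs (map (\<lambda>m. Neg (Eql (Var 0) (num m)))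
        (sorted_list_of_set ?X))) (C_gt D (Var 0) (num n)))" unfolding msat.simps(4) by blast
    ultimately have "le (sc M (emb n)) l" using l by (auto simp: msat_C_gt)
    then show ?thesis using S_le_iff by blast
  qed
  then have "msat M e (C_ge D (string_tm ?r) (num n))" for e by (simp add: msat_C_ge)
  then show "msat M e T" using T PA unfolding theory_A_def by blast
qed (auto simp: theory_B_sentence theory_B_def)

end

section \<open>Closing the cycle of inclusions\<close>

lemma subtheory_trans: "subtheory S T \<Longrightarrow> subtheory T R \<Longrightarrow> subtheory S R"
  by (simp add: subtheory_def)

text \<open>A single constant b + c must serve both directions of every pair. Monotonicity is
  assumed for \<open>C\<close> only, so the inclusion of \<open>A\<close> in \<open>B\<close> at
  equal indices is shifted by going once round the cycle.\<close>

lemma subtheory_cycle: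
  assumes AB: "\<And>n. subtheory (A n) (B n)" and BC: "\<And>n. subtheory (B n) (C (n + b))"
    and CA: "\<And>n. subtheory (C n) (A (n + c))" and C: "\<And>m n. m \<le> n \<Longrightarrow> subtheory (C m) (C n)"
  shows "O1_equivalent A B \<and> O1_equivalent B C \<and> O1_equivalent A C"
proof -
  note trans = subtheory_trans
  have BA: "subtheory (B n) (A (n + (b + c)))" for n
    using trans[OF BC CA] by (simp add: add.assoc)
  have AB': "subtheory (A n) (B (n + (b + c)))" for n
    using trans[OF AB trans[OF BA AB]] .
  have BC': "subtheory (B n) (C (n + (b + c)))" for n
    using trans[OF BC C[of "n + b" "n + (b + c)"]] by simp
  have CA': "subtheory (C n) (A (n + (b + c)))" for n
    using trans[OF C[of n "n + b"] CA] by (simp add: add.assoc)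
  have "subtheory (C n) (B (n + (b + c)))" "subtheory (A n) (C (n + (b + c)))" for n
    using trans[OF CA' AB] trans[OF AB BC'] by auto
  then show ?thesis unfolding O1_equivalent_def using AB' BA BC' CA' by blast
qed

theorem theorem6:
  fixes D U :: fm
  assumes "provably_optimal D"
    and "optimal_universal U"
  shows "O1_equivalent (theory_A D) (theory_B D) \<and>
    O1_equivalent (theory_B D) (theory_C U) \<and>
    O1_equivalent (theory_A D) (theory_C U)"
proof -
  have "sigma1 D" "closed_fm (Suc (Suc 0)) D" "pi1 U" "closed_fm (Suc 0) U"
    using assms unfolding provably_optimal_def interpreter_def optimal_universal_def universal_def
    by (simp_all add: numeral_2_eq_2)
  note formulas = this
  obtain \<delta> where \<delta>: "delta0 \<delta>" "closed_fm (Suc (Suc (Suc 0))) \<delta>"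
    "\<forall>M e. PA_model M \<longrightarrow> msat M e D = (\<exists>w. msat M (case_nat w e) \<delta>)"
    using sigma1_normal_form[OF formulas(1,2)] by blast
  obtain \<epsilon> where \<epsilon>: "delta0 \<epsilon>" "closed_fm (Suc (Suc 0)) \<epsilon>"
    "\<forall>M e. PA_model M \<longrightarrow> (\<not> msat M e U) = (\<exists>w. msat M (case_nat w e) \<epsilon>)"
    using pi1_normal_form[OF formulas(3,4)] by blast
  interpret optimal_pair D U \<delta> \<epsilon>
    using assms \<delta> \<epsilon> by (intro optimal_pair.intro) blast+
  obtain b c where "\<And>n. subtheory (theory_B D n) (theory_C U (n + b))"
    "\<And>n. subtheory (theory_C U n) (theory_A D (n + c))"
    using theory_B_subset_C theory_C_subset_A by blast
  moreover have "subtheory (theory_C U m) (theory_C U n)" if "m \<le> n" for m n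
  proof -
    have "theory_C U m \<subseteq> theory_C U n"
      using that order_trans[of _ "enat m" "enat n"] unfolding theory_C_def by auto
    then show ?thesis unfolding subtheory_def using proves_mono by blast
  qed
  ultimately show ?thesis using theory_A_subset_B by (intro subtheory_cycle) blast+
qed

end
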